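(* Let $(X,d,\mathfrak{m})$ be a metric measure space which is either a very strict $CD^*(K,N)$-space (with $K\in\mathbb{R}$, $N\in(1,\infty)$) or a very strict $CD(K,N)$-space (with $K\in\mathbb{R}$, $N\in(1,\infty]$). Let $\mu_0,\mu_1\in\mathcal{P}_2^{ac}(X)$ have bounded supports, and let $\pi\in\mathrm{OptGeo}(\mu_0,\mu_1)$ be an optimal plan as provided by the defining condition of the very strict $CD^*(K,N)$ (respectively $CD(K,N)$) space, i.e. such that for every bounded non-negative Borel $F\colon\mathrm{Geo}(X)\to\mathbb{R}$ with $\int F\,d\pi=1$ and every $0\le t_1<t_2\le1$ the corresponding convexity inequality holds for $\tilde\pi=(\mathrm{restr}_{t_1}^{t_2})_\#(F\pi)$ at every $t\in[0,1]$. Then $\pi$ is induced by a Borel map $T\colon X\to\mathrm{Geo}(X)$, i.e. $\pi=T_\#\mu_0$ and $e_0\circ T=\mathrm{id}$.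
   Context: Standing assumptions: $(X,d)$ is complete and separable and $\mathfrak{m}$ is a locally finite Borel measure. $\mathrm{Geo}(X)$ is the set of constant speed geodesics $\gamma\colon[0,1]\to X$ with the sup metric, $e_t(\gamma)=\gamma_t$. $\mathcal{P}_2(X)$ is the set of Borel probability measures with finite second moment, $W_2$ the quadratic Wasserstein distance, $\mathcal{P}_2^{ac}(X)$ those measures in $\mathcal{P}_2(X)$ absolutely continuous w.r.t. $\mathfrak{m}$. $\mathrm{OptGeo}(\mu_0,\mu_1)$ is the set of $\pi\in\mathcal{P}(\mathrm{Geo}(X))$ with $(e_0,e_1)_\#\pi$ an optimal coupling of $\mu_0,\mu_1$ for the cost $d^2$. For $t_1<t_2$, $\mathrm{restr}_{t_1}^{t_2}(\gamma)(t)=\gamma(tt_2+(1-t)t_1)$; $\pi^{-1}$ is the pushforward of $\pi$ under $\gamma\mapsto\gamma(1-\cdot)$. Coefficients: for $K\in\mathbb{R}$, $N\in(0,\infty]$, $t\in[0,1]$, $\theta\ge0$: $\sigma^{(t)}_{K,N}(\theta)=t$ if $N=\infty$ or $K=0$; $=\infty$ if $K\theta^2\ge N\pi^2$; $=\sin(t\theta\sqrt{K/N})/\sin(\theta\sqrt{K/N})$ if $0<K\theta^2<N\pi^2$; $=\sinh(t\theta\sqrt{-K/N})/\sinh(\theta\sqrt{-K/N})$ if $K<0$. For $N\in(1,\infty)$: $\tau^{(t)}_{K,N}(\theta)=t^{1/N}(\sigma^{(t)}_{K,N-1}(\theta))^{(N-1)/N}$ and, for $t>0$, $\beta^{(t)}_{K,N}(\theta)=t^{1-N}(\sigma^{(t)}_{K,N-1}(\theta))^{N-1}$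 (which is $\infty$ if $K\theta^2>(N-1)\pi^2$); $\beta^{(t)}_{K,\infty}(\theta)=e^{\frac K6(1-t^2)\theta^2}$; $\beta^{(0)}_{K,N}\equiv1$. Entropies: write $\mu=\rho\mathfrak{m}+\mu^\perp$ (Lebesgue decomposition, $\mu^\perp(\{\rho>0\})=0$). For $N<\infty$, $\mathrm{Ent}_N(\mu)=-\int\rho^{1-1/N}\,d\mathfrak{m}$ (the paper writes $-\int\rho^{-1/N}d\mu$, with $\rho^{-1/N}$ contributing only on the absolutely continuous part); $\mathrm{Ent}_\infty(\mu)=\int\rho\log\rho\,d\mathfrak{m}+\infty\cdot\mu^\perp(X)$. For $\pi\in\mathcal{P}(\mathrm{Geo}(X))$ with $(e_0)_\#\pi=\mu_0=\rho_0\mathfrak{m}+\mu_0^\perp$: $\mathrm{Ent}^{(t)}_{N,\pi}(\mu_0)=-\int(\beta^{(t)}_{K,N}(d(\gamma_0,\gamma_1)))^{1/N}\rho_0(\gamma_0)^{-1/N}d\pi(\gamma)$ for $N<\infty$, and $\mathrm{Ent}^{(t)}_{\infty,\pi}(\mu_0)=\int\log\big(\rho_0(\gamma_0)/\beta^{(t)}_{K,\infty}(d(\gamma_0,\gamma_1))\big)d\pi+\infty\cdot\mu_0^\perp(X)$. Very strict $CD(K,N)$: for all $\mu_0,\mu_1\in\mathcal{P}_2^{ac}(X)$ with bounded supports there exists $\pi\in\mathrm{OptGeo}(\mu_0,\mu_1)$ such that for all bounded non-negative Borel $F$ on $\mathrm{Geo}(X)$ with $\int Fd\pi=1$, all $0\le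 t_1<t_2\le1$ and all $t\in[0,1]$, with $\tilde\pi=(\mathrm{restr}_{t_1}^{t_2})_\#(F\pi)$ and $\tilde\mu_t=(e_t)_\#\tilde\pi$: $\mathrm{Ent}_N(\tilde\mu_t)\le(1-t)\mathrm{Ent}^{(1-t)}_{N,\tilde\pi}(\tilde\mu_0)+t\,\mathrm{Ent}^{(t)}_{N,\tilde\pi^{-1}}(\tilde\mu_1)$. Very strict $CD^*(K,N)$ ($N<\infty$): the same, with the inequality replaced by $\mathrm{Ent}_N(\tilde\mu_t)\le-\int\big[\sigma^{(1-t)}_{K,N}(d(\gamma_0,\gamma_1))\tilde\rho_0^{-1/N}(\gamma_0)+\sigma^{(t)}_{K,N}(d(\gamma_0,\gamma_1))\tilde\rho_1^{-1/N}(\gamma_1)\big]d\tilde\pi(\gamma)$, $\tilde\rho_i$ the density of $\tilde\mu_i$. *)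

theory Defs
  imports "HOL-Analysis.Analysis" "HOL-Probability.Probability"
begin

definition mm_space :: "'a::polish_space measure \<Rightarrow> bool" where
  "mm_space m \<longleftrightarrow> sets m = sets borel \<and>
     (\<forall>x. \<exists>U. open U \<and> x \<in> U \<and> emeasure m U < \<infinity>)"

definition Geo :: "(real \<Rightarrow> 'a::metric_space) set" where
  "Geo = {\<gamma>. \<gamma> \<in> extensional {0..1} \<and>
      (\<forall>s\<in>{0..1}. \<forall>t\<in>{0..1}. dist (\<gamma> s) (\<gamma> t) = \<bar>s - t\<bar> * dist (\<gamma> 0) (\<gamma> 1))}"

definition supdist :: "(real \<Rightarrow> 'a::metric_space) \<Rightarrow> (real \<Rightarrow> 'a) \<Rightarrow> real" where
  "supdist \<gamma> \<eta> = (SUP t\<in>{0..1}. dist (\<gamma> t) (\<eta> t))"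

definition geo_open :: "(real \<Rightarrow> 'a::metric_space) set \<Rightarrow> bool" where
  "geo_open U \<longleftrightarrow> U \<subseteq> Geo \<and>
     (\<forall>\<gamma>\<in>U. \<exists>e>0. \<forall>\<eta>\<in>Geo. supdist \<gamma> \<eta> < e \<longrightarrow> \<eta> \<in> U)"

definition GeoM :: "(real \<Rightarrow> 'a::metric_space) measure" where
  "GeoM = sigma Geo {U. geo_open U}"

definition restr :: "real \<Rightarrow> real \<Rightarrow> (real \<Rightarrow> 'a) \<Rightarrow> (real \<Rightarrow> 'a)" where
  "restr t1 t2 \<gamma> = restrict (\<lambda>t. \<gamma> (t * t2 + (1 - t) * t1)) {0..1}"

definition reverse :: "(real \<Rightarrow> 'a) \<Rightarrow> (real \<Rightarrow> 'a)" where
  "reverse \<gamma> = restrict (\<lambda>t. \<gamma> (1 - t)) {0..1}"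

definition P2 :: "'a::polish_space measure \<Rightarrow> bool" where
  "P2 \<mu> \<longleftrightarrow> prob_space \<mu> \<and> sets \<mu> = sets borel \<and>
     (\<exists>x0. (\<integral>\<^sup>+x. ennreal ((dist x0 x)\<^sup>2) \<partial>\<mu>) < \<infinity>)"

definition P2ac :: "'a::polish_space measure \<Rightarrow> 'a measure \<Rightarrow> bool" where
  "P2ac m \<mu> \<longleftrightarrow> P2 \<mu> \<and> absolutely_continuous m \<mu>"

definition bounded_support :: "'a::metric_space measure \<Rightarrow> bool" where
  "bounded_support \<mu> \<longleftrightarrow> (\<exists>B. bounded B \<and> B \<in> sets borel \<and> emeasure \<mu> (UNIV - B) = 0)"

definition coupling :: "'a::polish_space measure \<Rightarrow> 'a measure \<Rightarrow> ('a \<times> 'a) measure \<Rightarrow> bool" where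
  "coupling \<mu>0 \<mu>1 \<sigma> \<longleftrightarrow> prob_space \<sigma> \<and> sets \<sigma> = sets borel \<and>
     distr \<sigma> borel fst = \<mu>0 \<and> distr \<sigma> borel snd = \<mu>1"

definition optimal_coupling :: "'a::polish_space measure \<Rightarrow> 'a measure \<Rightarrow> ('a \<times> 'a) measure \<Rightarrow> bool" where
  "optimal_coupling \<mu>0 \<mu>1 \<sigma> \<longleftrightarrow> coupling \<mu>0 \<mu>1 \<sigma> \<and>
     (\<forall>\<sigma>'. coupling \<mu>0 \<mu>1 \<sigma>' \<longrightarrow>
        (\<integral>\<^sup>+p. ennreal ((dist (fst p) (snd p))\<^sup>2) \<partial>\<sigma>) \<le> (\<integral>\<^sup>+p. ennreal ((dist (fst p) (snd p))\<^sup>2) \<partial>\<sigma>'))"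

definition OptGeo :: "'a::polish_space measure \<Rightarrow> 'a measure \<Rightarrow> (real \<Rightarrow> 'a) measure \<Rightarrow> bool" where
  "OptGeo \<mu>0 \<mu>1 \<pi> \<longleftrightarrow> prob_space \<pi> \<and> sets \<pi> = sets GeoM \<and>
     optimal_coupling \<mu>0 \<mu>1 (distr \<pi> borel (\<lambda>\<gamma>. (\<gamma> 0, \<gamma> 1)))"

text \<open>mu = rho m + mu_perp, where mu_perp = mu restricted to the m-null Borel set S.\<close>
definition leb_decomp :: "'a::polish_space measure \<Rightarrow> 'a measure \<Rightarrow> ('a \<Rightarrow> real) \<Rightarrow> 'a set \<Rightarrow> bool" where
  "leb_decomp m \<mu> \<rho> S \<longleftrightarrow> \<rho> \<in> borel_measurable borel \<and> (\<forall>x. 0 \<le> \<rho> x) \<and>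
     S \<in> sets borel \<and> emeasure m S = 0 \<and> (\<forall>x\<in>S. \<rho> x = 0) \<and>
     (\<forall>A\<in>sets borel. emeasure \<mu> A = (\<integral>\<^sup>+x\<in>A. ennreal (\<rho> x) \<partial>m) + emeasure \<mu> (A \<inter> S))"

definition dens :: "'a::polish_space measure \<Rightarrow> 'a measure \<Rightarrow> 'a \<Rightarrow> real" where
  "dens m \<mu> = fst (SOME p. leb_decomp m \<mu> (fst p) (snd p))"

definition sing :: "'a::polish_space measure \<Rightarrow> 'a measure \<Rightarrow> 'a set" where
  "sing m \<mu> = snd (SOME p. leb_decomp m \<mu> (fst p) (snd p))"

definition eint :: "'b measure \<Rightarrow> ('b \<Rightarrow> real) \<Rightarrow> ereal" where
  "eint M f = enn2ereal (\<integral>\<^sup>+x. ennreal (f x) \<partial>M) - enn2ereal (\<integral>\<^sup>+x. ennreal (- f x) \<partial>M)"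

text \<open>sigma^(t)_{K,N}(theta) for real N > 0 (value infinity allowed); at theta = 0 the
  (limit) value t is used.\<close>
definition sigmaKN :: "real \<Rightarrow> real \<Rightarrow> real \<Rightarrow> real \<Rightarrow> ennreal" where
  "sigmaKN K N t \<theta> =
     (if K = 0 \<or> \<theta> = 0 then ennreal t
      else if K * \<theta>\<^sup>2 \<ge> N * pi\<^sup>2 then \<infinity>
      else if K > 0 then ennreal (sin (t * \<theta> * sqrt (K / N)) / sin (\<theta> * sqrt (K / N)))
      else ennreal (sinh (t * \<theta> * sqrt (- K / N)) / sinh (\<theta> * sqrt (- K / N))))"

definition beta_root :: "real \<Rightarrow> real \<Rightarrow> real \<Rightarrow> real \<Rightarrow> ennreal" where
  "beta_root K N t \<theta> =
     (if t = 0 then 1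
      else if sigmaKN K (N - 1) t \<theta> = \<infinity> then \<infinity>
      else ennreal ((t powr (1 - N) * (enn2real (sigmaKN K (N - 1) t \<theta>)) powr (N - 1)) powr (1 / N)))"

definition beta_inf :: "real \<Rightarrow> real \<Rightarrow> real \<Rightarrow> real" where
  "beta_inf K t \<theta> = exp (K / 6 * (1 - t\<^sup>2) * \<theta>\<^sup>2)"

definition sing_mass :: "'a::polish_space measure \<Rightarrow> 'a measure \<Rightarrow> ennreal" where
  "sing_mass m \<mu> = emeasure \<mu> (sing m \<mu>)"

definition Ent_fin :: "'a::polish_space measure \<Rightarrow> real \<Rightarrow> 'a measure \<Rightarrow> ereal" where
  "Ent_fin m N \<mu> = - enn2ereal (\<integral>\<^sup>+x. ennreal (dens m \<mu> x powr (1 - 1 / N)) \<partial>m)"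

definition Ent_inf :: "'a::polish_space measure \<Rightarrow> 'a measure \<Rightarrow> ereal" where
  "Ent_inf m \<mu> = eint m (\<lambda>x. dens m \<mu> x * ln (dens m \<mu> x))
      + (if sing_mass m \<mu> = 0 then 0 else \<infinity>)"

definition inv_root_dens :: "'a::polish_space measure \<Rightarrow> real \<Rightarrow> 'a measure \<Rightarrow> 'a \<Rightarrow> ennreal" where
  "inv_root_dens m N \<mu> x = (if x \<in> sing m \<mu> then 0 else ennreal (dens m \<mu> x powr (- 1 / N)))"

definition Ent_fin_pi :: "'a::polish_space measure \<Rightarrow> real \<Rightarrow> real \<Rightarrow> real
     \<Rightarrow> (real \<Rightarrow> 'a) measure \<Rightarrow> 'a measure \<Rightarrow> ereal" where
  "Ent_fin_pi m K N t \<pi> \<mu>0 =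
     - enn2ereal (\<integral>\<^sup>+\<gamma>. beta_root K N t (dist (\<gamma> 0) (\<gamma> 1)) * inv_root_dens m N \<mu>0 (\<gamma> 0) \<partial>\<pi>)"

definition Ent_inf_pi :: "'a::polish_space measure \<Rightarrow> real \<Rightarrow> real
     \<Rightarrow> (real \<Rightarrow> 'a) measure \<Rightarrow> 'a measure \<Rightarrow> ereal" where
  "Ent_inf_pi m K t \<pi> \<mu>0 =
     eint \<pi> (\<lambda>\<gamma>. ln (dens m \<mu>0 (\<gamma> 0) / beta_inf K t (dist (\<gamma> 0) (\<gamma> 1))))
      + (if sing_mass m \<mu>0 = 0 then 0 else \<infinity>)"

definition admissible_density :: "(real \<Rightarrow> 'a::metric_space) measure \<Rightarrow> ((real \<Rightarrow> 'a) \<Rightarrow> real) \<Rightarrow> bool" where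
  "admissible_density \<pi> F \<longleftrightarrow> F \<in> borel_measurable GeoM \<and> (\<forall>\<gamma>. 0 \<le> F \<gamma>) \<and>
     (\<exists>C. \<forall>\<gamma>. F \<gamma> \<le> C) \<and> (\<integral>\<^sup>+\<gamma>. ennreal (F \<gamma>) \<partial>\<pi>) = 1"

definition pi_tilde :: "(real \<Rightarrow> 'a::metric_space) measure \<Rightarrow> ((real \<Rightarrow> 'a) \<Rightarrow> real) \<Rightarrow> real \<Rightarrow> real
     \<Rightarrow> (real \<Rightarrow> 'a) measure" where
  "pi_tilde \<pi> F t1 t2 = distr (density \<pi> (\<lambda>\<gamma>. ennreal (F \<gamma>))) GeoM (restr t1 t2)"

definition marg :: "(real \<Rightarrow> 'a::polish_space) measure \<Rightarrow> real \<Rightarrow> 'a measure" where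
  "marg \<pi> t = distr \<pi> borel (\<lambda>\<gamma>. \<gamma> t)"

definition CD_plan :: "'a::polish_space measure \<Rightarrow> real \<Rightarrow> ereal \<Rightarrow> (real \<Rightarrow> 'a) measure \<Rightarrow> bool" where
  "CD_plan m K N \<pi> \<longleftrightarrow>
    (\<forall>F t1 t2 t. admissible_density \<pi> F \<and> 0 \<le> t1 \<and> t1 < t2 \<and> t2 \<le> 1 \<and> 0 \<le> t \<and> t \<le> 1 \<longrightarrow>
      (let \<pi>' = pi_tilde \<pi> F t1 t2; \<pi>r = distr \<pi>' GeoM reverse in
       if N = \<infinity> then
         Ent_inf m (marg \<pi>' t) \<le>
           ereal (1 - t) * Ent_inf_pi m K (1 - t) \<pi>' (marg \<pi>' 0)
           + ereal t * Ent_inf_pi m K t \<pi>r (marg \<pi>' 1)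
       else
         Ent_fin m (real_of_ereal N) (marg \<pi>' t) \<le>
           ereal (1 - t) * Ent_fin_pi m K (real_of_ereal N) (1 - t) \<pi>' (marg \<pi>' 0)
           + ereal t * Ent_fin_pi m K (real_of_ereal N) t \<pi>r (marg \<pi>' 1)))"

definition CDstar_plan :: "'a::polish_space measure \<Rightarrow> real \<Rightarrow> real \<Rightarrow> (real \<Rightarrow> 'a) measure \<Rightarrow> bool" where
  "CDstar_plan m K N \<pi> \<longleftrightarrow>
    (\<forall>F t1 t2 t. admissible_density \<pi> F \<and> 0 \<le> t1 \<and> t1 < t2 \<and> t2 \<le> 1 \<and> 0 \<le> t \<and> t \<le> 1 \<longrightarrow>
      (let \<pi>' = pi_tilde \<pi> F t1 t2 in
         Ent_fin m N (marg \<pi>' t) \<le>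
           - enn2ereal (\<integral>\<^sup>+\<gamma>. sigmaKN K N (1 - t) (dist (\<gamma> 0) (\<gamma> 1)) * inv_root_dens m N (marg \<pi>' 0) (\<gamma> 0)
                + sigmaKN K N t (dist (\<gamma> 0) (\<gamma> 1)) * inv_root_dens m N (marg \<pi>' 1) (\<gamma> 1) \<partial>\<pi>')))"

definition very_strict_CD :: "'a::polish_space measure \<Rightarrow> real \<Rightarrow> ereal \<Rightarrow> bool" where
  "very_strict_CD m K N \<longleftrightarrow>
    (\<forall>\<mu>0 \<mu>1. P2ac m \<mu>0 \<and> P2ac m \<mu>1 \<and> bounded_support \<mu>0 \<and> bounded_support \<mu>1 \<longrightarrow>
       (\<exists>\<pi>. OptGeo \<mu>0 \<mu>1 \<pi> \<and> CD_plan m K N \<pi>))"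

definition very_strict_CDstar :: "'a::polish_space measure \<Rightarrow> real \<Rightarrow> real \<Rightarrow> bool" where
  "very_strict_CDstar m K N \<longleftrightarrow>
    (\<forall>\<mu>0 \<mu>1. P2ac m \<mu>0 \<and> P2ac m \<mu>1 \<and> bounded_support \<mu>0 \<and> bounded_support \<mu>1 \<longrightarrow>
       (\<exists>\<pi>. OptGeo \<mu>0 \<mu>1 \<pi> \<and> CDstar_plan m K N \<pi>))"

end

theory Submission
  imports Defs "HOL-Real_Asymp.Real_Asymp"
begin

text \<open>For finite \<open>N\<close> put \<open>H = - N ln (- Ent_N)\<close>, for \<open>N = \<infinity>\<close> let \<open>H\<close> be the Boltzmann entropy.
  In both cases \<open>H\<close> drops by \<open>ln 2\<close> when two mutually singular measures are mixed, \<open>H \<ge> - ln (m V)\<close>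
  for probability measures on \<open>V\<close>, with equality for the uniform one, and the curvature condition bounds
  the increments of \<open>H\<close> along a plan of density at most \<open>R\<close> by a constant times \<open>(1 + ln R)\<close> times
  the time step.

  Suppose that an event \<open>\<gamma> b \<in> B\<close> can be predicted from \<open>\<gamma> a\<close> only with an error \<open>q > 0\<close>. Then there are
  two plans of density at most \<open>1/q\<close> which agree at time \<open>a\<close> and are mutually singular at time \<open>b\<close>;
  comparing \<open>H\<close> of their mixture at the two times gives \<open>ln 2 \<le> C (b - a) (1 + ln (1/q))\<close>, so \<open>q\<close> is
  \<open>o(b - a)\<close>. Chaining the predictions over a fine partition shows that \<open>\<gamma> s\<close> determines \<open>\<gamma> s'\<close> for
  \<open>0 < s < s' < 1\<close>. Hence two plans with the same initial law which are singular at time \<open>s'\<close> are singular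
  at every time in \<open>(0, s']\<close>; taking the initial law uniform on a compact set \<open>E\<close> and letting the time
  tend to \<open>0\<close>, the bound \<open>H \<ge> - ln (m V)\<close> on neighbourhoods \<open>V\<close> of \<open>E\<close> contradicts the drop by \<open>ln 2\<close>.
  So \<open>\<gamma> 0\<close> determines \<open>\<gamma>\<close>. All this is done on sets of geodesics on which the end densities are
  bounded and which stay in a set of finite reference measure; these sets exhaust the plan.\<close>

section \<open>The space of geodesics\<close>

text \<open>The logarithm in \<open>H\<close> makes the two kinds of curvature condition alike. For
  finite N they give multiplicative bounds on the integral of the density to the power
  \<open>1 - 1/N\<close>; these become additive, and the factor N makes the drop \<open>ln 2\<close>
  and the value \<open>- ln (m E)\<close> of a uniform law independent of N. Increments of
  \<open>H\<close> come from interpolation on \<open>[a, 1]\<close> (forward) or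
  \<open>[0, b]\<close> (backward), where a short step is a small fraction of the interval. The
  backward fraction \<open>(b - a) / b\<close> equals 1 for \<open>a = 0\<close>, so no estimate
  leads from a small time back to time 0. This obstacle forces a separate argument at the initial
  time, where a lower bound for \<open>H\<close> by the volume of the region already reached takes
  the place of the backward estimate. It is essential that R enters only through
  \<open>ln R\<close>: the plans have density \<open>1/q\<close> with \<open>q\<close> possibly as
  small as a multiple of the step h, and \<open>h ln (1/h)\<close> tends to 0. Since about
  \<open>1/h\<close> predictions are chained, an error merely of order h would not suffice. Time 1
  is avoided, because the forward bound degenerates there and a geodesic is determined by its values
  on \<open>[0, 1)\<close>.\<close>

lemma Geo_dist:
  "\<gamma> \<in> Geo \<Longrightarrow> s \<in> {0..1} \<Longrightarrow> t \<in> {0..1} \<Longrightarrow> dist (\<gamma> s) (\<gamma> t) = \<bar>s - t\<bar> * dist (\<gamma> 0) (\<gamma> 1)"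
  unfolding Geo_def by blast

lemma Geo_dist_le:
  assumes "\<gamma> \<in> Geo" "s \<in> {0..1}" "t \<in> {0..1}"
  shows "dist (\<gamma> s) (\<gamma> t) \<le> dist (\<gamma> 0) (\<gamma> 1)"
proof -
  have "\<bar>s - t\<bar> \<le> 1" using assms by auto
  then show ?thesis using mult_right_mono[of "\<bar>s - t\<bar>" 1 "dist (\<gamma> 0) (\<gamma> 1)"]
    by (simp add: Geo_dist[OF assms])
qed

text \<open>A real-valued \<open>SUP\<close> bounds its members only if they are bounded above. Here
  the bound is the sum of the two lengths and the distance of the starting points.\<close>

lemma dist_le_supdist:
  assumes "\<gamma> \<in> Geo" "\<eta> \<in> Geo" "t \<in> {0..1}"
  shows "dist (\<gamma> t) (\<eta> t) \<le> supdist \<gamma> \<eta>"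
proof -
  have "dist (\<gamma> s) (\<eta> s) \<le> dist (\<gamma> 0) (\<gamma> 1) + dist (\<gamma> 0) (\<eta> 0) + dist (\<eta> 0) (\<eta> 1)"
    if "s \<in> {0..1}" for s
    using Geo_dist_le[OF assms(1) that, of 0] Geo_dist_le[OF assms(2) that, of 0]
      dist_triangle[of "\<gamma> s" "\<eta> s" "\<gamma> 0"] dist_triangle[of "\<gamma> 0" "\<eta> s" "\<eta> 0"]
    by (simp add: dist_commute)
  then have "bdd_above ((\<lambda>s. dist (\<gamma> s) (\<eta> s)) ` {0..1})"
    by (rule bdd_aboveI2)
  then show ?thesis unfolding supdist_def by (rule cSUP_upper[OF assms(3)])
qed

lemma supdist_le: "(\<And>t. t \<in> {0..1} \<Longrightarrow> dist (\<gamma> t) (\<eta> t) \<le> e) \<Longrightarrow> supdist \<gamma> \<eta> \<le> e"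
  unfolding supdist_def by (rule cSUP_least) auto

lemma geo_open_Pow: "{U. geo_open U} \<subseteq> Pow Geo"
  by (auto simp: geo_open_def)

lemma space_GeoM [simp]: "space GeoM = Geo"
  unfolding GeoM_def by (rule space_measure_of[OF geo_open_Pow])

lemma geo_open_sets: "geo_open U \<Longrightarrow> U \<in> sets GeoM"
  unfolding GeoM_def sets_measure_of[OF geo_open_Pow] by auto

text \<open>Evaluation is 1-Lipschitz for \<open>supdist\<close>, so preimages of open sets are
  \<open>geo_open\<close>.\<close>

lemma measurable_eval:
  assumes "t \<in> {0..1}"
  shows "(\<lambda>\<gamma>. \<gamma> t) \<in> GeoM \<rightarrow>\<^sub>M borel"
proof (rule borel_measurableI)
  fix S :: "'a set" assume "open S"
  have "geo_open ((\<lambda>\<gamma>. \<gamma> t) -` S \<inter> Geo)"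
    unfolding geo_open_def
  proof safe
    fix \<gamma> :: "real \<Rightarrow> 'a" assume "\<gamma> \<in> Geo" "\<gamma> t \<in> S"
    then obtain e where "e > 0" "\<And>y. dist y (\<gamma> t) < e \<Longrightarrow> y \<in> S"
      using \<open>open S\<close> unfolding open_dist by blast
    then show "\<exists>e>0. \<forall>\<eta>\<in>Geo. supdist \<gamma> \<eta> < e \<longrightarrow> \<eta> \<in> (\<lambda>\<gamma>. \<gamma> t) -` S \<inter> Geo"
      using dist_le_supdist[OF \<open>\<gamma> \<in> Geo\<close> _ assms]
      by (intro exI[of _ e]) (fastforce simp: dist_commute)
  qed
  then show "(\<lambda>\<gamma>. \<gamma> t) -` S \<inter> space GeoM \<in> sets GeoM"
    by (simp add: geo_open_sets)
qed

text \<open>The length of the list doubles as the number of grid points, so a cylinder is coded by a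
  single finite list and a countable basis yields only countably many cylinders.\<close>

definition cyl :: "'a::metric_space set list \<Rightarrow> (real \<Rightarrow> 'a) set" where
  "cyl l = {\<gamma> \<in> Geo. \<forall>i<length l. \<gamma> (real i / real (length l)) \<in> l ! i}"

lemma cyl_times: "i < length l \<Longrightarrow> real i / real (length l) \<in> {0..<1}"
  by (auto simp: divide_simps)

text \<open>The grid times stay below 1, so that the terminal time never has to be treated.\<close>

lemma cyl_small:
  fixes \<gamma> :: "real \<Rightarrow> 'a::metric_space"
  assumes \<gamma>: "\<gamma> \<in> Geo" and e: "e > 0" and \<B>: "topological_basis \<B>"
  shows "\<exists>l\<in>lists \<B>. \<gamma> \<in> cyl l \<and> (\<forall>\<eta>\<in>cyl l. \<forall>t\<in>{0..1}. dist (\<gamma> t) (\<eta> t) \<le> e)"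
proof -
  define L where "L = dist (\<gamma> 0) (\<gamma> 1)"
  have L0: "L \<ge> 0" by (simp add: L_def)
  obtain n0 :: nat where n0: "(2 * L + e) / (e / 2) < real n0" using reals_Archimedean2 by blast
  \<comment> \<open>At least two grid points, so that the last grid time \<open>r\<close> below is
    at least 1/2; \<open>n0\<close> makes the motion of both geodesics within one grid cell
    small.\<close>
  define n where "n = max 2 n0"
  have n2: "n \<ge> 2" by (simp add: n_def)
  have "(2 * L + e) / (e / 2) < real n" using n0 by (simp add: n_def)
  then have n: "(2 * L + e) / real n \<le> e / 2" using e n2 by (simp add: field_simps)
  have "\<exists>V\<in>\<B>. x \<in> V \<and> V \<subseteq> ball x (e / 4)" for x
    using topological_basisE[OF \<B>, of "ball x (e/4)" x] e by auto
  then obtain V where V: "\<And>x. V x \<in> \<B>" "\<And>x. x \<in> V x" "\<And>x. V x \<subseteq> ball x (e / 4)" by metis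
  define l where "l = map (\<lambda>i. V (\<gamma> (real i / real n))) [0..<n]"
  have len: "length l = n" by (simp add: l_def)
  have "l \<in> lists \<B>" using V(1) by (auto simp: l_def)
  moreover have "\<gamma> \<in> cyl l" using \<gamma> V(2) by (auto simp: cyl_def l_def)
  moreover have "dist (\<gamma> t) (\<eta> t) \<le> e" if \<eta>: "\<eta> \<in> cyl l" and t: "t \<in> {0..1}" for \<eta> t
  proof -
    have \<eta>G: "\<eta> \<in> Geo" using \<eta> by (simp add: cyl_def)
    have near: "dist (\<gamma> (real i / real n)) (\<eta> (real i / real n)) < e / 4" if "i < n" for i
    proof -
      have "\<eta> (real i / real n) \<in> V (\<gamma> (real i / real n))"
        using \<eta> that by (auto simp: cyl_def l_def)
      then have "\<eta> (real i / real n) \<in> ball (\<gamma> (real i / real n)) (e / 4)" using V(3) by (rule subsetD[rotated])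
      then show ?thesis by (simp only: mem_ball)
    qed
    \<comment> \<open>The length of \<open>\<eta>\<close> is read off between time 0 and the last
      grid time \<open>r\<close>; dividing by \<open>r \<ge> 1/2\<close> at most doubles the error
      \<open>e / 2\<close>.\<close>
    define L' where "L' = dist (\<eta> 0) (\<eta> 1)"
    define r where "r = real (n - 1) / real n"
    have r: "r \<in> {0..1}" "r \<ge> 1/2" using n2 by (auto simp: r_def field_simps of_nat_diff)
    have "r * L' = dist (\<eta> 0) (\<eta> r)" using Geo_dist[OF \<eta>G, of 0 r] r by (simp add: L'_def)
    also have "\<dots> \<le> dist (\<eta> 0) (\<gamma> 0) + dist (\<gamma> 0) (\<gamma> r) + dist (\<gamma> r) (\<eta> r)"
      using dist_triangle[of "\<eta> 0" "\<eta> r" "\<gamma> 0"] dist_triangle[of "\<gamma> 0" "\<eta> r" "\<gamma> r"] by linarith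
    also have "\<dots> \<le> e / 4 + r * L + e / 4"
      using near[of 0] near[of "n - 1"] n2 Geo_dist[OF \<gamma>, of 0 r] r
      by (simp add: L_def r_def dist_commute)
    finally have "r * (L' - L) \<le> e / 2" by (simp add: algebra_simps)
    then have L': "L' \<le> L + e"
    proof (cases "L' \<le> L")
      case False
      then have "1/2 * (L' - L) \<le> r * (L' - L)" using r by (intro mult_right_mono) auto
      then have "1/2 * (L' - L) \<le> e / 2" using \<open>r * (L' - L) \<le> e / 2\<close> by (rule order_trans)
      then show ?thesis by simp
    qed (use e in auto)
    \<comment> \<open>The \<open>min\<close> matters only for \<open>t = 1\<close>, where the floor
      is \<open>n\<close>; the last grid point is still within one cell.\<close>
    define i where "i = min (nat \<lfloor>t * real n\<rfloor>) (n - 1)"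
    define s where "s = real i / real n"
    have i: "i < n" using n2 by (auto simp: i_def)
    have s: "s \<in> {0..1}" using i by (auto simp: s_def divide_simps)
    have tn: "0 \<le> t * real n" "t * real n \<le> real n" using mult_right_mono[of t 1 "real n"] t by auto
    have "\<bar>t * real n - real i\<bar> \<le> 1"
    proof (cases "nat \<lfloor>t * real n\<rfloor> \<le> n - 1")
      case True
      then have "real i = of_int \<lfloor>t * real n\<rfloor>" using tn by (simp add: i_def)
      then show ?thesis by linarith
    next
      case False
      then have "real i = real n - 1" using n2 by (simp add: i_def of_nat_diff)
      moreover have "int n \<le> \<lfloor>t * real n\<rfloor>" using False n2 by linarith
      then have "real n \<le> t * real n" by (simp add: le_floor_iff)
      ultimately show ?thesis using tn by linarith
    qed
    moreover have "t - s = (t * real n - real i) / real n" using n2 by (simp add: s_def field_simps)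
    ultimately have ts: "\<bar>t - s\<bar> \<le> 1 / real n" by (simp add: divide_right_mono)
    have "dist (\<gamma> t) (\<eta> t) \<le> dist (\<gamma> t) (\<gamma> s) + dist (\<gamma> s) (\<eta> s) + dist (\<eta> s) (\<eta> t)"
      using dist_triangle[of "\<gamma> t" "\<eta> t" "\<gamma> s"] dist_triangle[of "\<gamma> s" "\<eta> t" "\<eta> s"] by linarith
    also have "\<dots> \<le> \<bar>t - s\<bar> * L + e / 4 + \<bar>t - s\<bar> * L'"
      using near[OF i] Geo_dist[OF \<gamma> t s] Geo_dist[OF \<eta>G s t]
      by (simp add: L_def L'_def s_def abs_minus_commute)
    also have "\<dots> = \<bar>t - s\<bar> * (L + L') + e / 4" by (simp add: algebra_simps)
    also have "\<dots> \<le> (1 / real n) * (2 * L + e) + e / 4"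
      using ts L' L0 e by (intro add_right_mono mult_mono) (auto simp: L'_def)
    also have "\<dots> \<le> e" using n e unfolding times_divide_eq_left mult_1 by linarith
    finally show ?thesis .
  qed
  ultimately show ?thesis by blast
qed


text \<open>By \<open>cyl_small\<close> and second countability every \<open>geo_open\<close> set is
  a countable union of cylinders over a countable basis, so the evaluations at times below 1
  generate \<open>GeoM\<close>. Restriction, reversal and the final map \<open>T\<close> are shown
  measurable in this way.\<close>

lemma measurable_GeoM:
  fixes f :: "'b \<Rightarrow> real \<Rightarrow> 'a::polish_space"
  assumes f: "f \<in> space M \<rightarrow> Geo" and ev: "\<And>t. t \<in> {0..<1} \<Longrightarrow> (\<lambda>x. f x t) \<in> M \<rightarrow>\<^sub>M borel"
  shows "f \<in> M \<rightarrow>\<^sub>M GeoM"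
  unfolding GeoM_def
proof (rule measurable_measure_of[OF geo_open_Pow f])
  fix U :: "(real \<Rightarrow> 'a) set" assume "U \<in> {U. geo_open U}"
  then have U: "geo_open U" by simp
  obtain \<B> :: "'a set set" where \<B>: "countable \<B>" "topological_basis \<B>" using ex_countable_basis by auto
  define \<C> where "\<C> = {l \<in> lists \<B>. cyl l \<subseteq> U}"
  have "U = (\<Union>l\<in>\<C>. cyl l)"
  proof safe
    fix \<gamma> assume "\<gamma> \<in> U"
    then obtain e where e: "e > 0" "\<And>\<eta>. \<eta> \<in> Geo \<Longrightarrow> supdist \<gamma> \<eta> < e \<Longrightarrow> \<eta> \<in> U" and G: "\<gamma> \<in> Geo"
      using U unfolding geo_open_def by blast
    obtain l where l: "l \<in> lists \<B>" "\<gamma> \<in> cyl l" "\<forall>\<eta>\<in>cyl l. \<forall>t\<in>{0..1}. dist (\<gamma> t) (\<eta> t) \<le> e / 2"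
      using cyl_small[OF G _ \<B>(2), of "e/2"] e by auto
    have "cyl l \<subseteq> U"
    proof
      fix \<eta> assume \<eta>: "\<eta> \<in> cyl l"
      have "supdist \<gamma> \<eta> \<le> e / 2" using l(3) \<eta> by (intro supdist_le) auto
      then show "\<eta> \<in> U" using e \<eta> by (intro e(2)) (auto simp: cyl_def)
    qed
    then show "\<gamma> \<in> (\<Union>l\<in>\<C>. cyl l)" using l by (auto simp: \<C>_def)
  qed (auto simp: \<C>_def)
  then have "f -` U \<inter> space M = (\<Union>l\<in>\<C>. f -` cyl l \<inter> space M)" by blast
  also have "\<dots> \<in> sets M"
  proof (rule sets.countable_UN'')
    show "countable \<C>" using \<B>(1) by (auto simp: \<C>_def intro: countable_subset[of _ "lists \<B>"])
    fix l assume "l \<in> \<C>"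
    have op: "open (l ! i)" if "i < length l" for i
      using \<open>l \<in> \<C>\<close> that topological_basis_open[OF \<B>(2)] by (auto simp: \<C>_def in_lists_conv_set)
    have "f -` cyl l \<inter> space M =
        space M \<inter> (\<Inter>i\<in>{..<length l}. (\<lambda>x. f x (real i / real (length l))) -` (l ! i) \<inter> space M)"
      using f by (auto simp: cyl_def)
    also have "\<dots> \<in> sets M"
    proof (cases "l = []")
      case False
      then show ?thesis
        using op by (intro sets.Int sets.finite_INT measurable_sets[OF ev] cyl_times) auto
    qed auto
    finally show "f -` cyl l \<inter> space M \<in> sets M" .
  qed
  finally show "f -` U \<inter> space M \<in> sets M" .
qed

section \<open>Restriction and reversal of geodesics\<close>

lemma affine_time: "t1 \<in> {0..1} \<Longrightarrow> t2 \<in> {0..1} \<Longrightarrow> t \<in> {0..1} \<Longrightarrow> t * t2 + (1 - t) * t1 \<in> {0..1::real}"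
  by (auto intro: convex_bound_le add_nonneg_nonneg mult_nonneg_nonneg)

lemma restr_Geo:
  assumes "\<gamma> \<in> Geo" "t1 \<in> {0..1}" "t2 \<in> {0..1}"
  shows "restr t1 t2 \<gamma> \<in> Geo"
  unfolding Geo_def
proof safe
  show "restr t1 t2 \<gamma> \<in> extensional {0..1}" by (simp add: restr_def)
  fix s t :: real assume st: "s \<in> {0..1}" "t \<in> {0..1}"
  have *: "(s * t2 + (1 - s) * t1) - (t * t2 + (1 - t) * t1) = (s - t) * (t2 - t1)"
    by (simp add: algebra_simps)
  show "dist (restr t1 t2 \<gamma> s) (restr t1 t2 \<gamma> t) = \<bar>s - t\<bar> * dist (restr t1 t2 \<gamma> 0) (restr t1 t2 \<gamma> 1)"
    using Geo_dist[OF assms] Geo_dist[OF assms(1) affine_time[OF assms(2,3) st(1)] affine_time[OF assms(2,3) st(2)]] st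
    unfolding * by (simp add: restr_def abs_mult abs_minus_commute)
qed

lemma reverse_Geo:
  assumes "\<gamma> \<in> Geo"
  shows "reverse \<gamma> \<in> Geo"
  unfolding Geo_def
proof safe
  show "reverse \<gamma> \<in> extensional {0..1}" by (simp add: reverse_def)
  fix s t :: real assume st: "s \<in> {0..1}" "t \<in> {0..1}"
  show "dist (reverse \<gamma> s) (reverse \<gamma> t) = \<bar>s - t\<bar> * dist (reverse \<gamma> 0) (reverse \<gamma> 1)"
    using Geo_dist[OF assms, of "1 - s" "1 - t"] st
    by (simp add: reverse_def abs_minus_commute dist_commute[of "\<gamma> 1"])
qed

lemma restr_measurable [measurable]:
  assumes "t1 \<in> {0..1}" "t2 \<in> {0..1}"
  shows "restr t1 t2 \<in> GeoM \<rightarrow>\<^sub>M (GeoM :: (real \<Rightarrow> 'a::polish_space) measure)"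
proof (rule measurable_GeoM)
  fix t :: real assume "t \<in> {0..<1}"
  then show "(\<lambda>\<gamma>. restr t1 t2 \<gamma> t) \<in> GeoM \<rightarrow>\<^sub>M (borel :: 'a measure)"
    using measurable_eval[OF affine_time[OF assms, of t]] by (simp add: restr_def)
qed (use assms restr_Geo in auto)

lemma reverse_measurable [measurable]: "reverse \<in> GeoM \<rightarrow>\<^sub>M (GeoM :: (real \<Rightarrow> 'a::polish_space) measure)"
proof (rule measurable_GeoM)
  fix t :: real assume "t \<in> {0..<1}"
  then show "(\<lambda>\<gamma>. reverse \<gamma> t) \<in> GeoM \<rightarrow>\<^sub>M (borel :: 'a measure)"
    using measurable_eval[of "1 - t"] by (simp add: reverse_def)
qed (use reverse_Geo in auto)

section \<open>Prediction of events\<close>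

text \<open>Radon-Nikodym with real values: the density of a finite measure is finite almost
  everywhere, and \<open>enn2real\<close> sends the exceptional values to 0.\<close>

lemma real_valued_density:
  assumes "sigma_finite_measure m" and fin: "finite_measure \<mu>"
    and sets: "sets \<mu> = sets m" and ac: "absolutely_continuous m \<mu>"
  shows "\<exists>\<rho>\<in>borel_measurable m. (\<forall>x. 0 \<le> \<rho> x) \<and> \<mu> = density m (\<lambda>x. ennreal (\<rho> x))"
proof -
  interpret sigma_finite_measure m by fact
  obtain f where f: "f \<in> borel_measurable m" "density m f = \<mu>"
    using Radon_Nikodym[OF ac sets] by auto
  have "(\<integral>\<^sup>+x. f x \<partial>m) = emeasure \<mu> (space \<mu>)"
    using f(1) unfolding f(2)[symmetric] by (simp add: emeasure_density cong: nn_integral_cong)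
  then have "AE x in m. f x \<noteq> \<infinity>"
    using finite_measure.emeasure_finite[OF fin] f(1) by (intro nn_integral_PInf_AE) auto
  then have "density m f = density m (\<lambda>x. ennreal (enn2real (f x)))"
    using f(1) by (intro density_cong) (auto simp: ennreal_enn2real_if elim!: eventually_mono)
  then show ?thesis
    using f by (intro bexI[of _ "\<lambda>x. enn2real (f x)"]) auto
qed

lemma emeasure_distr_density:
  fixes F :: "'b \<Rightarrow> real"
  assumes [measurable]: "X \<in> M \<rightarrow>\<^sub>M N" "F \<in> borel_measurable M" "C \<in> sets N"
  shows "emeasure (distr (density M (\<lambda>y. ennreal (F y))) N X) C =
    (\<integral>\<^sup>+y. ennreal (F y) * indicator C (X y) \<partial>M)"
  by (simp add: emeasure_distr emeasure_density)
    (auto intro!: nn_integral_cong simp: indicator_def)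

text \<open>With \<open>p\<close> and \<open>r\<close> the densities of the laws of \<open>X\<close> on \<open>B\<close> and off \<open>B\<close>, the best
  predictor of \<open>B\<close> in terms of \<open>X\<close> is \<open>{p > r}\<close>, and its error is the mass of the common
  part \<open>min p r\<close>; \<open>g1\<close> and \<open>g2\<close> cut both laws down to this common part.\<close>

lemma common_part:
  assumes fin: "finite_measure M" and X[measurable]: "X \<in> M \<rightarrow>\<^sub>M N" and B[measurable]: "B \<in> sets M"
  shows "\<exists>A\<in>sets N. \<exists>F1\<in>borel_measurable M. \<exists>F2\<in>borel_measurable M.
    (\<forall>y. 0 \<le> F1 y \<and> F1 y \<le> (1::real) \<and> 0 \<le> F2 y \<and> F2 y \<le> (1::real)) \<and>
    (\<forall>y. y \<notin> B \<longrightarrow> F1 y = 0) \<and> (\<forall>y. y \<in> B \<longrightarrow> F2 y = 0) \<and>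
    distr (density M (\<lambda>y. ennreal (F1 y))) N X = distr (density M (\<lambda>y. ennreal (F2 y))) N X \<and>
    emeasure M {y \<in> space M. (X y \<in> A) \<noteq> (y \<in> B)} = (\<integral>\<^sup>+y. ennreal (F1 y) \<partial>M)"
proof -
  interpret finite_measure M by fact
  define \<nu> where "\<nu> = distr M N X"
  have sf: "sigma_finite_measure \<nu>"
    unfolding \<nu>_def using finite_measure_distr[OF X] by (simp add: finite_measure.axioms)
  \<comment> \<open>Here \<open>p\<close> is the density of the law of \<open>X\<close> on
    \<open>Q\<close> with respect to the full law of \<open>X\<close>, in change-of-variables form;
    it is taken for \<open>B\<close> and for its complement.\<close>
  have ex: "\<exists>p\<in>borel_measurable N. (\<forall>x. 0 \<le> p x) \<and>
      (\<forall>h\<in>borel_measurable N. (\<integral>\<^sup>+y. h (X y) * indicator Q y \<partial>M) = (\<integral>\<^sup>+x. ennreal (p x) * h x \<partial>\<nu>))"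
    if Q[measurable]: "Q \<in> sets M" for Q
  proof -
    define NQ where "NQ = distr (density M (indicator Q)) N X"
    have "finite_measure (density M (indicator Q))"
      by (rule finite_measureI) (simp add: emeasure_density emeasure_finite cong: nn_integral_cong)
    then have f1: "finite_measure NQ"
      unfolding NQ_def by (rule finite_measure.finite_measure_distr) simp
    have ac: "absolutely_continuous \<nu> NQ"
      unfolding absolutely_continuous_def
    proof
      fix A assume "A \<in> null_sets \<nu>"
      then have A[measurable]: "A \<in> sets N" and 0: "emeasure M (X -` A \<inter> space M) = 0"
        by (auto simp: \<nu>_def null_sets_def emeasure_distr)
      have "emeasure NQ A = (\<integral>\<^sup>+y. indicator Q y * indicator (X -` A \<inter> space M) y \<partial>M)"
        by (simp add: NQ_def emeasure_distr emeasure_density)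
      also have "\<dots> \<le> (\<integral>\<^sup>+y. indicator (X -` A \<inter> space M) y \<partial>M)"
        by (intro nn_integral_mono) (auto simp: indicator_def)
      also have "\<dots> = 0" using 0 by simp
      finally show "A \<in> null_sets NQ" by (simp add: NQ_def null_sets_def)
    qed
    obtain p where p[measurable]: "p \<in> borel_measurable N" and p0: "\<And>x. 0 \<le> p x"
      and NQ: "NQ = density \<nu> (\<lambda>x. ennreal (p x))"
      using real_valued_density[OF sf f1 _ ac] by (auto simp: NQ_def \<nu>_def)
    have "(\<integral>\<^sup>+y. h (X y) * indicator Q y \<partial>M) = (\<integral>\<^sup>+x. ennreal (p x) * h x \<partial>\<nu>)"
      if h[measurable]: "h \<in> borel_measurable N" for h
    proof -
      have "(\<integral>\<^sup>+y. h (X y) * indicator Q y \<partial>M) = (\<integral>\<^sup>+x. h x \<partial>NQ)"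
        by (simp add: NQ_def nn_integral_distr nn_integral_density mult.commute)
      also have "\<dots> = (\<integral>\<^sup>+x. ennreal (p x) * h x \<partial>\<nu>)"
        unfolding NQ by (subst nn_integral_density) (auto simp: \<nu>_def)
      finally show ?thesis .
    qed
    then show ?thesis using p p0 by blast
  qed
  obtain p where p[measurable]: "p \<in> borel_measurable N" and p0: "\<And>x. 0 \<le> p x"
    and pi: "\<And>h. h \<in> borel_measurable N \<Longrightarrow>
      (\<integral>\<^sup>+y. h (X y) * indicator B y \<partial>M) = (\<integral>\<^sup>+x. ennreal (p x) * h x \<partial>\<nu>)"
    using ex[OF B] by blast
  obtain r where r[measurable]: "r \<in> borel_measurable N" and r0: "\<And>x. 0 \<le> r x"
    and ri: "\<And>h. h \<in> borel_measurable N \<Longrightarrow>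
      (\<integral>\<^sup>+y. h (X y) * indicator (space M - B) y \<partial>M) = (\<integral>\<^sup>+x. ennreal (r x) * h x \<partial>\<nu>)"
    using ex[OF sets.compl_sets[OF B]] by blast
  define A where "A = {x \<in> space N. p x > r x}"
  \<comment> \<open>Where \<open>p x = 0\<close> the quotient is 0 by convention and so is the
    minimum; hence \<open>p * g1 = min p r\<close> holds everywhere, and likewise for
    \<open>g2\<close>.\<close>
  define g1 where "g1 x = min (p x) (r x) / p x" for x
  define g2 where "g2 x = min (p x) (r x) / r x" for x
  have A[measurable]: "A \<in> sets N" by (simp add: A_def)
  have gm[measurable]: "g1 \<in> borel_measurable N" "g2 \<in> borel_measurable N"
    by (simp_all add: g1_def[abs_def] g2_def[abs_def])
  have pg1: "p x * g1 x = min (p x) (r x)" and rg2: "r x * g2 x = min (p x) (r x)" for x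
    using p0[of x] r0[of x] by (auto simp: g1_def g2_def)
  have b1: "0 \<le> g1 x" "g1 x \<le> 1" and b2: "0 \<le> g2 x" "g2 x \<le> 1" for x
    using p0[of x] r0[of x] by (auto simp: g1_def g2_def divide_le_eq_1)
  have i1: "(\<integral>\<^sup>+y. ennreal (g1 (X y) * indicator B y) * indicator C (X y) \<partial>M) =
      (\<integral>\<^sup>+x. ennreal (min (p x) (r x)) * indicator C x \<partial>\<nu>)" if [measurable]: "C \<in> sets N" for C
  proof -
    have "(\<integral>\<^sup>+y. ennreal (g1 (X y) * indicator B y) * indicator C (X y) \<partial>M) =
        (\<integral>\<^sup>+y. (ennreal (g1 (X y)) * indicator C (X y)) * indicator B y \<partial>M)"
      by (intro nn_integral_cong) (auto simp: indicator_def)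
    also have "\<dots> = (\<integral>\<^sup>+x. ennreal (p x) * (ennreal (g1 x) * indicator C x) \<partial>\<nu>)"
      by (rule pi) measurable
    finally show ?thesis
      by (simp add: mult.assoc[symmetric] ennreal_mult[symmetric] p0 b1 pg1)
  qed
  have i2: "(\<integral>\<^sup>+y. ennreal (g2 (X y) * indicator (space M - B) y) * indicator C (X y) \<partial>M) =
      (\<integral>\<^sup>+x. ennreal (min (p x) (r x)) * indicator C x \<partial>\<nu>)" if [measurable]: "C \<in> sets N" for C
  proof -
    have "(\<integral>\<^sup>+y. ennreal (g2 (X y) * indicator (space M - B) y) * indicator C (X y) \<partial>M) =
        (\<integral>\<^sup>+y. (ennreal (g2 (X y)) * indicator C (X y)) * indicator (space M - B) y \<partial>M)"
      by (intro nn_integral_cong) (auto simp: indicator_def)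
    also have "\<dots> = (\<integral>\<^sup>+x. ennreal (r x) * (ennreal (g2 x) * indicator C x) \<partial>\<nu>)"
      by (rule ri) measurable
    finally show ?thesis
      by (simp add: mult.assoc[symmetric] ennreal_mult[symmetric] r0 b2 rg2)
  qed
  have "emeasure M {y \<in> space M. (X y \<in> A) \<noteq> (y \<in> B)} =
      (\<integral>\<^sup>+y. indicator (space N - A) (X y) * indicator B y + indicator A (X y) * indicator (space M - B) y \<partial>M)"
  proof -
    have "emeasure M {y \<in> space M. (X y \<in> A) \<noteq> (y \<in> B)} = (\<integral>\<^sup>+y. indicator {y \<in> space M. (X y \<in> A) \<noteq> (y \<in> B)} y \<partial>M)"
      by (intro nn_integral_indicator[symmetric]) simp
    also have "\<dots> = (\<integral>\<^sup>+y. indicator (space N - A) (X y) * indicator B y + indicator A (X y) * indicator (space M - B) y \<partial>M)"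
      using measurable_space[OF X] by (intro nn_integral_cong) (auto simp: indicator_def)
    finally show ?thesis .
  qed
  also have "\<dots> = (\<integral>\<^sup>+y. indicator (space N - A) (X y) * indicator B y \<partial>M)
      + (\<integral>\<^sup>+y. indicator A (X y) * indicator (space M - B) y \<partial>M)"
    by (rule nn_integral_add) simp_all
  also have "\<dots> = (\<integral>\<^sup>+x. ennreal (p x) * indicator (space N - A) x \<partial>\<nu>) + (\<integral>\<^sup>+x. ennreal (r x) * indicator A x \<partial>\<nu>)"
    by (subst pi, simp, subst ri, simp_all)
  also have "\<dots> = (\<integral>\<^sup>+x. ennreal (p x) * indicator (space N - A) x + ennreal (r x) * indicator A x \<partial>\<nu>)"
    by (rule nn_integral_add[symmetric]) (simp_all add: \<nu>_def)
  \<comment> \<open>On \<open>A\<close> the smaller density is \<open>r\<close>, off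
    \<open>A\<close> it is \<open>p\<close>: the mass predicted wrongly is exactly the common
    part.\<close>
  also have "\<dots> = (\<integral>\<^sup>+x. ennreal (min (p x) (r x)) * indicator (space N) x \<partial>\<nu>)"
    by (intro nn_integral_cong) (auto simp: A_def indicator_def \<nu>_def min_def)
  also have "\<dots> = (\<integral>\<^sup>+y. ennreal (g1 (X y) * indicator B y) * indicator (space N) (X y) \<partial>M)"
    by (rule i1[symmetric]) simp
  also have "\<dots> = (\<integral>\<^sup>+y. ennreal (g1 (X y) * indicator B y) \<partial>M)"
    using measurable_space[OF X] by (intro nn_integral_cong) (auto simp: indicator_def)
  finally have err: "emeasure M {y \<in> space M. (X y \<in> A) \<noteq> (y \<in> B)} =
      (\<integral>\<^sup>+y. ennreal (g1 (X y) * indicator B y) \<partial>M)" .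
  define F1 where "F1 y = g1 (X y) * indicator B y" for y
  define F2 where "F2 y = g2 (X y) * indicator (space M - B) y" for y
  have Fm[measurable]: "F1 \<in> borel_measurable M" "F2 \<in> borel_measurable M"
    by (simp_all add: F1_def[abs_def] F2_def[abs_def])
  have eq: "distr (density M (\<lambda>y. ennreal (F1 y))) N X = distr (density M (\<lambda>y. ennreal (F2 y))) N X"
  proof (rule measure_eqI)
    fix C assume "C \<in> sets (distr (density M (\<lambda>y. ennreal (F1 y))) N X)"
    then have C[measurable]: "C \<in> sets N" by simp
    show "emeasure (distr (density M (\<lambda>y. ennreal (F1 y))) N X) C =
        emeasure (distr (density M (\<lambda>y. ennreal (F2 y))) N X) C"
      unfolding emeasure_distr_density[OF X Fm(1) C] emeasure_distr_density[OF X Fm(2) C] using i1[OF C] i2[OF C] by (simp only: F1_def F2_def)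
  qed simp
  have "emeasure M {y \<in> space M. (X y \<in> A) \<noteq> (y \<in> B)} = (\<integral>\<^sup>+y. ennreal (F1 y) \<partial>M)"
    using err by (simp only: F1_def)
  moreover have "\<forall>y. 0 \<le> F1 y \<and> F1 y \<le> (1::real) \<and> 0 \<le> F2 y \<and> F2 y \<le> (1::real)"
    using b1 b2 by (auto simp: F1_def F2_def indicator_def)
  moreover have "\<forall>y. y \<notin> B \<longrightarrow> F1 y = 0" "\<forall>y. y \<in> B \<longrightarrow> F2 y = 0"
    by (auto simp: F1_def F2_def)
  ultimately show ?thesis
    by (rule_tac bexI[OF _ A], rule_tac bexI[OF _ Fm(1)], rule_tac bexI[OF _ Fm(2)]) (simp only: eq simp_thms)
qed

text \<open>For measurable data and error 0, \<open>B\<close> agrees up to a null set with an event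
  of the sigma-algebra generated by \<open>X\<close>.\<close>

definition predictable :: "'b measure \<Rightarrow> ('b \<Rightarrow> 'c) \<Rightarrow> 'c measure \<Rightarrow> 'b set \<Rightarrow> ennreal \<Rightarrow> bool" where
  "predictable M X N B \<epsilon> \<longleftrightarrow>
     (\<exists>A\<in>sets N. emeasure M {y \<in> space M. (X y \<in> A) \<noteq> (y \<in> B)} \<le> \<epsilon>)"

text \<open>The infimum of the prediction errors is attained by the set that
  \<open>common_part\<close> supplies, since every competitor \<open>A'\<close> errs with at least
  the mass of \<open>F1\<close>. Such limits are taken twice: over refining partitions of time and
  over the sets exhausting the plan.\<close>

lemma predictable_limit:
  assumes fin: "finite_measure M" and X[measurable]: "X \<in> M \<rightarrow>\<^sub>M N" and B[measurable]: "B \<in> sets M"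
    and pr: "\<And>\<epsilon>::real. \<epsilon> > 0 \<Longrightarrow> predictable M X N B (ennreal \<epsilon>)"
  shows "predictable M X N B 0"
proof -
  obtain A F1 F2 where A: "A \<in> sets N"
    and Fm[measurable]: "F1 \<in> borel_measurable M" "F2 \<in> borel_measurable M"
    and b: "\<forall>y. 0 \<le> F1 y \<and> F1 y \<le> (1::real) \<and> 0 \<le> F2 y \<and> F2 y \<le> (1::real)"
    and F0: "\<forall>y. y \<notin> B \<longrightarrow> F1 y = 0" "\<forall>y. y \<in> B \<longrightarrow> F2 y = 0"
    and eq: "distr (density M (\<lambda>y. ennreal (F1 y))) N X = distr (density M (\<lambda>y. ennreal (F2 y))) N X"
    and err: "emeasure M {y \<in> space M. (X y \<in> A) \<noteq> (y \<in> B)} = (\<integral>\<^sup>+y. ennreal (F1 y) \<partial>M)"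
    using common_part[OF fin X B] by blast
  have le: "(\<integral>\<^sup>+y. ennreal (F1 y) \<partial>M) \<le> ennreal \<epsilon>" if eps: "\<epsilon> > 0" for \<epsilon> :: real
  proof -
    obtain A' where A'[measurable]: "A' \<in> sets N"
      and e: "emeasure M {y \<in> space M. (X y \<in> A') \<noteq> (y \<in> B)} \<le> ennreal \<epsilon>"
      using pr[OF eps] unfolding predictable_def by blast
    have "(\<integral>\<^sup>+y. ennreal (F1 y) \<partial>M) =
        (\<integral>\<^sup>+y. ennreal (F1 y) * indicator A' (X y) + ennreal (F1 y) * indicator (space N - A') (X y) \<partial>M)"
      using measurable_space[OF X] by (intro nn_integral_cong) (auto simp: indicator_def)
    also have "\<dots> = (\<integral>\<^sup>+y. ennreal (F1 y) * indicator A' (X y) \<partial>M)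
          + (\<integral>\<^sup>+y. ennreal (F1 y) * indicator (space N - A') (X y) \<partial>M)"
      by (rule nn_integral_add) simp_all
    \<comment> \<open>Equality of the laws under \<open>X\<close> allows \<open>F1\<close> to be
      replaced by \<open>F2\<close> where \<open>A'\<close> predicts \<open>B\<close>. As
      \<open>F2\<close> lives off \<open>B\<close> and \<open>F1\<close> on \<open>B\<close>, both
      integrals then sit on disjoint parts of the error set of \<open>A'\<close>.\<close>
    also have "(\<integral>\<^sup>+y. ennreal (F1 y) * indicator A' (X y) \<partial>M) =
        (\<integral>\<^sup>+y. ennreal (F2 y) * indicator A' (X y) \<partial>M)"
      unfolding emeasure_distr_density[OF X Fm(1) A', symmetric] emeasure_distr_density[OF X Fm(2) A', symmetric] eq ..
    also have "(\<integral>\<^sup>+y. ennreal (F2 y) * indicator A' (X y) \<partial>M)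
          + (\<integral>\<^sup>+y. ennreal (F1 y) * indicator (space N - A') (X y) \<partial>M)
       = (\<integral>\<^sup>+y. ennreal (F2 y) * indicator A' (X y) + ennreal (F1 y) * indicator (space N - A') (X y) \<partial>M)"
      by (rule nn_integral_add[symmetric]) simp_all
    also have "\<dots> \<le> (\<integral>\<^sup>+y. indicator {y \<in> space M. (X y \<in> A') \<noteq> (y \<in> B)} y \<partial>M)"
      using b F0 by (intro nn_integral_mono) (auto simp: indicator_def)
    also have "\<dots> \<le> ennreal \<epsilon>" using e by simp
    finally show ?thesis .
  qed
  have "(\<integral>\<^sup>+y. ennreal (F1 y) \<partial>M) \<le> 0"
    by (rule ennreal_le_epsilon) (simp add: le)
  then show ?thesis unfolding predictable_def err[symmetric] by (rule bexI[OF _ A])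
qed

section \<open>Plans controlled by an entropy functional\<close>

definition law :: "(real \<Rightarrow> 'a::polish_space) measure \<Rightarrow> ((real \<Rightarrow> 'a) \<Rightarrow> real) \<Rightarrow> real \<Rightarrow> 'a measure" where
  "law \<pi> F t = distr (density \<pi> (\<lambda>\<gamma>. ennreal (F \<gamma>))) borel (\<lambda>\<gamma>. \<gamma> t)"

lemma sets_law [simp, measurable_cong]: "sets (law \<pi> F t) = sets borel"
  by (simp add: law_def)

lemma space_law [simp]: "space (law \<pi> F t) = UNIV"
  by (simp add: law_def)

definition thru :: "real \<Rightarrow> 'a::metric_space set \<Rightarrow> (real \<Rightarrow> 'a) set" where
  "thru t B = {\<gamma> \<in> Geo. \<gamma> t \<in> B}"

lemma thru_sets:
  "t \<in> {0..1} \<Longrightarrow> B \<in> sets borel \<Longrightarrow> thru t B \<in> sets GeoM"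
  using measurable_sets[OF measurable_eval, of t B] by (simp add: thru_def vimage_def Int_def conj_commute)

lemma ennreal_mean:
  assumes "0 \<le> x" "0 \<le> y"
  shows "ennreal ((x + y) / 2) = ennreal (1/2) * ennreal x + ennreal (1/2) * ennreal y"
proof -
  have "ennreal ((x + y) / 2) = ennreal (1/2 * x + 1/2 * y)"
    by (rule arg_cong[where f = ennreal]) simp
  also have "\<dots> = ennreal (1/2 * x) + ennreal (1/2 * y)"
    using assms by (intro ennreal_plus) auto
  also have "\<dots> = ennreal (1/2) * ennreal x + ennreal (1/2) * ennreal y"
    using assms by (intro arg_cong2[where f = "(+)"] ennreal_mult) auto
  finally show ?thesis .
qed

lemma ennreal_halves: "ennreal (1/2) + ennreal (1/2) = 1"
proof -
  have "ennreal (1/2 + 1/2) = ennreal (1/2) + ennreal (1/2)" by (rule ennreal_plus) auto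
  then show ?thesis by (simp only: field_sum_of_halves ennreal_1)
qed

locale geodesic_plan = prob_space \<pi>
  for \<pi> :: "(real \<Rightarrow> 'a::polish_space) measure" +
  assumes sets_plan [measurable_cong, simp]: "sets \<pi> = sets GeoM"
begin

lemma space_plan [simp]: "space \<pi> = Geo"
  using sets_eq_imp_space_eq[OF sets_plan] by simp

lemma measurable_eval_plan: "t \<in> {0..1} \<Longrightarrow> (\<lambda>\<gamma>. \<gamma> t) \<in> \<pi> \<rightarrow>\<^sub>M borel"
  using measurable_eval measurable_cong_sets[OF sets_plan refl] by blast

lemma emeasure_law:
  assumes t: "t \<in> {0..1}" and F: "F \<in> borel_measurable GeoM" and C: "C \<in> sets borel"
  shows "emeasure (law \<pi> F t) C = (\<integral>\<^sup>+\<gamma>. ennreal (F \<gamma>) * indicator C (\<gamma> t) \<partial>\<pi>)"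
  unfolding law_def using assms measurable_eval_plan[OF t] by (intro emeasure_distr_density) simp_all

lemma law_null:
  assumes "t \<in> {0..1}" "F \<in> borel_measurable GeoM" "C \<in> sets borel"
    and "AE \<gamma> in \<pi>. F \<gamma> \<noteq> 0 \<longrightarrow> \<gamma> t \<notin> C"
  shows "emeasure (law \<pi> F t) C = 0"
proof -
  have "AE \<gamma> in \<pi>. ennreal (F \<gamma>) * indicator C (\<gamma> t) = 0"
    using assms(4) by (rule eventually_mono) (auto simp: indicator_def)
  then have "(\<integral>\<^sup>+\<gamma>. ennreal (F \<gamma>) * indicator C (\<gamma> t) \<partial>\<pi>) = (\<integral>\<^sup>+\<gamma>. 0 \<partial>\<pi>)"
    by (rule nn_integral_cong_AE)
  then show ?thesis using emeasure_law[OF assms(1-3)] by simp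
qed

lemma law_eqI:
  assumes t: "t \<in> {0..1}" and F: "F \<in> borel_measurable GeoM" and s: "sets \<mu> = sets borel"
    and eq: "\<And>C. C \<in> sets borel \<Longrightarrow> (\<integral>\<^sup>+\<gamma>. ennreal (F \<gamma>) * indicator C (\<gamma> t) \<partial>\<pi>) = emeasure \<mu> C"
  shows "law \<pi> F t = \<mu>"
  using s by (intro measure_eqI) (simp_all add: emeasure_law[OF t F] eq)

lemma emeasure_law_mix:
  assumes t: "t \<in> {0..1}" and F[measurable]: "F1 \<in> borel_measurable GeoM" "F2 \<in> borel_measurable GeoM"
    and n: "\<And>\<gamma>. 0 \<le> F1 \<gamma>" "\<And>\<gamma>. 0 \<le> F2 \<gamma>" and C[measurable]: "C \<in> sets borel"
  shows "emeasure (law \<pi> (\<lambda>\<gamma>. (F1 \<gamma> + F2 \<gamma>) / 2) t) C =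
    ennreal (1/2) * emeasure (law \<pi> F1 t) C + ennreal (1/2) * emeasure (law \<pi> F2 t) C"
proof -
  note [measurable] = measurable_eval_plan[OF t]
  have "emeasure (law \<pi> (\<lambda>\<gamma>. (F1 \<gamma> + F2 \<gamma>) / 2) t) C =
      (\<integral>\<^sup>+\<gamma>. ennreal ((F1 \<gamma> + F2 \<gamma>) / 2) * indicator C (\<gamma> t) \<partial>\<pi>)"
    by (rule emeasure_law[OF t]) simp_all
  also have "\<dots> = (\<integral>\<^sup>+\<gamma>. ennreal (1/2) * (ennreal (F1 \<gamma>) * indicator C (\<gamma> t))
      + ennreal (1/2) * (ennreal (F2 \<gamma>) * indicator C (\<gamma> t)) \<partial>\<pi>)"
  proof (intro nn_integral_cong)
    fix \<gamma>
    have "ennreal ((F1 \<gamma> + F2 \<gamma>) / 2) = ennreal (1/2) * ennreal (F1 \<gamma>) + ennreal (1/2) * ennreal (F2 \<gamma>)"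
      by (rule ennreal_mean[OF n])
    then show "ennreal ((F1 \<gamma> + F2 \<gamma>) / 2) * indicator C (\<gamma> t) =
        ennreal (1/2) * (ennreal (F1 \<gamma>) * indicator C (\<gamma> t)) + ennreal (1/2) * (ennreal (F2 \<gamma>) * indicator C (\<gamma> t))"
      by (simp only: distrib_right mult.assoc)
  qed
  also have "\<dots> = (\<integral>\<^sup>+\<gamma>. ennreal (1/2) * (ennreal (F1 \<gamma>) * indicator C (\<gamma> t)) \<partial>\<pi>)
      + (\<integral>\<^sup>+\<gamma>. ennreal (1/2) * (ennreal (F2 \<gamma>) * indicator C (\<gamma> t)) \<partial>\<pi>)"
    by (rule nn_integral_add) simp_all
  also have "\<dots> = ennreal (1/2) * (\<integral>\<^sup>+\<gamma>. ennreal (F1 \<gamma>) * indicator C (\<gamma> t) \<partial>\<pi>)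
      + ennreal (1/2) * (\<integral>\<^sup>+\<gamma>. ennreal (F2 \<gamma>) * indicator C (\<gamma> t) \<partial>\<pi>)"
    by (intro arg_cong2[where f = "(+)"] nn_integral_cmult) simp_all
  finally show ?thesis by (simp add: emeasure_law[OF t] F C)
qed

lemma law_mix_same:
  assumes t: "t \<in> {0..1}" and F: "F1 \<in> borel_measurable GeoM" "F2 \<in> borel_measurable GeoM"
    and n: "\<And>\<gamma>. 0 \<le> F1 \<gamma>" "\<And>\<gamma>. 0 \<le> F2 \<gamma>" and eq: "law \<pi> F1 t = law \<pi> F2 t"
  shows "law \<pi> (\<lambda>\<gamma>. (F1 \<gamma> + F2 \<gamma>) / 2) t = law \<pi> F1 t"
proof (rule measure_eqI)
  fix C assume "C \<in> sets (law \<pi> (\<lambda>\<gamma>. (F1 \<gamma> + F2 \<gamma>) / 2) t)"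
  then have C: "C \<in> sets borel" by simp
  have "emeasure (law \<pi> (\<lambda>\<gamma>. (F1 \<gamma> + F2 \<gamma>) / 2) t) C =
      (ennreal (1/2) + ennreal (1/2)) * emeasure (law \<pi> F1 t) C"
    unfolding emeasure_law_mix[OF t F n C] eq[symmetric] by (rule distrib_right[symmetric])
  also note ennreal_halves
  finally show "emeasure (law \<pi> (\<lambda>\<gamma>. (F1 \<gamma> + F2 \<gamma>) / 2) t) C = emeasure (law \<pi> F1 t) C"
    by simp
qed simp

text \<open>The bound \<open>R\<close> is kept explicit because the entropy increments depend on it
  through \<open>ln R\<close>.\<close>

definition adm :: "(real \<Rightarrow> 'a) set \<Rightarrow> real \<Rightarrow> ((real \<Rightarrow> 'a) \<Rightarrow> real) \<Rightarrow> bool" where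
  "adm \<Gamma> R F \<longleftrightarrow> admissible_density \<pi> F \<and> (\<forall>\<gamma>. \<gamma> \<notin> \<Gamma> \<longrightarrow> F \<gamma> = 0) \<and> (\<forall>\<gamma>. F \<gamma> \<le> R)"

lemma admD:
  assumes "adm \<Gamma> R F"
  shows "F \<in> borel_measurable GeoM" "0 \<le> F \<gamma>" "F \<gamma> \<le> R" "\<gamma> \<notin> \<Gamma> \<Longrightarrow> F \<gamma> = 0"
    "(\<integral>\<^sup>+\<gamma>. ennreal (F \<gamma>) \<partial>\<pi>) = 1" "admissible_density \<pi> F"
  using assms by (auto simp: adm_def admissible_density_def)

lemma admI:
  assumes "F \<in> borel_measurable GeoM" "\<And>\<gamma>. 0 \<le> F \<gamma>" "\<And>\<gamma>. F \<gamma> \<le> R" "\<And>\<gamma>. \<gamma> \<notin> \<Gamma> \<Longrightarrow> F \<gamma> = 0"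
    "(\<integral>\<^sup>+\<gamma>. ennreal (F \<gamma>) \<partial>\<pi>) = 1"
  shows "adm \<Gamma> R F"
  using assms by (auto simp: adm_def admissible_density_def)

lemma prob_space_law:
  assumes "adm \<Gamma> R F" "t \<in> {0..1}"
  shows "prob_space (law \<pi> F t)"
  by (rule prob_spaceI) (simp add: emeasure_law[OF assms(2) admD(1)[OF assms(1)]] admD(5)[OF assms(1)])

text \<open>The mean of two densities keeps the bound \<open>R\<close>, so a mixture obeys the same
  entropy estimates as its parts.\<close>

lemma adm_mix:
  assumes "adm \<Gamma> R F1" "adm \<Gamma> R F2"
  shows "adm \<Gamma> R (\<lambda>\<gamma>. (F1 \<gamma> + F2 \<gamma>) / 2)"
proof (rule admI)
  note [measurable] = admD(1)[OF assms(1)] admD(1)[OF assms(2)]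
  show "(\<lambda>\<gamma>. (F1 \<gamma> + F2 \<gamma>) / 2) \<in> borel_measurable GeoM" by measurable
  show "0 \<le> (F1 \<gamma> + F2 \<gamma>) / 2" "(F1 \<gamma> + F2 \<gamma>) / 2 \<le> R" for \<gamma>
    using admD(2,3)[OF assms(1), of \<gamma>] admD(2,3)[OF assms(2), of \<gamma>] by auto
  show "(F1 \<gamma> + F2 \<gamma>) / 2 = 0" if "\<gamma> \<notin> \<Gamma>" for \<gamma>
    using admD(4)[OF assms(1) that] admD(4)[OF assms(2) that] by simp
  have "emeasure (law \<pi> (\<lambda>\<gamma>. (F1 \<gamma> + F2 \<gamma>) / 2) 0) UNIV = ennreal (1/2) * 1 + ennreal (1/2) * 1"
    using prob_space.emeasure_space_1[OF prob_space_law[OF assms(1), of 0]]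
      prob_space.emeasure_space_1[OF prob_space_law[OF assms(2), of 0]]
    by (subst emeasure_law_mix) (auto simp: admD(1,2)[OF assms(1)] admD(1,2)[OF assms(2)])
  also have "\<dots> = 1"
    unfolding mult_1_right by (rule ennreal_halves)
  finally show "(\<integral>\<^sup>+\<gamma>. ennreal ((F1 \<gamma> + F2 \<gamma>) / 2) \<partial>\<pi>) = 1"
    by (subst (asm) emeasure_law) auto
qed

end

text \<open>\<open>H\<close> stands for \<open>- N ln (- Ent_N)\<close> or for the Boltzmann entropy.\<close>

locale entropy_plan = geodesic_plan \<pi>
  for \<pi> :: "(real \<Rightarrow> 'a::polish_space) measure" +
  fixes m :: "'a measure" and \<Gamma> :: "(real \<Rightarrow> 'a) set" and W :: "'a set" and D C :: real
    and H :: "'a measure \<Rightarrow> real"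
  assumes sets_m [simp]: "sets m = sets borel"
    and \<Gamma>_sets [measurable]: "\<Gamma> \<in> sets GeoM" and W_sets [measurable]: "W \<in> sets borel"
    and W_fin: "emeasure m W < \<infinity>"
    and \<Gamma>_W: "\<And>\<gamma> t. \<gamma> \<in> \<Gamma> \<Longrightarrow> t \<in> {0..1} \<Longrightarrow> \<gamma> t \<in> W"
    and \<Gamma>_D: "\<And>\<gamma>. \<gamma> \<in> \<Gamma> \<Longrightarrow> dist (\<gamma> 0) (\<gamma> 1) \<le> D"
    and C0: "0 \<le> C"
    and sigma: "sigma_finite_measure m"
    and ac0: "\<And>R F. adm \<Gamma> R F \<Longrightarrow> absolutely_continuous m (law \<pi> F 0)"
    and fwd: "\<And>R F \<delta> a b. adm \<Gamma> R F \<Longrightarrow> 1 \<le> R \<Longrightarrow> 0 < \<delta> \<Longrightarrow> 0 \<le> a \<Longrightarrow> a \<le> b \<Longrightarrow> b \<le> 1 - \<delta>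
       \<Longrightarrow> b - a \<le> \<delta> / 2 \<Longrightarrow> H (law \<pi> F b) \<le> H (law \<pi> F a) + C / \<delta> * (b - a) * (1 + ln R)"
    and bwd: "\<And>R F \<delta> a b. adm \<Gamma> R F \<Longrightarrow> 1 \<le> R \<Longrightarrow> 0 < \<delta> \<Longrightarrow> \<delta> \<le> a \<Longrightarrow> a \<le> b \<Longrightarrow> b \<le> 1 - \<delta>
       \<Longrightarrow> b - a \<le> \<delta> / 2 \<Longrightarrow> H (law \<pi> F a) \<le> H (law \<pi> F b) + C / \<delta> * (b - a) * (1 + ln R)"
    and sep: "\<And>R F1 F2 t B. adm \<Gamma> R F1 \<Longrightarrow> adm \<Gamma> R F2 \<Longrightarrow> 0 \<le> t \<Longrightarrow> t < 1 \<Longrightarrow> B \<in> sets borel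
       \<Longrightarrow> emeasure (law \<pi> F1 t) (UNIV - B) = 0 \<Longrightarrow> emeasure (law \<pi> F2 t) B = 0
       \<Longrightarrow> H (law \<pi> (\<lambda>\<gamma>. (F1 \<gamma> + F2 \<gamma>) / 2) t) \<le> (H (law \<pi> F1 t) + H (law \<pi> F2 t)) / 2 - ln 2"
    and lower: "\<And>R F t V. adm \<Gamma> R F \<Longrightarrow> 0 \<le> t \<Longrightarrow> t < 1 \<Longrightarrow> V \<in> sets borel \<Longrightarrow> V \<subseteq> W
       \<Longrightarrow> emeasure (law \<pi> F t) (UNIV - V) = 0 \<Longrightarrow> - ln (measure m V) \<le> H (law \<pi> F t)"
    and unif: "\<And>R F E. adm \<Gamma> R F \<Longrightarrow> E \<in> sets borel \<Longrightarrow> E \<subseteq> W \<Longrightarrow> 0 < measure m E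
       \<Longrightarrow> law \<pi> F 0 = density m (\<lambda>x. ennreal (indicator E x / measure m E))
       \<Longrightarrow> H (law \<pi> F 0) \<le> - ln (measure m E)"
begin

abbreviation "M \<equiv> density \<pi> (indicator \<Gamma>)"

lemma finite_M: "finite_measure M"
proof (rule finite_measureI)
  have "emeasure M (space \<pi>) = (\<integral>\<^sup>+\<gamma>. indicator \<Gamma> \<gamma> * indicator (space \<pi>) \<gamma> \<partial>\<pi>)"
    by (rule emeasure_density[OF _ sets.top]) simp_all
  also have "\<dots> \<le> (\<integral>\<^sup>+\<gamma>. indicator (space \<pi>) \<gamma> \<partial>\<pi>)"
    by (intro nn_integral_mono) (auto simp: indicator_def)
  also have "\<dots> = 1" unfolding nn_integral_indicator[OF sets.top] by (rule emeasure_space_1)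
  finally show "emeasure M (space M) \<noteq> \<infinity>"
    unfolding space_density by (auto simp: top_unique)
qed

lemma eval_M: "t \<in> {0..1} \<Longrightarrow> (\<lambda>\<gamma>. \<gamma> t) \<in> M \<rightarrow>\<^sub>M borel"
  using measurable_eval_plan by simp

text \<open>The functions \<open>F1\<close> and \<open>F2\<close> of \<open>common_part\<close> give
  equal laws at time \<open>a\<close> and lie on opposite sides of \<open>B\<close> at time
  \<open>b\<close>. Their common mass \<open>q\<close> is the best prediction error, hence exceeds
  \<open>\<epsilon>\<close>, and dividing by \<open>q\<close> turns them into plans of density at
  most \<open>1 / q\<close>. The last clause is confined to \<open>Geo\<close> because
  \<open>thru b B\<close> contains geodesics only.\<close>

lemma unpredictable_plans:
  assumes a: "a \<in> {0..1}" and b: "b \<in> {0..1}" and B: "B \<in> sets borel" and \<epsilon>: "\<epsilon> \<ge> 0"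
    and np: "\<not> predictable M (\<lambda>\<gamma>. \<gamma> a) borel (thru b B) (ennreal \<epsilon>)"
  shows "\<exists>q G1 G2. \<epsilon> < q \<and> q \<le> 1 \<and> adm \<Gamma> (1 / q) G1 \<and> adm \<Gamma> (1 / q) G2 \<and> law \<pi> G1 a = law \<pi> G2 a \<and>
    (\<forall>\<gamma>. G1 \<gamma> \<noteq> 0 \<longrightarrow> \<gamma> b \<in> B) \<and> (\<forall>\<gamma>\<in>Geo. G2 \<gamma> \<noteq> 0 \<longrightarrow> \<gamma> b \<notin> B)"
proof -
  have Bs: "thru b B \<in> sets M" using thru_sets[OF b B] by simp
  obtain A F1 F2 where A: "A \<in> sets borel"
    and Fm0: "F1 \<in> borel_measurable M" "F2 \<in> borel_measurable M"
    and bd: "\<forall>y. 0 \<le> F1 y \<and> F1 y \<le> (1::real) \<and> 0 \<le> F2 y \<and> F2 y \<le> (1::real)"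
    and F0: "\<forall>y. y \<notin> thru b B \<longrightarrow> F1 y = 0" "\<forall>y. y \<in> thru b B \<longrightarrow> F2 y = 0"
    and eq: "distr (density M (\<lambda>y. ennreal (F1 y))) borel (\<lambda>\<gamma>. \<gamma> a) = distr (density M (\<lambda>y. ennreal (F2 y))) borel (\<lambda>\<gamma>. \<gamma> a)"
    and err: "emeasure M {y \<in> space M. (y a \<in> A) \<noteq> (y \<in> thru b B)} = (\<integral>\<^sup>+y. ennreal (F1 y) \<partial>M)"
    using common_part[OF finite_M eval_M[OF a] Bs] by blast
  have Fm[measurable]: "F1 \<in> borel_measurable GeoM" "F2 \<in> borel_measurable GeoM"
    using Fm0 by simp_all
  note [measurable] = measurable_eval_plan[OF a]
  have lawM: "(\<integral>\<^sup>+\<gamma>. ennreal (F \<gamma>) * indicator \<Gamma> \<gamma> * indicator C (\<gamma> a) \<partial>\<pi>) =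
      emeasure (distr (density M (\<lambda>y. ennreal (F y))) borel (\<lambda>\<gamma>. \<gamma> a)) C"
    if [measurable]: "F \<in> borel_measurable GeoM" "C \<in> sets borel" for F :: "_ \<Rightarrow> real" and C
    by (subst emeasure_distr_density) (auto simp: nn_integral_density eval_M[OF a] mult_ac)
  define I where "I = (\<integral>\<^sup>+y. ennreal (F1 y) \<partial>M)"
  have I1: "I = (\<integral>\<^sup>+\<gamma>. ennreal (F1 \<gamma>) * indicator \<Gamma> \<gamma> \<partial>\<pi>)"
    by (simp add: I_def nn_integral_density mult.commute)
  also have "\<dots> \<le> (\<integral>\<^sup>+\<gamma>. indicator (space \<pi>) \<gamma> \<partial>\<pi>)"
    using bd by (intro nn_integral_mono) (auto simp: indicator_def)
  also have "\<dots> = 1" unfolding nn_integral_indicator[OF sets.top] by (rule emeasure_space_1)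
  finally have I_le: "I \<le> 1" .
  define q where "q = enn2real I"
  have Iq: "I = ennreal q" using I_le by (auto simp: q_def ennreal_enn2real_if top_unique)
  have "ennreal \<epsilon> < I"
    using np A err unfolding predictable_def I_def by (auto simp: not_le)
  then have q: "\<epsilon> < q" "0 < q" using \<epsilon> by (auto simp: Iq ennreal_less_iff)
  have q1: "q \<le> 1" using I_le by (simp add: Iq)
  have I2: "I = (\<integral>\<^sup>+\<gamma>. ennreal (F2 \<gamma>) * indicator \<Gamma> \<gamma> \<partial>\<pi>)"
    using lawM[OF Fm(1), of UNIV] lawM[OF Fm(2), of UNIV] by (simp add: I1 eq)
  define G where "G F \<gamma> = F \<gamma> * indicator \<Gamma> \<gamma> / q" for F and \<gamma> :: "real \<Rightarrow> 'a"
  have Gm: "G F \<in> borel_measurable GeoM" if [measurable]: "F \<in> borel_measurable GeoM" for F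
    unfolding G_def[abs_def] by simp
  have Ge: "ennreal (G F \<gamma>) = ennreal (1/q) * (ennreal (F \<gamma>) * indicator \<Gamma> \<gamma>)" if "0 \<le> F \<gamma>" for F \<gamma>
    using that q by (auto simp: G_def indicator_def ennreal_mult[symmetric])
  have adm: "adm \<Gamma> (1/q) (G F)"
    if F: "F \<in> borel_measurable GeoM" and bF: "\<forall>\<gamma>. 0 \<le> F \<gamma> \<and> F \<gamma> \<le> 1"
      and int: "I = (\<integral>\<^sup>+\<gamma>. ennreal (F \<gamma>) * indicator \<Gamma> \<gamma> \<partial>\<pi>)" for F
  proof (rule admI[OF Gm[OF F]])
    note [measurable] = F
    show "0 \<le> G F \<gamma>" "G F \<gamma> \<le> 1 / q" for \<gamma>
      using bF q by (auto simp: G_def indicator_def divide_simps)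
    show "G F \<gamma> = 0" if "\<gamma> \<notin> \<Gamma>" for \<gamma> using that by (simp add: G_def)
    have "(\<integral>\<^sup>+\<gamma>. ennreal (G F \<gamma>) \<partial>\<pi>) = (\<integral>\<^sup>+\<gamma>. ennreal (1/q) * (ennreal (F \<gamma>) * indicator \<Gamma> \<gamma>) \<partial>\<pi>)"
      using bF by (simp add: Ge)
    also have "\<dots> = ennreal (1/q) * I"
      unfolding int by (rule nn_integral_cmult) simp
    also have "\<dots> = 1" using q by (simp add: Iq ennreal_mult[symmetric])
    finally show "(\<integral>\<^sup>+\<gamma>. ennreal (G F \<gamma>) \<partial>\<pi>) = 1" .
  qed
  have lawG: "emeasure (law \<pi> (G F) a) C =
      ennreal (1/q) * emeasure (distr (density M (\<lambda>y. ennreal (F y))) borel (\<lambda>\<gamma>. \<gamma> a)) C"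
    if F: "F \<in> borel_measurable GeoM" and bF: "\<forall>\<gamma>. 0 \<le> F \<gamma> \<and> F \<gamma> \<le> 1" and C: "C \<in> sets borel" for F C
  proof -
    note [measurable] = F C
    have "emeasure (law \<pi> (G F) a) C = (\<integral>\<^sup>+\<gamma>. ennreal (1/q) * (ennreal (F \<gamma>) * indicator \<Gamma> \<gamma> * indicator C (\<gamma> a)) \<partial>\<pi>)"
      unfolding emeasure_law[OF a Gm[OF F] C] using bF by (intro nn_integral_cong) (simp add: Ge mult.assoc)
    also have "\<dots> = ennreal (1/q) * (\<integral>\<^sup>+\<gamma>. ennreal (F \<gamma>) * indicator \<Gamma> \<gamma> * indicator C (\<gamma> a) \<partial>\<pi>)"
      by (rule nn_integral_cmult) simp
    finally show ?thesis unfolding lawM[OF F C] .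
  qed
  have "law \<pi> (G F1) a = law \<pi> (G F2) a"
    using bd by (intro measure_eqI) (auto simp: lawG Fm eq)
  moreover have "\<forall>\<gamma>. G F1 \<gamma> \<noteq> 0 \<longrightarrow> \<gamma> b \<in> B" "\<forall>\<gamma>\<in>Geo. G F2 \<gamma> \<noteq> 0 \<longrightarrow> \<gamma> b \<notin> B"
    using F0 by (auto simp: G_def thru_def)
  ultimately show ?thesis
    using q q1 adm[OF Fm(1) _ I1] adm[OF Fm(2) _ I2] bd by blast
qed

lemma separated_laws:
  assumes G: "adm \<Gamma> R G1" "adm \<Gamma> R G2" and b: "0 \<le> b" "b < 1" and B: "B \<in> sets borel"
    and "AE \<gamma> in \<pi>. G1 \<gamma> \<noteq> 0 \<longrightarrow> \<gamma> b \<in> B" "AE \<gamma> in \<pi>. G2 \<gamma> \<noteq> 0 \<longrightarrow> \<gamma> b \<notin> B"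
  shows "H (law \<pi> (\<lambda>\<gamma>. (G1 \<gamma> + G2 \<gamma>) / 2) b) \<le> (H (law \<pi> G1 b) + H (law \<pi> G2 b)) / 2 - ln 2"
  using b assms(6,7) by (intro sep[OF G b B] law_null admD[OF G(1)] admD[OF G(2)]) (auto simp: B)

text \<open>The threshold \<open>h0\<close> is uniform in the times and in the event, because
  chaining applies the estimate to predictors about which nothing but measurability is
  known.\<close>

lemma short_time_predictable:
  assumes \<epsilon>: "\<epsilon> > 0" and \<delta>: "\<delta> > 0"
  shows "\<exists>h0>0. \<forall>a b B. \<delta> \<le> a \<and> a < b \<and> b \<le> 1 - \<delta> \<and> b - a < h0 \<and> B \<in> sets borel \<longrightarrow>
    predictable M (\<lambda>\<gamma>. \<gamma> a) borel (thru b B) (ennreal (\<epsilon> * (b - a)))"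
proof -
  \<comment> \<open>Twice the increment bound for \<open>R = 1 / (\<epsilon> * h)\<close>; it tends
    to 0 because \<open>h * ln h\<close> does, and so falls below \<open>ln 2\<close>.\<close>
  have "((\<lambda>h. 2 * C / \<delta> * h * (1 - ln (\<epsilon> * h))) \<longlongrightarrow> 0) (at_right 0)"
    using \<epsilon> by real_asymp
  then have "eventually (\<lambda>h. 2 * C / \<delta> * h * (1 - ln (\<epsilon> * h)) < ln 2) (at_right 0)"
    by (rule order_tendstoD) simp
  then obtain h1 where h1: "h1 > 0" "\<And>h. 0 < h \<Longrightarrow> h < h1 \<Longrightarrow> 2 * C / \<delta> * h * (1 - ln (\<epsilon> * h)) < ln 2"
    unfolding eventually_at_right_field by auto
  show ?thesis
  proof (intro exI[of _ "min h1 (\<delta> / 2)"] conjI allI impI)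
    show "0 < min h1 (\<delta> / 2)" using h1 \<delta> by simp
    fix a b and B :: "'a set" assume *: "\<delta> \<le> a \<and> a < b \<and> b \<le> 1 - \<delta> \<and> b - a < min h1 (\<delta> / 2) \<and> B \<in> sets borel"
    define h where "h = b - a"
    have h: "0 < h" "h < h1" "h \<le> \<delta> / 2" using * by (auto simp: h_def)
    have ab: "a \<in> {0..1}" "b \<in> {0..1}" "0 \<le> a" "b < 1" using * \<delta> by auto
    show "predictable M (\<lambda>\<gamma>. \<gamma> a) borel (thru b B) (ennreal (\<epsilon> * (b - a)))"
    proof (rule ccontr)
      assume "\<not> ?thesis"
      then obtain q G1 G2 where q: "\<epsilon> * h < q" "q \<le> 1" and G: "adm \<Gamma> (1 / q) G1" "adm \<Gamma> (1 / q) G2"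
        and eq: "law \<pi> G1 a = law \<pi> G2 a"
        and G0: "\<forall>\<gamma>. G1 \<gamma> \<noteq> 0 \<longrightarrow> \<gamma> b \<in> B" "\<forall>\<gamma>\<in>Geo. G2 \<gamma> \<noteq> 0 \<longrightarrow> \<gamma> b \<notin> B"
        using unpredictable_plans[OF ab(1,2), of B "\<epsilon> * h"] * \<epsilon> h unfolding h_def by auto
      have q0: "0 < q" using q(1) \<epsilon> h by (meson le_less_trans less_imp_le mult_pos_pos)
      then have R: "1 \<le> 1 / q" using q by simp
      define K where "K = C / \<delta> * h * (1 + ln (1 / q))"
      let ?Gm = "\<lambda>\<gamma>. (G1 \<gamma> + G2 \<gamma>) / 2"
      have "H (law \<pi> ?Gm b) \<le> (H (law \<pi> G1 b) + H (law \<pi> G2 b)) / 2 - ln 2"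
        using * ab G0 by (intro separated_laws[OF G]) auto
      moreover have "H (law \<pi> G1 b) \<le> H (law \<pi> G1 a) + K" "H (law \<pi> G2 b) \<le> H (law \<pi> G2 a) + K"
        using * h ab \<delta> fwd[OF G(1) R \<delta>, of a b] fwd[OF G(2) R \<delta>, of a b] by (auto simp: K_def h_def)
      moreover have "H (law \<pi> ?Gm a) \<le> H (law \<pi> ?Gm b) + K"
        using * h ab \<delta> bwd[OF adm_mix[OF G] R \<delta>, of a b] by (auto simp: K_def h_def)
      moreover have "law \<pi> ?Gm a = law \<pi> G1 a"
        by (rule law_mix_same[OF ab(1) admD(1)[OF G(1)] admD(1)[OF G(2)] admD(2)[OF G(1)] admD(2)[OF G(2)] eq])
      \<comment> \<open>Here \<open>ha\<close> and \<open>hm\<close> are the entropies of the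
        mixture at times \<open>a\<close> and \<open>b\<close>, while \<open>h1\<close> and
        \<open>h2\<close> are those of its parts at \<open>b\<close>; at time \<open>a\<close> the
        parts have the value \<open>ha\<close> as well.\<close>
      moreover have "ln 2 \<le> 2 * K"
        if "hm \<le> (h1 + h2) / 2 - ln 2" "h1 \<le> ha + K" "h2 \<le> ha + K" "ha \<le> hm + K" for hm h1 h2 ha :: real
        using that by argo
      ultimately have "ln 2 \<le> 2 * K" unfolding eq by metis
      also have "\<dots> \<le> 2 * (C / \<delta> * h * (1 - ln (\<epsilon> * h)))"
      proof -
        have "ln (1 / q) \<le> - ln (\<epsilon> * h)" using q q0 \<epsilon> h by (simp add: ln_div)
        then show ?thesis unfolding K_def using C0 \<delta> h by (intro mult_left_mono) auto
      qed
      also have "\<dots> < ln 2" using h1(2)[of h] h by (simp add: mult.assoc)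
      finally show False by simp
    qed
  qed
qed

text \<open>The triangle inequality for measures of symmetric differences, with an event at the
  middle time \<open>b\<close> in between.\<close>

lemma error_triangle:
  assumes t: "a \<in> {0..1}" "b \<in> {0..1}" "c \<in> {0..1}" and A: "A \<in> sets borel" "A' \<in> sets borel" "B \<in> sets borel"
  shows "emeasure M {\<gamma> \<in> Geo. (\<gamma> a \<in> A') \<noteq> (\<gamma> c \<in> B)} \<le>
    emeasure M {\<gamma> \<in> Geo. (\<gamma> a \<in> A') \<noteq> (\<gamma> b \<in> A)} + emeasure M {\<gamma> \<in> Geo. (\<gamma> b \<in> A) \<noteq> (\<gamma> c \<in> B)}"
proof -
  note [measurable] = t[THEN measurable_eval] A
  have m: "{\<gamma> \<in> space GeoM. (\<gamma> a \<in> A') \<noteq> (\<gamma> b \<in> A)} \<in> sets GeoM"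
    "{\<gamma> \<in> space GeoM. (\<gamma> b \<in> A) \<noteq> (\<gamma> c \<in> B)} \<in> sets GeoM" by measurable
  have "emeasure M {\<gamma> \<in> Geo. (\<gamma> a \<in> A') \<noteq> (\<gamma> c \<in> B)} \<le>
      emeasure M ({\<gamma> \<in> Geo. (\<gamma> a \<in> A') \<noteq> (\<gamma> b \<in> A)} \<union> {\<gamma> \<in> Geo. (\<gamma> b \<in> A) \<noteq> (\<gamma> c \<in> B)})"
    using m by (intro emeasure_mono) auto
  also have "\<dots> \<le> emeasure M {\<gamma> \<in> Geo. (\<gamma> a \<in> A') \<noteq> (\<gamma> b \<in> A)} + emeasure M {\<gamma> \<in> Geo. (\<gamma> b \<in> A) \<noteq> (\<gamma> c \<in> B)}"
    using m by (intro emeasure_subadditive) auto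
  finally show ?thesis .
qed

lemma predictable_thru:
  "b \<in> {0..1} \<Longrightarrow> predictable M (\<lambda>\<gamma>. \<gamma> a) borel (thru b B) \<epsilon> \<longleftrightarrow>
    (\<exists>A\<in>sets borel. emeasure M {\<gamma> \<in> Geo. (\<gamma> a \<in> A) \<noteq> (\<gamma> b \<in> B)} \<le> \<epsilon>)"
proof -
  have "{\<gamma> \<in> space M. (\<gamma> a \<in> A) \<noteq> (\<gamma> \<in> thru b B)} = {\<gamma> \<in> Geo. (\<gamma> a \<in> A) \<noteq> (\<gamma> b \<in> B)}" for A
    by (auto simp: thru_def)
  then show ?thesis by (simp add: predictable_def)
qed

lemma interior_predictable:
  assumes s: "0 < s" "s < s'" "s' < 1" and B: "B \<in> sets borel"
  shows "predictable M (\<lambda>\<gamma>. \<gamma> s) borel (thru s' B) 0"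
proof (rule predictable_limit[OF finite_M])
  show "(\<lambda>\<gamma>. \<gamma> s) \<in> M \<rightarrow>\<^sub>M borel" using s by (intro eval_M) auto
  show "thru s' B \<in> sets M" using thru_sets[OF _ B, of s'] s by auto
  fix \<epsilon> :: real assume \<epsilon>: "\<epsilon> > 0"
  \<comment> \<open>Both times keep the distance \<open>\<delta>\<close> from 0 and 1, so one
    threshold \<open>h0\<close> serves the whole interval.\<close>
  define \<delta> where "\<delta> = min s (1 - s')"
  have \<delta>: "0 < \<delta>" "\<delta> \<le> s" "s' \<le> 1 - \<delta>" using s by (auto simp: \<delta>_def)
  \<comment> \<open>Scaled so that the errors \<open>\<epsilon>' * h\<close> of the \<open>n\<close>
    steps, where \<open>n * h = s' - s\<close>, add up to \<open>\<epsilon>\<close>.\<close>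
  define \<epsilon>' where "\<epsilon>' = \<epsilon> / (s' - s)"
  have \<epsilon>': "0 < \<epsilon>'" using \<epsilon> s by (simp add: \<epsilon>'_def)
  obtain h0 where h0: "h0 > 0" and step: "\<And>a b B. \<delta> \<le> a \<Longrightarrow> a < b \<Longrightarrow> b \<le> 1 - \<delta> \<Longrightarrow> b - a < h0 \<Longrightarrow> B \<in> sets borel \<Longrightarrow>
    predictable M (\<lambda>\<gamma>. \<gamma> a) borel (thru b B) (ennreal (\<epsilon>' * (b - a)))"
    using short_time_predictable[OF \<epsilon>' \<delta>(1)] by blast
  obtain n :: nat where n: "(s' - s) / h0 < real n" using reals_Archimedean2 by blast
  have n0: "0 < real n" using n s h0 by (smt (verit) divide_pos_pos)
  define h where "h = (s' - s) / real n"
  have h: "0 < h" "h < h0" using n n0 h0 s by (auto simp: h_def field_simps)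
  have sn: "s' = s + real n * h" using n0 by (simp add: h_def)
  \<comment> \<open>Induction backwards from \<open>s'\<close>: \<open>A\<close> predicts
    \<open>B\<close> from \<open>j\<close> steps before \<open>s'\<close>, and one step earlier
    \<open>A'\<close> predicts \<open>A\<close>.\<close>
  have "\<exists>A\<in>sets borel. emeasure M {\<gamma> \<in> Geo. (\<gamma> (s + real (n - j) * h) \<in> A) \<noteq> (\<gamma> s' \<in> B)} \<le> ennreal (real j * (\<epsilon>' * h))"
    if "j \<le> n" for j
    using that
  proof (induction j)
    case 0
    then show ?case using B by (intro bexI[of _ B]) (simp_all add: sn[symmetric])
  next
    case (Suc j)
    then obtain A where A: "A \<in> sets borel"
      "emeasure M {\<gamma> \<in> Geo. (\<gamma> (s + real (n - j) * h) \<in> A) \<noteq> (\<gamma> s' \<in> B)} \<le> ennreal (real j * (\<epsilon>' * h))"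
      by auto
    define a where "a = s + real (n - Suc j) * h"
    define b where "b = s + real (n - j) * h"
    have ba: "b - a = h" using Suc.prems by (simp add: a_def b_def of_nat_diff algebra_simps)
    have "b \<le> s'" using h Suc.prems by (simp add: b_def sn)
    then have ab: "\<delta> \<le> a" "a < b" "b \<le> 1 - \<delta>" "b - a < h0"
      using h ba \<delta> by (auto simp: a_def intro: add_increasing2)
    obtain A' where A': "A' \<in> sets borel"
      "emeasure M {\<gamma> \<in> Geo. (\<gamma> a \<in> A') \<noteq> (\<gamma> b \<in> A)} \<le> ennreal (\<epsilon>' * h)"
      using step[OF ab A(1)] ab \<delta> s by (subst (asm) predictable_thru) (auto simp: ba)
    have "emeasure M {\<gamma> \<in> Geo. (\<gamma> a \<in> A') \<noteq> (\<gamma> s' \<in> B)} \<le> ennreal (\<epsilon>' * h) + ennreal (real j * (\<epsilon>' * h))"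
      using error_triangle[of a b s' A A' B] ab \<delta> s A A' B
      by (intro order_trans[OF error_triangle[of a b s' A A' B] add_mono]) (auto simp: b_def)
    also have "\<dots> = ennreal (\<epsilon>' * h + real j * (\<epsilon>' * h))"
      using \<epsilon>' h by (intro ennreal_plus[symmetric]) auto
    finally show ?case using A'(1) by (intro bexI[of _ A']) (simp_all add: a_def algebra_simps)
  qed
  from this[of n] show "predictable M (\<lambda>\<gamma>. \<gamma> s) borel (thru s' B) (ennreal \<epsilon>)"
    using s n0 by (subst predictable_thru) (auto simp: h_def \<epsilon>'_def)
qed

end

text \<open>Supplies the set that will carry the uniform initial law: the lower bound
  \<open>c\<close> keeps \<open>1 / f\<close> bounded on it, and closedness of \<open>E\<close> lets
  its neighbourhoods shrink to \<open>E\<close>.\<close>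

lemma compact_above_level:
  fixes m :: "'a::polish_space measure"
  assumes sm: "sets m = sets borel" and W: "W \<in> sets borel" and fW: "emeasure m W < \<infinity>"
    and f: "f \<in> borel_measurable borel" and f0: "\<And>x. 0 \<le> f x"
    and \<nu>: "prob_space (density m (\<lambda>x. ennreal (f x)))" "emeasure (density m (\<lambda>x. ennreal (f x))) (UNIV - W) = 0"
  shows "\<exists>c E. 0 < c \<and> compact E \<and> E \<subseteq> W \<and> (\<forall>x\<in>E. c < f x) \<and> 0 < measure m E"
proof -
  note [measurable_cong] = sm
  have spm: "space m = UNIV" using sets_eq_imp_space_eq[OF sm] by simp
  note [measurable] = W f
  have fm: "(\<lambda>x. ennreal (f x)) \<in> borel_measurable m"
    using f by (simp cong: measurable_cong_sets[OF sm refl])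
  let ?\<nu> = "density m (\<lambda>x. ennreal (f x))"
  define Q where "Q n = {x \<in> W. 1 / real (Suc n) < f x}" for n
  have Qs[measurable]: "Q n \<in> sets borel" for n
  proof -
    have "Q n = W \<inter> {x \<in> space borel. 1 / real (Suc n) < f x}" by (auto simp: Q_def)
    then show ?thesis by simp
  qed
  have "\<exists>n. emeasure m (Q n) \<noteq> 0"
  proof (rule ccontr)
    assume "\<nexists>n. emeasure m (Q n) \<noteq> 0"
    then have "Q n \<in> null_sets m" for n by (auto simp: sm intro!: null_setsI)
    then have "(\<Union>n. Q n) \<in> null_sets m" by (rule null_sets_UN)
    then have "AE x in m. x \<notin> (\<Union>n. Q n)" by (rule AE_not_in)
    then have ae: "AE x in m. ennreal (f x) * indicator W x = 0"
    proof (rule eventually_mono)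
      fix x assume x: "x \<notin> (\<Union>n. Q n)"
      show "ennreal (f x) * indicator W x = 0"
      proof (cases "x \<in> W \<and> 0 < f x")
        case True
        then obtain n where "1 / real (Suc n) < f x" using nat_approx_posE by blast
        then show ?thesis using x True by (auto simp: Q_def)
      next
        case False
        then show ?thesis using f0[of x] by (auto simp: indicator_def)
      qed
    qed
    have "emeasure ?\<nu> W = (\<integral>\<^sup>+x. ennreal (f x) * indicator W x \<partial>m)"
      by (rule emeasure_density[OF fm]) (simp add: sm)
    also have "\<dots> = 0" using nn_integral_cong_AE[OF ae] by simp
    finally have "emeasure ?\<nu> W = 0" .
    moreover have "emeasure ?\<nu> UNIV \<le> emeasure ?\<nu> W + emeasure ?\<nu> (UNIV - W)"
      using emeasure_subadditive[of W ?\<nu> "UNIV - W"] by (simp add: sm)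
    ultimately have "emeasure ?\<nu> UNIV \<le> 0" using \<nu>(2) by simp
    moreover have "emeasure ?\<nu> UNIV = 1" using prob_space.emeasure_space_1[OF \<nu>(1)] by (simp add: spm)
    ultimately show False by simp
  qed
  then obtain n where n: "emeasure m (Q n) \<noteq> 0" by blast
  \<comment> \<open>Inner regularity is applied to this finite restriction, since \<open>m\<close>
    itself may be infinite.\<close>
  define mW where "mW = density m (indicator W)"
  have mW: "emeasure mW B = emeasure m (W \<inter> B)" if "B \<in> sets borel" for B
  proof -
    have "emeasure mW B = (\<integral>\<^sup>+x. indicator W x * indicator B x \<partial>m)"
      unfolding mW_def using that W by (intro emeasure_density borel_measurable_indicator) (simp_all add: sm)
    also have "\<dots> = (\<integral>\<^sup>+x. indicator (W \<inter> B) x \<partial>m)"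
      by (intro nn_integral_cong) (auto simp: indicator_def)
    finally show ?thesis using that by (simp add: sm)
  qed
  have "emeasure mW (Q n) = (SUP K \<in> {K. K \<subseteq> Q n \<and> compact K}. emeasure mW K)"
  proof (rule inner_regular[OF _ _ Qs])
    show "sets mW = sets borel" by (simp add: mW_def sm)
    have "space mW = UNIV" by (simp add: mW_def spm)
    then show "emeasure mW (space mW) \<noteq> \<infinity>" using mW[of UNIV] fW by auto
  qed
  moreover have "0 < emeasure mW (Q n)"
  proof -
    have "W \<inter> Q n = Q n" by (auto simp: Q_def)
    then show ?thesis using n mW[OF Qs] by (simp add: zero_less_iff_neq_zero)
  qed
  ultimately obtain E where E: "E \<subseteq> Q n" "compact E" "0 < emeasure mW E"
    by (auto simp: less_SUP_iff)
  have Es: "E \<in> sets borel" using E(2) by (simp add: borel_closed compact_imp_closed)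
  have EW: "E \<subseteq> W" using E(1) by (auto simp: Q_def)
  then have "0 < emeasure m E" using E(3) mW[OF Es] by (simp add: Int_absorb1)
  moreover have "emeasure m E < \<infinity>" using emeasure_mono[OF EW, of m] fW sm W by auto
  ultimately have "0 < measure m E"
    by (simp add: measure_def enn2real_positive_iff)
  then show ?thesis using E EW by (intro exI[of _ "1 / real (Suc n)"] exI[of _ E]) (auto simp: Q_def)
qed

context entropy_plan
begin

lemma measurable_m [simp]: "measurable m N = measurable borel N"
  by (rule measurable_cong_sets[OF sets_m refl])

lemma \<Gamma>_near:
  assumes "\<gamma> \<in> \<Gamma>" "\<gamma> 0 \<in> E" "t \<in> {0..1}"
  shows "infdist (\<gamma> t) E \<le> t * D"
proof -
  have "\<gamma> \<in> Geo" using assms(1) sets.sets_into_space[OF \<Gamma>_sets] by auto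
  then have "dist (\<gamma> t) (\<gamma> 0) = t * dist (\<gamma> 0) (\<gamma> 1)"
    using Geo_dist[of \<gamma> t 0] assms(3) by simp
  also have "\<dots> \<le> t * D" using \<Gamma>_D[OF assms(1)] assms(3) by (intro mult_left_mono) auto
  finally show ?thesis using infdist_le2[OF assms(2)] by blast
qed

text \<open>The argument of \<open>short_time_predictable\<close> from time 0 would need
  \<open>bwd\<close> with \<open>a = 0\<close>, which its condition
  \<open>0 < \<delta> \<le> a\<close> excludes. Instead \<open>lower\<close> bounds \<open>H\<close>
  of the mixture at a small time \<open>s\<close> by the measure of the region it can have reached,
  and this is compared with \<open>unif\<close> at time 0.\<close>

lemma initial_predictable:
  assumes s': "0 < s'" "s' < 1" and B: "B \<in> sets borel"
  shows "predictable M (\<lambda>\<gamma>. \<gamma> 0) borel (thru s' B) 0"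
proof (rule ccontr)
  assume "\<not> ?thesis"
  then obtain q G1 G2 where q: "0 < q" "q \<le> 1" and G: "adm \<Gamma> (1 / q) G1" "adm \<Gamma> (1 / q) G2"
    and eq: "law \<pi> G1 0 = law \<pi> G2 0"
    and G0: "\<forall>\<gamma>. G1 \<gamma> \<noteq> 0 \<longrightarrow> \<gamma> s' \<in> B" "\<forall>\<gamma>\<in>Geo. G2 \<gamma> \<noteq> 0 \<longrightarrow> \<gamma> s' \<notin> B"
    using unpredictable_plans[of 0 s' B 0] s' B by auto
  obtain f where fm[measurable]: "f \<in> borel_measurable borel" and f0: "\<And>x. 0 \<le> f x"
    and law0: "law \<pi> G1 0 = density m (\<lambda>x. ennreal (f x))"
  proof -
    have "finite_measure (law \<pi> G1 0)" using prob_space_law[OF G(1), of 0] by (simp add: prob_space_def)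
    from real_valued_density[OF sigma this _ ac0[OF G(1)]]
    obtain f where "f \<in> borel_measurable m" "\<forall>x. 0 \<le> f x" "law \<pi> G1 0 = density m (\<lambda>x. ennreal (f x))"
      by auto
    moreover have "f \<in> borel_measurable borel"
      using \<open>f \<in> borel_measurable m\<close> by (simp cong: measurable_cong_sets[OF sets_m refl])
    ultimately show ?thesis using that by blast
  qed
  have "emeasure (law \<pi> G1 0) (UNIV - W) = 0"
  proof (rule law_null)
    have "G1 \<gamma> \<noteq> 0 \<longrightarrow> \<gamma> 0 \<notin> UNIV - W" for \<gamma>
      using admD(4)[OF G(1), of \<gamma>] \<Gamma>_W[of \<gamma> 0] by auto
    then show "AE \<gamma> in \<pi>. G1 \<gamma> \<noteq> 0 \<longrightarrow> \<gamma> 0 \<notin> UNIV - W" by simp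
  qed (use admD(1)[OF G(1)] in auto)
  then obtain c E where c: "0 < c" and E: "compact E" "E \<subseteq> W" "\<And>x. x \<in> E \<Longrightarrow> c < f x" "0 < measure m E"
    using compact_above_level[OF sets_m W_sets W_fin fm f0] prob_space_law[OF G(1), of 0]
    unfolding law0 by auto
  have Es[measurable]: "E \<in> sets borel" using E(1) by (simp add: borel_closed compact_imp_closed)
  define \<mu> where "\<mu> = measure m E"
  have \<mu>: "0 < \<mu>" using E by (simp add: \<mu>_def)
  \<comment> \<open>The weight depends on the starting point alone: it gives both plans the uniform
    law on \<open>E\<close> at time 0 and leaves them on their sides of \<open>B\<close> at time
    \<open>s'\<close>.\<close>
  define w where "w x = indicator E x / (f x * \<mu>)" for x
  have wm[measurable]: "w \<in> borel_measurable borel" by (simp add: w_def[abs_def])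
  have w0: "0 \<le> w x" for x using f0 \<mu> by (simp add: w_def)
  have w1: "w x \<le> 1 / (c * \<mu>)" for x
    using E(3)[of x] c \<mu> by (auto simp: w_def indicator_def intro!: divide_left_mono mult_right_mono mult_pos_pos)
  \<comment> \<open>The product of the bounds for the plans and for the weight; the maximum with 1
    meets the condition \<open>1 \<le> R\<close> of \<open>fwd\<close>.\<close>
  define R where "R = max 1 (1 / q * (1 / (c * \<mu>)))"
  have R1: "1 \<le> R" by (simp add: R_def)
  define J where "J G \<gamma> = G \<gamma> * w (\<gamma> 0)" for G and \<gamma> :: "real \<Rightarrow> 'a"
  have zero: "(0::real) \<in> {0..1}" by simp
  note [measurable] = measurable_eval[OF zero] measurable_eval_plan[OF zero]
  have Jm: "J G \<in> borel_measurable GeoM" if [measurable]: "G \<in> borel_measurable GeoM" for G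
    unfolding J_def[abs_def] by measurable
  let ?u = "density m (\<lambda>x. ennreal (indicator E x / measure m E))"
  have Jlaw: "law \<pi> (J G) 0 = ?u" if G: "adm \<Gamma> (1/q) G" and l: "law \<pi> G 0 = law \<pi> G1 0" for G
  proof (rule law_eqI[OF zero Jm])
    show Gm[measurable]: "G \<in> borel_measurable GeoM" using admD[OF G] by simp
    fix A :: "'a set" assume A[measurable]: "A \<in> sets borel"
    have "(\<integral>\<^sup>+\<gamma>. ennreal (J G \<gamma>) * indicator A (\<gamma> 0) \<partial>\<pi>) =
        (\<integral>\<^sup>+\<gamma>. ennreal (G \<gamma>) * (ennreal (w (\<gamma> 0)) * indicator A (\<gamma> 0)) \<partial>\<pi>)"
      using admD(2)[OF G] w0 by (intro nn_integral_cong) (simp add: J_def ennreal_mult mult.assoc)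
    also have "\<dots> = (\<integral>\<^sup>+x. ennreal (w x) * indicator A x \<partial>(law \<pi> G 0))"
      unfolding law_def by (simp add: nn_integral_distr nn_integral_density)
    also have "\<dots> = (\<integral>\<^sup>+x. ennreal (f x) * (ennreal (w x) * indicator A x) \<partial>m)"
      unfolding l law0 by (rule nn_integral_density) simp_all
    also have "\<dots> = (\<integral>\<^sup>+x. ennreal (indicator E x / measure m E) * indicator A x \<partial>m)"
    proof (intro nn_integral_cong)
      fix x
      have "f x * w x = indicator E x / measure m E"
        using E(3)[of x] c by (auto simp: w_def indicator_def \<mu>_def)
      then show "ennreal (f x) * (ennreal (w x) * indicator A x) = ennreal (indicator E x / measure m E) * indicator A x"
        using f0 w0 by (simp add: mult.assoc[symmetric] ennreal_mult[symmetric])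
    qed
    also have "\<dots> = emeasure ?u A"
      by (rule emeasure_density[symmetric]) simp_all
    finally show "(\<integral>\<^sup>+\<gamma>. ennreal (J G \<gamma>) * indicator A (\<gamma> 0) \<partial>\<pi>) = emeasure ?u A" .
  qed simp
  have Efin: "emeasure m E = ennreal \<mu>"
    using emeasure_mono[OF E(2), of m] W_fin W_sets unfolding \<mu>_def
    by (intro emeasure_eq_ennreal_measure) (auto simp: top_unique)
  have u1: "emeasure ?u UNIV = 1"
  proof -
    have "emeasure ?u UNIV = (\<integral>\<^sup>+x. ennreal (1/\<mu>) * indicator E x \<partial>m)"
      unfolding \<mu>_def[symmetric]
      by (subst emeasure_density) (auto intro!: nn_integral_cong simp: indicator_def)
    also have "\<dots> = ennreal (1/\<mu>) * emeasure m E" by (rule nn_integral_cmult_indicator) simp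
    also have "\<dots> = 1" using \<mu> by (simp add: Efin ennreal_mult[symmetric])
    finally show ?thesis .
  qed
  have Jadm: "adm \<Gamma> R (J G)" if G: "adm \<Gamma> (1/q) G" and l: "law \<pi> G 0 = law \<pi> G1 0" for G
  proof (rule admI[OF Jm[OF admD(1)[OF G]]])
    show "0 \<le> J G \<gamma>" for \<gamma> using admD(2)[OF G] w0 by (simp add: J_def)
    have "J G \<gamma> \<le> 1 / q * (1 / (c * \<mu>))" for \<gamma>
      unfolding J_def using admD(2,3)[OF G] w0 w1 q by (intro mult_mono) auto
    then show "J G \<gamma> \<le> R" for \<gamma> unfolding R_def by (meson max.coboundedI2)
    show "J G \<gamma> = 0" if "\<gamma> \<notin> \<Gamma>" for \<gamma> using admD(4)[OF G that] by (simp add: J_def)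
    show "(\<integral>\<^sup>+\<gamma>. ennreal (J G \<gamma>) \<partial>\<pi>) = 1"
      using emeasure_law[OF zero Jm[OF admD(1)[OF G]], of UNIV] Jlaw[OF G l] u1 by simp
  qed
  note J1 = Jadm[OF G(1) refl] and J2 = Jadm[OF G(2) eq[symmetric]]
  note l1 = Jlaw[OF G(1) refl] and l2 = Jlaw[OF G(2) eq[symmetric]]
  let ?Jm = "\<lambda>\<gamma>. (J G1 \<gamma> + J G2 \<gamma>) / 2"
  \<comment> \<open>With this choice the condition \<open>b \<le> 1 - \<delta>\<close> of
    \<open>fwd\<close> on \<open>[0, s]\<close> becomes \<open>s \<le> s'\<close>.\<close>
  define \<delta> where "\<delta> = 1 - s'"
  have \<delta>: "0 < \<delta>" using s' by (simp add: \<delta>_def)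
  \<comment> \<open>The reweighted plans charge only geodesics of \<open>\<Gamma>\<close> that start
    in \<open>E\<close>; their speed is at most \<open>D\<close>, so they are in \<open>V s\<close>
    at time \<open>s\<close>.\<close>
  define V where "V s = {x \<in> W. infdist x E \<le> s * D}" for s
  have Vs[measurable]: "V s \<in> sets borel" for s
  proof -
    have "closed {x. infdist x E \<le> s * D}"
      by (intro closed_Collect_le continuous_intros)
    moreover have "V s = W \<inter> {x. infdist x E \<le> s * D}" by (auto simp: V_def)
    ultimately show ?thesis by (simp add: borel_closed)
  qed
  define L where "L = C / \<delta> * (1 + ln R)"
  have key: "ln 2 \<le> ln (measure m (V s)) - ln \<mu> + s * L" if s: "0 < s" "s \<le> s'" "s \<le> \<delta> / 2" for s
  proof -
    have s01: "s \<in> {0..1}" "0 \<le> s" "s < 1" using s s' by auto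
    \<comment> \<open>The plans are separated by \<open>B\<close> at time \<open>s'\<close>; a
      predictor of \<open>B\<close> from time \<open>s\<close> separates them already at time
      \<open>s\<close>.\<close>
    have "\<exists>A\<in>sets borel. AE \<gamma> in M. \<gamma> s \<in> A \<longleftrightarrow> \<gamma> s' \<in> B"
    proof (cases "s = s'")
      case True
      then show ?thesis using B by (intro bexI[of _ B]) auto
    next
      case False
      then have "predictable M (\<lambda>\<gamma>. \<gamma> s) borel (thru s' B) 0"
        using s s' B by (intro interior_predictable) auto
      then obtain A where A: "A \<in> sets borel" "emeasure M {\<gamma> \<in> Geo. (\<gamma> s \<in> A) \<noteq> (\<gamma> s' \<in> B)} = 0"
        using s' by (subst (asm) predictable_thru) auto
      have "AE \<gamma> in M. \<gamma> s \<in> A \<longleftrightarrow> \<gamma> s' \<in> B"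
      proof (rule AE_I[OF _ A(2)])
        have [measurable]: "(\<lambda>\<gamma>. \<gamma> s) \<in> GeoM \<rightarrow>\<^sub>M borel" "(\<lambda>\<gamma>. \<gamma> s') \<in> GeoM \<rightarrow>\<^sub>M borel"
          using s01 s' by (auto intro: measurable_eval)
        note [measurable] = A(1) B
        have "{\<gamma> \<in> space GeoM. (\<gamma> s \<in> A) \<noteq> (\<gamma> s' \<in> B)} \<in> sets GeoM" by measurable
        then show "{\<gamma> \<in> Geo. (\<gamma> s \<in> A) \<noteq> (\<gamma> s' \<in> B)} \<in> sets M" by simp
      qed auto
      then show ?thesis using A(1) by blast
    qed
    then obtain A where A[measurable]: "A \<in> sets borel" and ae0: "AE \<gamma> in M. \<gamma> s \<in> A \<longleftrightarrow> \<gamma> s' \<in> B" by blast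
    have ae: "AE \<gamma> in \<pi>. \<gamma> \<in> \<Gamma> \<longrightarrow> (\<gamma> s \<in> A \<longleftrightarrow> \<gamma> s' \<in> B)"
      using ae0 by (subst (asm) AE_density) (auto simp: indicator_def elim!: eventually_mono split: if_splits)
    have geo: "AE \<gamma> in \<pi>. \<gamma> \<in> Geo" by (rule AE_I2) simp
    have "H (law \<pi> ?Jm s) \<le> (H (law \<pi> (J G1) s) + H (law \<pi> (J G2) s)) / 2 - ln 2"
    proof (rule separated_laws[OF J1 J2 s01(2,3) A])
      show "AE \<gamma> in \<pi>. J G1 \<gamma> \<noteq> 0 \<longrightarrow> \<gamma> s \<in> A"
        using ae geo by eventually_elim (use G0 admD(4)[OF G(1)] in \<open>auto simp: J_def\<close>)
      show "AE \<gamma> in \<pi>. J G2 \<gamma> \<noteq> 0 \<longrightarrow> \<gamma> s \<notin> A"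
        using ae geo by eventually_elim (use G0 admD(4)[OF G(2)] in \<open>auto simp: J_def\<close>)
    qed
    moreover have "H (law \<pi> (J G1) s) \<le> H ?u + s * L" "H (law \<pi> (J G2) s) \<le> H ?u + s * L"
      using fwd[OF J1 R1 \<delta>, of 0 s] fwd[OF J2 R1 \<delta>, of 0 s] s
      by (simp_all add: l1 l2 L_def \<delta>_def mult_ac)
    moreover have "H ?u \<le> - ln \<mu>"
      using unif[OF J1 Es E(2) E(4) l1] by (simp add: l1 \<mu>_def)
    moreover have "- ln (measure m (V s)) \<le> H (law \<pi> ?Jm s)"
    proof (rule lower[OF adm_mix[OF J1 J2] s01(2,3) Vs])
      show "V s \<subseteq> W" by (auto simp: V_def)
      have "\<gamma> s \<in> V s" if "?Jm \<gamma> \<noteq> 0" for \<gamma>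
      proof -
        have "\<gamma> \<in> \<Gamma>" using that admD(4)[OF J1, of \<gamma>] admD(4)[OF J2, of \<gamma>] by (cases "\<gamma> \<in> \<Gamma>") auto
        moreover have "\<gamma> 0 \<in> E" using that by (cases "\<gamma> 0 \<in> E") (auto simp: J_def w_def)
        ultimately have "\<gamma> \<in> \<Gamma>" "\<gamma> 0 \<in> E" by blast+
        then show ?thesis using \<Gamma>_near[of \<gamma> E s] \<Gamma>_W[of \<gamma> s] s01 by (auto simp: V_def)
      qed
      then show "emeasure (law \<pi> ?Jm s) (UNIV - V s) = 0"
        using admD(1)[OF adm_mix[OF J1 J2]] s01 by (intro law_null) auto
    qed
    ultimately show ?thesis by argo
  qed
  \<comment> \<open>\<open>D\<close> is known only as a bound for lengths in
    \<open>\<Gamma>\<close>; a plan of mass 1 must charge some geodesic there.\<close>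
  have D0: "0 \<le> D"
  proof -
    have "\<exists>\<gamma>. G1 \<gamma> \<noteq> 0"
    proof (rule ccontr)
      assume "\<nexists>\<gamma>. G1 \<gamma> \<noteq> 0"
      then show False using admD(5)[OF G(1)] by simp
    qed
    then obtain \<gamma> where "\<gamma> \<in> \<Gamma>" using admD(4)[OF G(1)] by blast
    then show ?thesis using \<Gamma>_D[of \<gamma>] zero_le_dist[of "\<gamma> 0" "\<gamma> 1"] by linarith
  qed
  \<comment> \<open>Continuity from above, available because \<open>V s\<close> stays inside
    \<open>W\<close>; with it the right side of \<open>key\<close> tends to 0.\<close>
  have "(\<lambda>n. measure m (V (1 / real (Suc n)))) \<longlonglongrightarrow> measure m (\<Inter>n. V (1 / real (Suc n)))"
  proof (rule Lim_measure_decseq)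
    show "range (\<lambda>n. V (1 / real (Suc n))) \<subseteq> sets m" by auto
    show "decseq (\<lambda>n. V (1 / real (Suc n)))"
    proof (rule decseq_SucI, rule subsetI)
      fix n x assume "x \<in> V (1 / real (Suc (Suc n)))"
      moreover have "1 / real (Suc (Suc n)) * D \<le> 1 / real (Suc n) * D"
        using D0 by (intro mult_right_mono divide_left_mono) auto
      ultimately show "x \<in> V (1 / real (Suc n))" by (auto simp: V_def)
    qed
    fix n
    have "emeasure m (V (1 / real (Suc n))) \<le> emeasure m W"
      by (rule emeasure_mono) (auto simp: V_def)
    then show "emeasure m (V (1 / real (Suc n))) \<noteq> \<infinity>" using W_fin by (auto simp: top_unique)
  qed
  moreover have "(\<Inter>n. V (1 / real (Suc n))) = E"
  proof (intro equalityI subsetI)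
    fix x assume x: "x \<in> (\<Inter>n. V (1 / real (Suc n)))"
    have "(\<lambda>n. 1 / real (Suc n) * D) \<longlonglongrightarrow> 0 * D"
      by (intro tendsto_intros LIMSEQ_Suc[OF lim_1_over_n])
    moreover have "infdist x E \<le> 1 / real (Suc n) * D" for n using x by (auto simp: V_def)
    ultimately have "infdist x E \<le> 0" by (intro LIMSEQ_le_const[of "\<lambda>n. 1 / real (Suc n) * D"]) auto
    moreover have "E \<noteq> {}" using E(4) by auto
    ultimately show "x \<in> E"
      using in_closed_iff_infdist_zero[OF compact_imp_closed[OF E(1)]] infdist_nonneg[of x E] by simp
  next
    fix x assume "x \<in> E"
    moreover note D0
    ultimately show "x \<in> (\<Inter>n. V (1 / real (Suc n)))" using E(2) by (auto simp: V_def)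
  qed
  ultimately have lim: "(\<lambda>n. measure m (V (1 / real (Suc n)))) \<longlonglongrightarrow> \<mu>" by (simp add: \<mu>_def)
  have "(\<lambda>n. ln (measure m (V (1 / real (Suc n)))) - ln \<mu> + 1 / real (Suc n) * L) \<longlonglongrightarrow> ln \<mu> - ln \<mu> + 0 * L"
    using \<mu> by (intro tendsto_intros lim LIMSEQ_Suc[OF lim_1_over_n]) auto
  moreover have "eventually (\<lambda>n. ln 2 \<le> ln (measure m (V (1 / real (Suc n)))) - ln \<mu> + 1 / real (Suc n) * L) sequentially"
  proof -
    have "(\<lambda>n. 1 / real (Suc n)) \<longlonglongrightarrow> 0" by (rule LIMSEQ_Suc[OF lim_1_over_n])
    then have "eventually (\<lambda>n. 1 / real (Suc n) < min s' (\<delta> / 2)) sequentially"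
      using s' \<delta> by (intro order_tendstoD) auto
    then show ?thesis by eventually_elim (intro key, auto)
  qed
  ultimately have "ln 2 \<le> ln \<mu> - ln \<mu> + 0 * L"
    by (intro tendsto_lowerbound[where F = sequentially]) auto
  then show False by simp
qed

end

section \<open>Plans determined by their initial point\<close>

lemma const_Geo: "restrict (\<lambda>_. x) {0..1} \<in> Geo"
  by (simp add: Geo_def)

context geodesic_plan
begin

text \<open>A cylinder imposes finitely many conditions at times below 1, so the intersection of
  their predictors predicts it.\<close>

lemma cylinder_determined:
  assumes det: "\<And>s B. s \<in> {0..<1} \<Longrightarrow> B \<in> sets borel \<Longrightarrow> \<exists>A\<in>sets borel. AE \<gamma> in \<pi>. \<gamma> 0 \<in> A \<longleftrightarrow> \<gamma> s \<in> B"
    and l: "\<And>V. V \<in> set l \<Longrightarrow> open V"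
  shows "\<exists>A\<in>sets borel. AE \<gamma> in \<pi>. \<gamma> 0 \<in> A \<longleftrightarrow> \<gamma> \<in> cyl l"
proof -
  have "\<exists>A. i < length l \<longrightarrow> A \<in> sets borel \<and> (AE \<gamma> in \<pi>. \<gamma> 0 \<in> A \<longleftrightarrow> \<gamma> (real i / real (length l)) \<in> l ! i)" for i
    using det[OF cyl_times, of i l "l ! i"] l[of "l ! i"] by (cases "i < length l") auto
  from choice[OF allI[OF this]] obtain A
    where "\<forall>i. i < length l \<longrightarrow> A i \<in> sets borel \<and> (AE \<gamma> in \<pi>. \<gamma> 0 \<in> A i \<longleftrightarrow> \<gamma> (real i / real (length l)) \<in> l ! i)" ..
  then have A: "\<And>i. i < length l \<Longrightarrow> A i \<in> sets borel"
    "\<And>i. i < length l \<Longrightarrow> AE \<gamma> in \<pi>. \<gamma> 0 \<in> A i \<longleftrightarrow> \<gamma> (real i / real (length l)) \<in> l ! i"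
    by blast+
  have "AE \<gamma> in \<pi>. \<forall>i\<in>{..<length l}. \<gamma> 0 \<in> A i \<longleftrightarrow> \<gamma> (real i / real (length l)) \<in> l ! i"
    using A(2) by (intro AE_finite_allI) auto
  moreover have "AE \<gamma> in \<pi>. \<gamma> \<in> Geo" by (rule AE_I2) simp
  ultimately have "AE \<gamma> in \<pi>. \<gamma> 0 \<in> (\<Inter>i\<in>{..<length l}. A i) \<longleftrightarrow> \<gamma> \<in> cyl l"
    by eventually_elim (auto simp: cyl_def)
  moreover have "(\<Inter>i\<in>{..<length l}. A i) \<in> sets borel"
    using A(1) by (cases "length l = 0") (auto intro!: sets.finite_INT)
  ultimately show ?thesis by blast
qed

text \<open>\<open>T\<close> is a limit of countably valued maps: through the predictors the
  starting point selects a cylinder of sup-diameter at most \<open>(1/2)^n\<close>, and a fixed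
  geodesic of this cylinder is the approximation. Completeness of the space gives the limit.\<close>

lemma induced_by_map:
  assumes det: "\<And>s B. s \<in> {0..<1} \<Longrightarrow> B \<in> sets borel \<Longrightarrow> \<exists>A\<in>sets borel. AE \<gamma> in \<pi>. \<gamma> 0 \<in> A \<longleftrightarrow> \<gamma> s \<in> B"
  shows "\<exists>T. T \<in> borel \<rightarrow>\<^sub>M GeoM \<and> (\<forall>x. T x \<in> Geo \<and> T x 0 = x) \<and> \<pi> = distr (distr \<pi> borel (\<lambda>\<gamma>. \<gamma> 0)) GeoM T"
proof -
  obtain \<B> :: "'a set set" where \<B>: "countable \<B>" "topological_basis \<B>" using ex_countable_basis by auto
  define close where "close e \<gamma> \<eta> \<longleftrightarrow> (\<forall>t\<in>{0..1}. dist (\<gamma> t) (\<eta> t) \<le> e)" for e and \<gamma> \<eta> :: "real \<Rightarrow> 'a"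
  have close_tri: "close (a + b) \<gamma> \<zeta>" if "close a \<gamma> \<eta>" "close b \<eta> \<zeta>" for a b \<gamma> \<eta> \<zeta>
    unfolding close_def
  proof
    fix t :: real assume "t \<in> {0..1}"
    then have "dist (\<gamma> t) (\<eta> t) \<le> a" "dist (\<eta> t) (\<zeta> t) \<le> b"
      using that by (simp_all add: close_def)
    then show "dist (\<gamma> t) (\<zeta> t) \<le> a + b"
      using dist_triangle[of "\<gamma> t" "\<zeta> t" "\<eta> t"] by linarith
  qed
  have close_sym: "close a \<gamma> \<eta> \<Longrightarrow> close a \<eta> \<gamma>" for a \<gamma> \<eta>
    by (simp add: close_def dist_commute)
  \<comment> \<open>Nonemptiness provides each of these small cylinders with a representative
    geodesic.\<close>
  define \<L> where "\<L> n = {l \<in> lists \<B>. cyl l \<noteq> {} \<and> (\<forall>\<gamma>\<in>cyl l. \<forall>\<eta>\<in>cyl l. close ((1/2)^n) \<gamma> \<eta>)}" for n :: nat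
  have cover: "\<exists>l\<in>\<L> n. \<gamma> \<in> cyl l" if \<gamma>: "\<gamma> \<in> Geo" for n \<gamma>
  proof -
    obtain l where l: "l \<in> lists \<B>" "\<gamma> \<in> cyl l" "\<forall>\<eta>\<in>cyl l. \<forall>t\<in>{0..1}. dist (\<gamma> t) (\<eta> t) \<le> (1/2)^n / 2"
      using cyl_small[OF \<gamma> _ \<B>(2), of "(1/2)^n / 2"] by auto
    have cl: "close ((1/2)^n / 2) \<gamma> \<eta>" if "\<eta> \<in> cyl l" for \<eta>
      using l(3) that by (simp add: close_def)
    have "close ((1/2)^n / 2 + (1/2)^n / 2) \<eta> \<zeta>" if "\<eta> \<in> cyl l" "\<zeta> \<in> cyl l" for \<eta> \<zeta>
      by (rule close_tri[OF close_sym[OF cl[OF that(1)]] cl[OF that(2)]])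
    then have "l \<in> \<L> n" using l by (auto simp: \<L>_def)
    then show ?thesis using l by blast
  qed
  have ne: "\<L> n \<noteq> {}" for n using cover[OF const_Geo] by blast
  have ctb: "countable (\<L> n)" for n
    using \<B>(1) by (auto simp: \<L>_def intro: countable_subset[of _ "lists \<B>"])
  define e where "e n = from_nat_into (\<L> n)" for n
  have e: "e n k \<in> \<L> n" for n k unfolding e_def by (rule from_nat_into[OF ne])
  have e_cover: "\<exists>k. \<gamma> \<in> cyl (e n k)" if "\<gamma> \<in> Geo" for \<gamma> n
    using cover[OF that, of n] from_nat_into_surj[OF ctb[of n]] unfolding e_def by metis
  have exP: "\<exists>A\<in>sets borel. AE \<gamma> in \<pi>. \<gamma> 0 \<in> A \<longleftrightarrow> \<gamma> \<in> cyl (e n k)" for n k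
  proof (rule cylinder_determined[OF det])
    fix V assume "V \<in> set (e n k)"
    then show "open V" using e[of n k] topological_basis_open[OF \<B>(2)] by (auto simp: \<L>_def)
  qed
  define P where "P n k = (SOME A. A \<in> sets borel \<and> (AE \<gamma> in \<pi>. \<gamma> 0 \<in> A \<longleftrightarrow> \<gamma> \<in> cyl (e n k)))" for n k
  have P0: "P n k \<in> sets borel \<and> (AE \<gamma> in \<pi>. \<gamma> 0 \<in> P n k \<longleftrightarrow> \<gamma> \<in> cyl (e n k))" for n k
    unfolding P_def using exP[of n k] unfolding Bex_def by (rule someI_ex)
  have P[measurable]: "P n k \<in> sets borel" for n k
    using P0 by blast
  have ae: "AE \<gamma> in \<pi>. \<gamma> 0 \<in> P n k \<longleftrightarrow> \<gamma> \<in> cyl (e n k)" for n k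
    using P0 by (rule conjunct2)
  define rep where "rep n k = (SOME \<gamma>. \<gamma> \<in> cyl (e n k))" for n k
  have rep: "rep n k \<in> cyl (e n k)" for n k
  proof -
    have "\<exists>\<gamma>. \<gamma> \<in> cyl (e n k)" using e[of n k] unfolding \<L>_def by blast
    then show ?thesis unfolding rep_def by (rule someI_ex)
  qed
  then have repG: "rep n k \<in> Geo" for n k by (auto simp: cyl_def)
  \<comment> \<open>At a point in no predictor \<open>LEAST\<close> returns an arbitrary index;
    \<open>T x\<close> is still a geodesic from \<open>x\<close>, because that rests on
    \<open>K\<close> alone.\<close>
  define j where "j n x = (LEAST k. x \<in> P n k)" for n x
  have jm[measurable]: "j n \<in> borel \<rightarrow>\<^sub>M count_space UNIV" for n
    unfolding j_def[abs_def] by measurable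
  define g where "g n x = rep n (j n x)" for n x
  have gG: "g n x \<in> Geo" for n x by (simp add: g_def repG)
  have gm: "(\<lambda>x. g n x t) \<in> borel_measurable borel" for n t
  proof -
    have "(\<lambda>k. rep n k t) \<circ> j n \<in> borel_measurable borel"
      by (rule measurable_comp[OF jm]) simp
    then show ?thesis by (simp add: g_def comp_def)
  qed
  \<comment> \<open>The bound \<open>2 * (1/2)^n\<close> comes from comparing \<open>g n x\<close>
    and \<open>g n' x\<close> with one geodesic, at distances \<open>(1/2)^n\<close> and
    \<open>(1/2)^n'\<close>. The conditions see \<open>x\<close> only through countably valued
    indices and one distance, which makes \<open>K\<close> a Borel set.\<close>
  define K where "K = {x. (\<forall>n n'. n \<le> n' \<longrightarrow> close (2 * (1/2)^n) (g n x) (g n' x)) \<and> (\<forall>n. dist (g n x 0) x \<le> 2 * (1/2)^n)}"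
  have Km[measurable]: "K \<in> sets borel"
  proof -
    have [measurable]: "(\<lambda>x. close (2 * (1/2)^n) (g n x) (g n' x)) \<in> borel \<rightarrow>\<^sub>M count_space UNIV" for n n'
    proof -
      have "(\<lambda>p. close (2 * (1/2)^n) (rep n (fst p)) (rep n' (snd p))) \<in> count_space UNIV \<rightarrow>\<^sub>M count_space UNIV"
        by simp
      moreover have "(\<lambda>x. (j n x, j n' x)) \<in> borel \<rightarrow>\<^sub>M count_space UNIV"
        using measurable_Pair[OF jm jm, of n n'] by (simp add: pair_measure_countable)
      ultimately show ?thesis
        using measurable_compose by (fastforce simp: g_def)
    qed
    note [measurable] = gm
    have "{x \<in> space borel. (\<forall>n n'. n \<le> n' \<longrightarrow> close (2 * (1/2)^n) (g n x) (g n' x)) \<and> (\<forall>n. dist (g n x 0) x \<le> 2 * (1/2)^n)} \<in> sets borel"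
      by measurable
    then show ?thesis by (simp add: K_def)
  qed
  have pow0: "(\<lambda>n. 2 * (1/2)^n :: real) \<longlonglongrightarrow> 0"
    by (intro tendsto_mult_right_zero LIMSEQ_power_zero) auto
  \<comment> \<open>Off \<open>K\<close> the constant geodesic at \<open>x\<close> is taken, so that
    \<open>T x\<close> is a geodesic from \<open>x\<close> for every \<open>x\<close>.\<close>
  define T where "T x = restrict (\<lambda>t. if x \<in> K then lim (\<lambda>n. g n x t) else x) {0..1}" for x
  have conv: "(\<lambda>n. g n x t) \<longlonglongrightarrow> T x t" if x: "x \<in> K" and t: "t \<in> {0..1}" for x t
  proof -
    have "Cauchy (\<lambda>n. g n x t)"
    proof (rule metric_CauchyI)
      fix \<epsilon> :: real assume "\<epsilon> > 0"
      then have "eventually (\<lambda>n. 2 * (1/2)^n < \<epsilon> / 2) sequentially"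
        by (intro order_tendstoD(2)[OF pow0]) auto
      then obtain n where n: "2 * (1/2)^n < \<epsilon> / 2" by (auto simp: eventually_sequentially)
      show "\<exists>M. \<forall>m\<ge>M. \<forall>n\<ge>M. dist (g m x t) (g n x t) < \<epsilon>"
      proof (intro exI[of _ n] allI impI)
        fix p r assume "n \<le> p" "n \<le> r"
        then have "dist (g n x t) (g p x t) \<le> 2 * (1/2)^n" "dist (g n x t) (g r x t) \<le> 2 * (1/2)^n"
          using x t by (auto simp: K_def close_def)
        then show "dist (g p x t) (g r x t) < \<epsilon>"
          using n dist_triangle3[of "g p x t" "g r x t" "g n x t"] by linarith
      qed
    qed
    then show ?thesis using x t by (simp add: T_def Cauchy_convergent convergent_LIMSEQ_iff[symmetric])
  qed
  have T0: "T x 0 = x" for x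
  proof (cases "x \<in> K")
    case True
    have "(\<lambda>n. dist (g n x 0) x) \<longlonglongrightarrow> 0"
      using True by (intro tendsto_sandwich[OF _ _ tendsto_const pow0]) (auto simp: K_def)
    then have "(\<lambda>n. g n x 0) \<longlonglongrightarrow> x" by (rule tendsto_dist_iff[THEN iffD2])
    with conv[OF True, of 0] show ?thesis by (intro LIMSEQ_unique) auto
  qed (simp add: T_def)
  have TG: "T x \<in> Geo" for x
  proof (cases "x \<in> K")
    case True
    show ?thesis unfolding Geo_def
    proof safe
      show "T x \<in> extensional {0..1}" by (simp add: T_def)
      fix s t :: real assume st: "s \<in> {0..1}" "t \<in> {0..1}"
      have "(\<lambda>n. dist (g n x s) (g n x t)) \<longlonglongrightarrow> dist (T x s) (T x t)"
        by (intro tendsto_dist conv True st)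
      moreover have "(\<lambda>n. \<bar>s - t\<bar> * dist (g n x 0) (g n x 1)) \<longlonglongrightarrow> \<bar>s - t\<bar> * dist (T x 0) (T x 1)"
        by (intro tendsto_intros conv True) auto
      ultimately show "dist (T x s) (T x t) = \<bar>s - t\<bar> * dist (T x 0) (T x 1)"
        using Geo_dist[OF gG st] by (intro LIMSEQ_unique) simp_all
    qed
  next
    case False
    then show ?thesis using const_Geo[of x] by (simp add: T_def)
  qed
  have Tm: "T \<in> borel \<rightarrow>\<^sub>M GeoM"
  proof (rule measurable_GeoM)
    show "T \<in> space borel \<rightarrow> Geo" using TG by auto
    fix t :: real assume "t \<in> {0..<1}"
    then have t: "t \<in> {0..1}" by auto
    show "(\<lambda>x. T x t) \<in> borel_measurable borel"
    proof (rule borel_measurable_LIMSEQ_metric)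
      fix n
      note [measurable] = gm
      show "(\<lambda>x. if x \<in> K then g n x t else x) \<in> borel_measurable borel" by measurable
    next
      fix x
      show "(\<lambda>n. if x \<in> K then g n x t else x) \<longlonglongrightarrow> T x t"
        using conv[of x t] t by (cases "x \<in> K") (auto simp: T_def)
    qed
  qed
  have "AE \<gamma> in \<pi>. \<forall>n k. \<gamma> 0 \<in> P n k \<longleftrightarrow> \<gamma> \<in> cyl (e n k)"
    using ae by (simp add: AE_all_countable)
  moreover have "AE \<gamma> in \<pi>. \<gamma> \<in> Geo" by (rule AE_I2) simp
  ultimately have TAE: "AE \<gamma> in \<pi>. T (\<gamma> 0) = \<gamma>"
  proof eventually_elim
    fix \<gamma> assume P: "\<forall>n k. \<gamma> 0 \<in> P n k \<longleftrightarrow> \<gamma> \<in> cyl (e n k)" and \<gamma>: "\<gamma> \<in> Geo"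
    \<comment> \<open>For this geodesic all predictors are exact, so the cylinder selected by its
      starting point contains the geodesic itself.\<close>
    have cl: "close ((1/2)^n) (g n (\<gamma> 0)) \<gamma>" for n
    proof -
      obtain k where "\<gamma> \<in> cyl (e n k)" using e_cover[OF \<gamma>] by blast
      then have "\<gamma> 0 \<in> P n k" using P by blast
      then have "\<gamma> 0 \<in> P n (j n (\<gamma> 0))" unfolding j_def by (rule LeastI)
      then have "\<gamma> \<in> cyl (e n (j n (\<gamma> 0)))" using P by blast
      then show ?thesis using e[of n "j n (\<gamma> 0)"] rep[of n "j n (\<gamma> 0)"] by (auto simp: \<L>_def g_def)
    qed
    have K: "\<gamma> 0 \<in> K"
      unfolding K_def
    proof (safe)
      fix n n' :: nat assume "n \<le> n'"
      have "close ((1/2)^n + (1/2)^n') (g n (\<gamma> 0)) (g n' (\<gamma> 0))"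
        by (rule close_tri[OF cl close_sym[OF cl]])
      moreover have "(1/2)^n' \<le> ((1/2)^n :: real)" using \<open>n \<le> n'\<close> by (intro power_decreasing) auto
      then have "(1/2)^n + (1/2)^n' \<le> (2 * (1/2)^n :: real)" by simp
      ultimately show "close (2 * (1/2)^n) (g n (\<gamma> 0)) (g n' (\<gamma> 0))"
        unfolding close_def by (meson order_trans)
    next
      fix n :: nat
      have "dist (g n (\<gamma> 0) 0) (\<gamma> 0) \<le> (1/2)^n" using cl[of n] by (simp add: close_def)
      also have "\<dots> \<le> 2 * (1/2)^n" by simp
      finally show "dist (g n (\<gamma> 0) 0) (\<gamma> 0) \<le> 2 * (1/2)^n" .
    qed
    have "T (\<gamma> 0) t = \<gamma> t" if t: "t \<in> {0..1}" for t
    proof -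
      have "dist (g n (\<gamma> 0) t) (\<gamma> t) \<le> 2 * (1/2)^n" for n
      proof -
        have "dist (g n (\<gamma> 0) t) (\<gamma> t) \<le> (1/2)^n" using cl[of n] t by (simp add: close_def)
        also have "\<dots> \<le> 2 * (1/2)^n" by simp
        finally show ?thesis .
      qed
      then have "(\<lambda>n. dist (g n (\<gamma> 0) t) (\<gamma> t)) \<longlonglongrightarrow> 0"
        by (intro tendsto_sandwich[OF _ _ tendsto_const pow0]) auto
      then have "(\<lambda>n. g n (\<gamma> 0) t) \<longlonglongrightarrow> \<gamma> t" by (rule tendsto_dist_iff[THEN iffD2])
      then show ?thesis using conv[OF K t] by (rule LIMSEQ_unique[rotated])
    qed
    moreover have "T (\<gamma> 0) \<in> extensional {0..1}" "\<gamma> \<in> extensional {0..1}"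
      using TG \<gamma> unfolding Geo_def by blast+
    ultimately show "T (\<gamma> 0) = \<gamma>" by (intro extensionalityI[of _ "{0..1}"]) auto
  qed
  have e0: "(\<lambda>\<gamma>. \<gamma> 0) \<in> \<pi> \<rightarrow>\<^sub>M borel" by (rule measurable_eval_plan) simp
  have "distr (distr \<pi> borel (\<lambda>\<gamma>. \<gamma> 0)) GeoM T = distr \<pi> GeoM (T \<circ> (\<lambda>\<gamma>. \<gamma> 0))"
    by (rule distr_distr[OF Tm e0])
  also have "\<dots> = distr \<pi> GeoM (\<lambda>\<gamma>. \<gamma>)"
  proof (rule distr_cong_AE)
    show "AE \<gamma> in \<pi>. (T \<circ> (\<lambda>\<gamma>. \<gamma> 0)) \<gamma> = \<gamma>" using TAE by simp
    show "T \<circ> (\<lambda>\<gamma>. \<gamma> 0) \<in> \<pi> \<rightarrow>\<^sub>M GeoM" by (rule measurable_comp[OF e0 Tm])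
    show "(\<lambda>\<gamma>. \<gamma>) \<in> \<pi> \<rightarrow>\<^sub>M GeoM" by (rule measurable_ident_sets[OF sets_plan])
  qed simp_all
  also have "\<dots> = \<pi>" by (rule distr_id2) simp
  finally show ?thesis using Tm TG T0 by (intro exI[of _ T]) auto
qed

end

section \<open>Densities and entropies with respect to the reference measure\<close>

text \<open>The left side is the tangent line of the convex right side at \<open>1 / v\<close>, the
  density of a uniform law on a set of measure \<open>v\<close>. Integrated over such a set it
  yields the entropy bound \<open>- ln v\<close>.\<close>

lemma x_ln_x_ge: "0 \<le> x \<Longrightarrow> 0 < v \<Longrightarrow> x * (1 - ln v) - 1 / v \<le> x * ln (x::real)"
proof (cases "x = 0")
  case False
  assume "0 \<le> x" and v: "0 < v"
  with False have x: "0 < x" by simp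
  have "ln (1 / (x * v)) \<le> 1 / (x * v) - 1" using x v by (intro ln_le_minus_one) simp
  then have "1 - 1 / (x * v) \<le> ln x + ln v" using x v by (simp add: ln_div ln_mult)
  then have "x * (1 - 1 / (x * v)) \<le> x * (ln x + ln v)" using x by (intro mult_left_mono) auto
  moreover have "x * (1 - 1 / (x * v)) = x - 1 / v" using x v by (simp add: field_simps)
  ultimately show ?thesis by (simp add: algebra_simps)
qed auto

lemma eint_integrable:
  assumes "integrable M f"
  shows "eint M f = ereal (\<integral>x. f x \<partial>M)"
proof -
  have "(\<integral>\<^sup>+x. ennreal (f x) \<partial>M) \<noteq> \<infinity>" "(\<integral>\<^sup>+x. ennreal (- f x) \<partial>M) \<noteq> \<infinity>"
    using assms by (auto simp: real_integrable_def)
  then obtain p q where pq: "0 \<le> p" "0 \<le> q" "(\<integral>\<^sup>+x. ennreal (f x) \<partial>M) = ennreal p" "(\<integral>\<^sup>+x. ennreal (- f x) \<partial>M) = ennreal q"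
    by (metis ennreal_cases infinity_ennreal_def)
  have "(\<integral>x. f x \<partial>M) = p - q" using real_lebesgue_integral_def[OF assms] pq by simp
  then show ?thesis using pq by (simp add: eint_def enn2ereal_ennreal)
qed

lemma eint_cong_AE:
  assumes "AE x in M. f x = g x"
  shows "eint M f = eint M g"
proof -
  have "(\<integral>\<^sup>+x. ennreal (f x) \<partial>M) = (\<integral>\<^sup>+x. ennreal (g x) \<partial>M)"
    "(\<integral>\<^sup>+x. ennreal (- f x) \<partial>M) = (\<integral>\<^sup>+x. ennreal (- g x) \<partial>M)"
    using assms by (auto intro!: nn_integral_cong_AE elim!: eventually_mono)
  then show ?thesis by (simp add: eint_def)
qed

section \<open>Lebesgue decomposition with respect to the reference measure\<close>

locale reference_measure = sigma_finite_measure m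
  for m :: "'a::polish_space measure" +
  assumes sets_m [simp]: "sets m = sets borel"
begin

lemma measurable_m [simp]: "measurable m N = measurable borel N"
  by (rule measurable_cong_sets[OF sets_m refl])

lemma space_m [simp]: "space m = UNIV"
  using sets_eq_imp_space_eq[OF sets_m] by simp

definition ac :: "'a measure \<Rightarrow> bool" where
  "ac \<mu> \<longleftrightarrow> prob_space \<mu> \<and> sets \<mu> = sets borel \<and> absolutely_continuous m \<mu>"

lemma acD:
  assumes "ac \<mu>"
  shows "prob_space \<mu>" "sets \<mu> = sets borel" "space \<mu> = UNIV" "emeasure \<mu> UNIV = 1"
    "\<And>A. A \<in> null_sets m \<Longrightarrow> emeasure \<mu> A = 0"
proof -
  show s: "sets \<mu> = sets borel" and p: "prob_space \<mu>" using assms by (auto simp: ac_def)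
  show sp: "space \<mu> = UNIV" using sets_eq_imp_space_eq[OF s] by simp
  show "emeasure \<mu> UNIV = 1" using prob_space.emeasure_space_1[OF p] by (simp add: sp)
  show "emeasure \<mu> A = 0" if "A \<in> null_sets m" for A
    using assms that by (auto simp: ac_def absolutely_continuous_def)
qed

lemma leb_decompD:
  assumes "leb_decomp m \<mu> \<rho> S"
  shows "\<rho> \<in> borel_measurable borel" "0 \<le> \<rho> x" "S \<in> null_sets m"
    "A \<in> sets borel \<Longrightarrow> emeasure \<mu> A = (\<integral>\<^sup>+x\<in>A. ennreal (\<rho> x) \<partial>m) + emeasure \<mu> (A \<inter> S)"
proof -
  show "\<rho> \<in> borel_measurable borel" "0 \<le> \<rho> x" "S \<in> null_sets m"
    using assms by (auto simp: leb_decomp_def)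
  have "\<forall>A\<in>sets borel. emeasure \<mu> A = (\<integral>\<^sup>+x\<in>A. ennreal (\<rho> x) \<partial>m) + emeasure \<mu> (A \<inter> S)"
    using assms unfolding leb_decomp_def by (elim conjE)
  then show "A \<in> sets borel \<Longrightarrow> emeasure \<mu> A = (\<integral>\<^sup>+x\<in>A. ennreal (\<rho> x) \<partial>m) + emeasure \<mu> (A \<inter> S)"
    by (rule bspec)
qed

text \<open>\<open>dens\<close> and \<open>sing\<close> are components of one and the same choice,
  so exhibiting any decomposition makes the chosen pair a decomposition.\<close>

lemma leb_decomp_dens:
  assumes "leb_decomp m \<mu> \<rho> S"
  shows "leb_decomp m \<mu> (dens m \<mu>) (sing m \<mu>)"
proof -
  have "\<exists>p. leb_decomp m \<mu> (fst p) (snd p)" using assms by (intro exI[of _ "(\<rho>, S)"]) simp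
  then show ?thesis unfolding dens_def sing_def by (rule someI_ex)
qed

text \<open>Radon-Nikodym gives a decomposition with empty singular set. The chosen singular set is
  \<open>m\<close>-null, hence \<open>\<mu>\<close>-null, so the chosen density already represents
  \<open>\<mu>\<close>.\<close>

lemma dens_ac:
  assumes "ac \<mu>"
  shows "dens m \<mu> \<in> borel_measurable borel" "0 \<le> dens m \<mu> x" "\<mu> = density m (\<lambda>x. ennreal (dens m \<mu> x))"
    "sing m \<mu> \<in> null_sets m" "sing_mass m \<mu> = 0"
proof -
  obtain f where f: "f \<in> borel_measurable borel" "\<And>x. 0 \<le> f x" and \<mu>: "\<mu> = density m (\<lambda>x. ennreal (f x))"
    using real_valued_density[OF sigma_finite_measure_axioms, of \<mu>] assms
    by (auto simp: ac_def prob_space_def)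
  have "emeasure \<mu> A = (\<integral>\<^sup>+x\<in>A. ennreal (f x) \<partial>m)" if "A \<in> sets borel" for A
    unfolding \<mu> using f that by (intro emeasure_density) simp_all
  then have "leb_decomp m \<mu> f {}"
    using f by (simp add: leb_decomp_def)
  from leb_decomp_dens[OF this] have d: "leb_decomp m \<mu> (dens m \<mu>) (sing m \<mu>)" .
  from leb_decompD(1-3)[OF d]
  show dm: "dens m \<mu> \<in> borel_measurable borel" and "0 \<le> dens m \<mu> x" and sn: "sing m \<mu> \<in> null_sets m" .
  show s0: "sing_mass m \<mu> = 0" unfolding sing_mass_def by (rule acD(5)[OF assms sn])
  show "\<mu> = density m (\<lambda>x. ennreal (dens m \<mu> x))"
  proof (rule measure_eqI)
    show "sets \<mu> = sets (density m (\<lambda>x. ennreal (dens m \<mu> x)))" using acD(2)[OF assms] by simp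
    fix A assume "A \<in> sets \<mu>"
    then have A: "A \<in> sets borel" using acD(2)[OF assms] by simp
    have "A \<inter> sing m \<mu> \<in> null_sets m"
      using sn A by (intro null_set_Int1) simp_all
    then have "emeasure \<mu> (A \<inter> sing m \<mu>) = 0" by (rule acD(5)[OF assms])
    then have "emeasure \<mu> A = (\<integral>\<^sup>+x\<in>A. ennreal (dens m \<mu> x) \<partial>m)"
      unfolding leb_decompD(4)[OF d A] by (simp only: add_0_right)
    also have "\<dots> = emeasure (density m (\<lambda>x. ennreal (dens m \<mu> x))) A"
      using dm A by (intro emeasure_density[symmetric]) simp_all
    finally show "emeasure \<mu> A = emeasure (density m (\<lambda>x. ennreal (dens m \<mu> x))) A" .
  qed
qed

lemma dens_unique:
  assumes "ac \<mu>" and f: "f \<in> borel_measurable borel" "\<And>x. 0 \<le> f x"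
    and \<mu>: "\<mu> = density m (\<lambda>x. ennreal (f x))"
  shows "AE x in m. dens m \<mu> x = f x"
proof -
  note d = dens_ac[OF assms(1)]
  have "density m (\<lambda>x. ennreal (dens m \<mu> x)) = density m (\<lambda>x. ennreal (f x))"
    using d(3) \<mu> by simp
  moreover have "(\<integral>\<^sup>+x. ennreal (dens m \<mu> x) \<partial>m) = emeasure \<mu> UNIV"
    by (subst (2) d(3)) (use d(1) in \<open>simp add: emeasure_density\<close>)
  ultimately have "AE x in m. ennreal (dens m \<mu> x) = ennreal (f x)"
    using d(1) f(1) acD(4)[OF assms(1)] by (intro finite_density_unique[THEN iffD1]) auto
  then show ?thesis using d(2) f(2) by (auto elim!: eventually_mono)
qed

lemma integral_dens:
  assumes "ac \<mu>" "A \<in> sets borel"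
  shows "(\<integral>\<^sup>+x. ennreal (dens m \<mu> x) * indicator A x \<partial>m) = emeasure \<mu> A"
  using dens_ac(1)[OF assms(1)] assms(2)
  by (subst (2) dens_ac(3)[OF assms(1)], subst emeasure_density) simp_all

text \<open>The zero density with singular set \<open>A\<close> is a decomposition. Off
  \<open>A\<close> and off the chosen singular set, both \<open>m\<close>-null, the chosen density
  has integral at most \<open>\<mu> (UNIV - A) = 0\<close>.\<close>

lemma dens_singular:
  assumes p: "prob_space \<mu>" and s: "sets \<mu> = sets borel"
    and A: "A \<in> null_sets m" "emeasure \<mu> (UNIV - A) = 0"
  shows "AE x in m. dens m \<mu> x = 0" "sing_mass m \<mu> \<noteq> 0"
proof -
  have As: "A \<in> sets borel" using A by auto
  have eqA: "emeasure \<mu> C = emeasure \<mu> (C \<inter> A)" if C: "C \<in> sets borel" for C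
  proof -
    have "emeasure \<mu> C = emeasure \<mu> (C \<inter> A) + emeasure \<mu> (C - A)"
      using C As s by (subst plus_emeasure) (auto intro!: arg_cong[where f = "emeasure \<mu>"])
    moreover have "emeasure \<mu> (C - A) \<le> emeasure \<mu> (UNIV - A)" using C As s by (intro emeasure_mono) auto
    ultimately show ?thesis using A(2) by simp
  qed
  have eq0: "\<forall>C\<in>sets borel. emeasure \<mu> C = (\<integral>\<^sup>+x\<in>C. ennreal 0 \<partial>m) + emeasure \<mu> (C \<inter> A)"
  proof
    fix C :: "'a set" assume "C \<in> sets borel"
    moreover have "(\<integral>\<^sup>+x\<in>C. ennreal 0 \<partial>m) = 0" by simp
    ultimately show "emeasure \<mu> C = (\<integral>\<^sup>+x\<in>C. ennreal 0 \<partial>m) + emeasure \<mu> (C \<inter> A)"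
      using eqA[of C] by (simp only: add_0)
  qed
  have m0: "emeasure m A = 0" using A(1) by auto
  have "leb_decomp m \<mu> (\<lambda>_. 0) A"
    unfolding leb_decomp_def by (intro conjI allI ballI borel_measurable_const order_refl refl As m0 eq0[rule_format])
  from leb_decomp_dens[OF this] have d: "leb_decomp m \<mu> (dens m \<mu>) (sing m \<mu>)" .
  then have dm: "dens m \<mu> \<in> borel_measurable borel" and S: "sing m \<mu> \<in> null_sets m"
    by (rule leb_decompD)+
  then have Ss: "sing m \<mu> \<in> sets borel" by auto
  define C where "C = UNIV - A - sing m \<mu>"
  have C: "C \<in> sets borel" using As Ss by (auto simp: C_def)
  have "emeasure \<mu> C \<le> emeasure \<mu> (UNIV - A)" using As s by (intro emeasure_mono) (auto simp: C_def)
  then have "(\<integral>\<^sup>+x\<in>C. ennreal (dens m \<mu> x) \<partial>m) = 0"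
    using leb_decompD(4)[OF d C] A(2) by (simp add: le_zero_eq)
  then have "AE x in m. ennreal (dens m \<mu> x) * indicator C x = 0"
    using dm C by (subst (asm) nn_integral_0_iff_AE) simp_all
  moreover have "AE x in m. x \<notin> A" "AE x in m. x \<notin> sing m \<mu>"
    using A(1) S by (auto intro: AE_not_in)
  ultimately show ae: "AE x in m. dens m \<mu> x = 0"
  proof eventually_elim
    fix x assume "ennreal (dens m \<mu> x) * indicator C x = 0" "x \<notin> A" "x \<notin> sing m \<mu>"
    then show "dens m \<mu> x = 0"
      using leb_decompD(2)[OF d, of x] by (auto simp: C_def ennreal_eq_0_iff intro: antisym)
  qed
  have "space \<mu> = UNIV" using sets_eq_imp_space_eq[OF s] by simp
  then have "1 = emeasure \<mu> UNIV" using prob_space.emeasure_space_1[OF p] by simp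
  also have "\<dots> = (\<integral>\<^sup>+x. ennreal (dens m \<mu> x) \<partial>m) + sing_mass m \<mu>"
    using leb_decompD(4)[OF d, of UNIV] by (simp add: sing_mass_def)
  also have "(\<integral>\<^sup>+x. ennreal (dens m \<mu> x) \<partial>m) = 0"
    using ae dm by (subst nn_integral_0_iff_AE) (auto elim: eventually_mono)
  finally show "sing_mass m \<mu> \<noteq> 0" by auto
qed

lemma dens_supp:
  assumes "ac \<mu>" "V \<in> sets borel" "emeasure \<mu> (UNIV - V) = 0"
  shows "AE x in m. x \<notin> V \<longrightarrow> dens m \<mu> x = 0"
proof -
  have "(\<integral>\<^sup>+x. ennreal (dens m \<mu> x) * indicator (UNIV - V) x \<partial>m) = 0"
    using integral_dens[OF assms(1), of "UNIV - V"] assms by auto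
  then have "AE x in m. ennreal (dens m \<mu> x) * indicator (UNIV - V) x = 0"
    using dens_ac(1)[OF assms(1)] assms(2) by (subst (asm) nn_integral_0_iff_AE) simp_all
  then show ?thesis
    by (rule eventually_mono)
      (use dens_ac(2)[OF assms(1)] in \<open>auto simp: ennreal_eq_0_iff indicator_def intro: antisym\<close>)
qed

lemma dens_le:
  assumes "ac \<mu>" "0 < c" and le: "\<And>A. A \<in> sets borel \<Longrightarrow> emeasure \<mu> A \<le> ennreal c * emeasure m A"
  shows "AE x in m. dens m \<mu> x \<le> c"
proof -
  note dm = dens_ac(1)[OF assms(1)]
  note [measurable] = dm
  define A where "A = {x. c < dens m \<mu> x}"
  have A[measurable]: "A \<in> sets borel"
  proof -
    have "{x \<in> space borel. c < dens m \<mu> x} \<in> sets borel" by measurable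
    then show ?thesis by (simp add: A_def)
  qed
  have eq: "(\<integral>\<^sup>+x. ennreal (dens m \<mu> x - c) * indicator A x \<partial>m) + ennreal c * emeasure m A = emeasure \<mu> A"
  proof -
    have "emeasure \<mu> A = (\<integral>\<^sup>+x. ennreal (dens m \<mu> x - c) * indicator A x + ennreal c * indicator A x \<partial>m)"
      unfolding integral_dens[OF assms(1) A, symmetric]
    proof (intro nn_integral_cong)
      fix x
      have "x \<in> A \<Longrightarrow> ennreal (dens m \<mu> x - c) + ennreal c = ennreal (dens m \<mu> x)"
        using assms(2) by (subst ennreal_plus[symmetric]) (auto simp: A_def)
      then show "ennreal (dens m \<mu> x) * indicator A x = ennreal (dens m \<mu> x - c) * indicator A x + ennreal c * indicator A x"
        by (auto simp: indicator_def)
    qed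
    also have "\<dots> = (\<integral>\<^sup>+x. ennreal (dens m \<mu> x - c) * indicator A x \<partial>m) + (\<integral>\<^sup>+x. ennreal c * indicator A x \<partial>m)"
      by (rule nn_integral_add) simp_all
    also have "(\<integral>\<^sup>+x. ennreal c * indicator A x \<partial>m) = ennreal c * emeasure m A"
      by (rule nn_integral_cmult_indicator) simp
    finally show ?thesis by simp
  qed
  moreover have "emeasure \<mu> A \<le> 1"
    using emeasure_mono[of A UNIV \<mu>] acD[OF assms(1)] by simp
  moreover have "ennreal c * emeasure m A \<le> (\<integral>\<^sup>+x. ennreal (dens m \<mu> x - c) * indicator A x \<partial>m) + ennreal c * emeasure m A"
    by simp
  \<comment> \<open>As \<open>\<mu>\<close> is a probability measure, this term is finite even if
    \<open>m\<close> is not, which justifies the cancellation below.\<close>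
  ultimately have "ennreal c * emeasure m A \<le> 1" by order
  then have "ennreal c * emeasure m A \<noteq> \<top>" by (auto simp: top_unique)
  moreover have "ennreal c * emeasure m A + (\<integral>\<^sup>+x. ennreal (dens m \<mu> x - c) * indicator A x \<partial>m) \<le> ennreal c * emeasure m A + 0"
    using eq le[OF A] by (simp only: add.commute[of "ennreal c * emeasure m A"] add_0)
  ultimately have "(\<integral>\<^sup>+x. ennreal (dens m \<mu> x - c) * indicator A x \<partial>m) \<le> 0"
    unfolding ennreal_add_left_cancel_le by simp
  then have "(\<integral>\<^sup>+x. ennreal (dens m \<mu> x - c) * indicator A x \<partial>m) = 0" by simp
  then have "AE x in m. ennreal (dens m \<mu> x - c) * indicator A x = 0"
    by (subst (asm) nn_integral_0_iff_AE) simp_all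
  then show ?thesis
    by (rule eventually_mono) (auto simp: A_def indicator_def ennreal_eq_0_iff split: if_splits)
qed

lemma ac_measure_pos:
  assumes "ac \<mu>" "V \<in> sets borel" "emeasure \<mu> (UNIV - V) = 0" "emeasure m V < \<infinity>"
  shows "0 < measure m V"
proof (rule ccontr)
  assume "\<not> 0 < measure m V"
  then have "measure m V = 0" using measure_nonneg[of m V] by linarith
  then have "emeasure m V = 0" using assms(4) by (auto simp: measure_def enn2real_eq_0_iff)
  then have "emeasure \<mu> V = 0" using assms(2) by (intro acD(5)[OF assms(1)] null_setsI) simp_all
  moreover have "emeasure \<mu> UNIV = emeasure \<mu> V + emeasure \<mu> (UNIV - V)"
    using assms(2) acD(2)[OF assms(1)] by (subst plus_emeasure) auto
  ultimately show False using acD(4)[OF assms(1)] assms(3) by simp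
qed

definition mixture :: "'a measure \<Rightarrow> 'a measure \<Rightarrow> 'a measure \<Rightarrow> bool" where
  "mixture \<mu> \<mu>1 \<mu>2 \<longleftrightarrow> (\<forall>A\<in>sets borel. emeasure \<mu> A = ennreal (1/2) * emeasure \<mu>1 A + ennreal (1/2) * emeasure \<mu>2 A)"

lemma dens_mixture:
  assumes a: "ac \<mu>1" "ac \<mu>2" "ac \<mu>" and B: "B \<in> sets borel" "emeasure \<mu>1 (UNIV - B) = 0" "emeasure \<mu>2 B = 0"
    and mix: "mixture \<mu> \<mu>1 \<mu>2"
  shows "AE x in m. dens m \<mu> x = (dens m \<mu>1 x + dens m \<mu>2 x) / 2 \<and> (dens m \<mu>1 x = 0 \<or> dens m \<mu>2 x = 0)"
proof -
  note [measurable] = dens_ac(1)[OF a(1)] dens_ac(1)[OF a(2)]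
  have "AE x in m. dens m \<mu> x = (dens m \<mu>1 x + dens m \<mu>2 x) / 2"
  proof (rule dens_unique[OF a(3)])
    show "\<mu> = density m (\<lambda>x. ennreal ((dens m \<mu>1 x + dens m \<mu>2 x) / 2))"
    proof (rule measure_eqI)
      fix A assume "A \<in> sets \<mu>"
      then have A[measurable]: "A \<in> sets borel" using acD(2)[OF a(3)] by simp
      have "emeasure (density m (\<lambda>x. ennreal ((dens m \<mu>1 x + dens m \<mu>2 x) / 2))) A =
          (\<integral>\<^sup>+x. ennreal ((dens m \<mu>1 x + dens m \<mu>2 x) / 2) * indicator A x \<partial>m)"
        by (rule emeasure_density) simp_all
      also have "\<dots> = (\<integral>\<^sup>+x. ennreal (1/2) * (ennreal (dens m \<mu>1 x) * indicator A x)
          + ennreal (1/2) * (ennreal (dens m \<mu>2 x) * indicator A x) \<partial>m)"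
        unfolding ennreal_mean[OF dens_ac(2)[OF a(1)] dens_ac(2)[OF a(2)]]
        by (simp only: distrib_right mult.assoc)
      also have "\<dots> = (\<integral>\<^sup>+x. ennreal (1/2) * (ennreal (dens m \<mu>1 x) * indicator A x) \<partial>m)
          + (\<integral>\<^sup>+x. ennreal (1/2) * (ennreal (dens m \<mu>2 x) * indicator A x) \<partial>m)"
        by (rule nn_integral_add) simp_all
      also have "\<dots> = ennreal (1/2) * emeasure \<mu>1 A + ennreal (1/2) * emeasure \<mu>2 A"
        unfolding integral_dens[OF a(1) A, symmetric] integral_dens[OF a(2) A, symmetric]
        by (intro arg_cong2[where f = "(+)"] nn_integral_cmult) simp_all
      finally show "emeasure \<mu> A = emeasure (density m (\<lambda>x. ennreal ((dens m \<mu>1 x + dens m \<mu>2 x) / 2))) A"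
        using mix A by (simp add: mixture_def)
    qed (simp add: acD(2)[OF a(3)])
  qed (use dens_ac(2)[OF a(1)] dens_ac(2)[OF a(2)] in simp_all)
  moreover have "AE x in m. x \<notin> B \<longrightarrow> dens m \<mu>1 x = 0"
    by (rule dens_supp[OF a(1) B(1,2)])
  moreover have "AE x in m. x \<notin> UNIV - B \<longrightarrow> dens m \<mu>2 x = 0"
    using B by (intro dens_supp[OF a(2)]) (auto simp: Diff_Diff_Int)
  ultimately show ?thesis by eventually_elim auto
qed

lemma nn_integral_ac:
  assumes "ac \<mu>" and h: "h \<in> borel_measurable borel"
  shows "(\<integral>\<^sup>+x. h x \<partial>\<mu>) = (\<integral>\<^sup>+x. ennreal (dens m \<mu> x) * h x \<partial>m)"
proof -
  define \<rho> where "\<rho> = dens m \<mu>"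
  have \<mu>: "\<mu> = density m (\<lambda>x. ennreal (\<rho> x))" and [measurable]: "\<rho> \<in> borel_measurable borel"
    using dens_ac(1,3)[OF assms(1)] by (simp_all only: \<rho>_def)
  show ?thesis
    unfolding \<rho>_def[symmetric] using h by (subst \<mu>, intro nn_integral_density) simp_all
qed

lemma dens_integral_1:
  assumes "ac \<mu>"
  shows "integrable m (dens m \<mu>)" "(\<integral>x. dens m \<mu> x \<partial>m) = 1"
proof -
  note d = dens_ac(1,2)[OF assms]
  have e: "(\<integral>\<^sup>+x. ennreal (dens m \<mu> x) \<partial>m) = 1"
    using integral_dens[OF assms, of UNIV] acD(4)[OF assms] by simp
  then show i: "integrable m (dens m \<mu>)"
    using d by (intro integrableI_nonneg) simp_all
  show "(\<integral>x. dens m \<mu> x \<partial>m) = 1"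
    using d e by (subst integral_eq_nn_integral) simp_all
qed

section \<open>Finite N: the power integral and its logarithm\<close>

definition pow_int :: "real \<Rightarrow> 'a measure \<Rightarrow> ennreal" where
  "pow_int n \<mu> = (\<integral>\<^sup>+x. ennreal (dens m \<mu> x powr (1 - 1 / n)) \<partial>m)"

text \<open>Bridges two forms of the functional: the power \<open>- 1 / n\<close> of the density
  integrated against \<open>\<mu>\<close>, as in the curvature conditions, and the power
  \<open>1 - 1 / n\<close> against \<open>m\<close>.\<close>

lemma pow_int_inv_root:
  assumes "ac \<mu>"
  shows "inv_root_dens m n \<mu> \<in> borel_measurable borel" "(\<integral>\<^sup>+x. inv_root_dens m n \<mu> x \<partial>\<mu>) = pow_int n \<mu>"
proof -
  note [measurable] = dens_ac(1)[OF assms]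
  have [measurable]: "sing m \<mu> \<in> sets borel" using dens_ac(4)[OF assms] by auto
  show i: "inv_root_dens m n \<mu> \<in> borel_measurable borel"
    unfolding inv_root_dens_def[abs_def] by measurable
  have "(\<integral>\<^sup>+x. inv_root_dens m n \<mu> x \<partial>\<mu>) = (\<integral>\<^sup>+x. ennreal (dens m \<mu> x) * inv_root_dens m n \<mu> x \<partial>m)"
    by (rule nn_integral_ac[OF assms i])
  also have "\<dots> = pow_int n \<mu>"
    unfolding pow_int_def
  proof (rule nn_integral_cong_AE)
    have "AE x in m. x \<notin> sing m \<mu>" by (rule AE_not_in[OF dens_ac(4)[OF assms]])
    then show "AE x in m. ennreal (dens m \<mu> x) * inv_root_dens m n \<mu> x = ennreal (dens m \<mu> x powr (1 - 1 / n))"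
    proof eventually_elim
      fix x assume "x \<notin> sing m \<mu>"
      moreover have "dens m \<mu> x * dens m \<mu> x powr (- 1 / n) = dens m \<mu> x powr (1 - 1 / n)"
        using powr_mult_base[OF dens_ac(2)[OF assms], of x "- 1 / n"] by simp
      ultimately show "ennreal (dens m \<mu> x) * inv_root_dens m n \<mu> x = ennreal (dens m \<mu> x powr (1 - 1 / n))"
        using dens_ac(2)[OF assms, of x] by (simp add: inv_root_dens_def ennreal_mult[symmetric])
    qed
  qed
  finally show "(\<integral>\<^sup>+x. inv_root_dens m n \<mu> x \<partial>\<mu>) = pow_int n \<mu>" .
qed

lemma pow_int_pos:
  assumes "ac \<mu>"
  shows "pow_int n \<mu> \<noteq> 0"
proof
  note [measurable] = dens_ac(1)[OF assms]
  assume "pow_int n \<mu> = 0"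
  then have "AE x in m. ennreal (dens m \<mu> x powr (1 - 1 / n)) = 0"
    unfolding pow_int_def by (subst (asm) nn_integral_0_iff_AE) simp_all
  then have "AE x in m. ennreal (dens m \<mu> x) = 0"
    by (rule eventually_mono) (auto simp: ennreal_eq_0_iff)
  then have "(\<integral>\<^sup>+x. ennreal (dens m \<mu> x) \<partial>m) = 0"
    by (subst nn_integral_0_iff_AE) simp_all
  then show False using integral_dens[OF assms, of UNIV] acD(4)[OF assms] by simp
qed

text \<open>Jensen's inequality on \<open>V\<close>, obtained by integrating Young's inequality
  between the density and the constant \<open>1 / v\<close> with weights \<open>\<alpha>\<close> and
  \<open>1 - \<alpha>\<close>. The weights sum to 1, which leaves
  \<open>v powr (1 - \<alpha>)\<close>, and \<open>1 - \<alpha> = 1 / n\<close>.\<close>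

lemma pow_int_le:
  assumes "ac \<mu>" and n: "1 < n" and V: "V \<in> sets borel" "emeasure \<mu> (UNIV - V) = 0" "emeasure m V < \<infinity>"
  shows "pow_int n \<mu> \<le> ennreal (measure m V powr (1 / n))"
proof -
  note [measurable] = dens_ac(1)[OF assms(1)] V(1)
  define v where "v = measure m V"
  define \<alpha> where "\<alpha> = 1 - 1 / n"
  have v: "0 < v" unfolding v_def by (rule ac_measure_pos[OF assms(1) V])
  have ev: "emeasure m V = ennreal v"
    unfolding v_def using V(3) by (intro emeasure_eq_ennreal_measure) auto
  have \<alpha>: "0 < \<alpha>" "\<alpha> < 1" using n by (auto simp: \<alpha>_def)
  have young: "x powr \<alpha> \<le> v powr (1 - \<alpha>) * (\<alpha> * x + (1 - \<alpha>) / v)" if "0 \<le> x" for x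
  proof (cases "x = 0")
    case False
    have "x powr \<alpha> * (1 / v) powr (1 - \<alpha>) \<le> \<alpha> * x + (1 - \<alpha>) * (1 / v)"
      using \<alpha> v that False by (intro Youngs_inequality_0) auto
    then have "v powr (1 - \<alpha>) * (x powr \<alpha> * (1 / v) powr (1 - \<alpha>)) \<le> v powr (1 - \<alpha>) * (\<alpha> * x + (1 - \<alpha>) * (1 / v))"
      by (intro mult_left_mono) auto
    moreover have "v powr (1 - \<alpha>) * (1 / v) powr (1 - \<alpha>) = 1"
      using v by (simp add: powr_mult[symmetric])
    then have "v powr (1 - \<alpha>) * (x powr \<alpha> * (1 / v) powr (1 - \<alpha>)) = x powr \<alpha>"
      by (metis mult.left_commute mult.right_neutral)
    ultimately show ?thesis by simp
  qed (use \<alpha> v in auto)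
  have "pow_int n \<mu> \<le> (\<integral>\<^sup>+x. ennreal (v powr (1 - \<alpha>) * \<alpha>) * ennreal (dens m \<mu> x)
      + ennreal (v powr (1 - \<alpha>) * (1 - \<alpha>) / v) * indicator V x \<partial>m)"
    unfolding pow_int_def \<alpha>_def[symmetric]
  proof (rule nn_integral_mono_AE)
    show "AE x in m. ennreal (dens m \<mu> x powr \<alpha>) \<le>
      ennreal (v powr (1 - \<alpha>) * \<alpha>) * ennreal (dens m \<mu> x) + ennreal (v powr (1 - \<alpha>) * (1 - \<alpha>) / v) * indicator V x"
      using dens_supp[OF assms(1) V(1,2)]
    proof eventually_elim
      fix x assume x: "x \<notin> V \<longrightarrow> dens m \<mu> x = 0"
      show "ennreal (dens m \<mu> x powr \<alpha>) \<le>
        ennreal (v powr (1 - \<alpha>) * \<alpha>) * ennreal (dens m \<mu> x) + ennreal (v powr (1 - \<alpha>) * (1 - \<alpha>) / v) * indicator V x"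
      proof (cases "x \<in> V")
        case True
        have d: "0 \<le> dens m \<mu> x" by (rule dens_ac(2)[OF assms(1)])
        have "ennreal (dens m \<mu> x powr \<alpha>) \<le> ennreal (v powr (1 - \<alpha>) * \<alpha> * dens m \<mu> x + v powr (1 - \<alpha>) * (1 - \<alpha>) / v)"
          using young[OF d] by (intro ennreal_leI) (simp add: algebra_simps)
        also have "\<dots> = ennreal (v powr (1 - \<alpha>) * \<alpha> * dens m \<mu> x) + ennreal (v powr (1 - \<alpha>) * (1 - \<alpha>) / v)"
          using d \<alpha> v by (intro ennreal_plus) auto
        also have "ennreal (v powr (1 - \<alpha>) * \<alpha> * dens m \<mu> x) = ennreal (v powr (1 - \<alpha>) * \<alpha>) * ennreal (dens m \<mu> x)"
          using d \<alpha> by (intro ennreal_mult) auto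
        finally show ?thesis using True by simp
      qed (use x in simp)
    qed
  qed
  also have "\<dots> = (\<integral>\<^sup>+x. ennreal (v powr (1 - \<alpha>) * \<alpha>) * ennreal (dens m \<mu> x) \<partial>m)
      + (\<integral>\<^sup>+x. ennreal (v powr (1 - \<alpha>) * (1 - \<alpha>) / v) * indicator V x \<partial>m)"
    by (rule nn_integral_add) simp_all
  also have "(\<integral>\<^sup>+x. ennreal (v powr (1 - \<alpha>) * \<alpha>) * ennreal (dens m \<mu> x) \<partial>m) = ennreal (v powr (1 - \<alpha>) * \<alpha>)"
    using integral_dens[OF assms(1), of UNIV] acD(4)[OF assms(1)] by (subst nn_integral_cmult) simp_all
  also have "(\<integral>\<^sup>+x. ennreal (v powr (1 - \<alpha>) * (1 - \<alpha>) / v) * indicator V x \<partial>m) = ennreal (v powr (1 - \<alpha>) * (1 - \<alpha>) / v) * ennreal v"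
    unfolding ev[symmetric] by (rule nn_integral_cmult_indicator) simp
  also have "\<dots> = ennreal (v powr (1 - \<alpha>) * (1 - \<alpha>))"
    using v \<alpha> by (subst ennreal_mult[symmetric]) auto
  also have "ennreal (v powr (1 - \<alpha>) * \<alpha>) + ennreal (v powr (1 - \<alpha>) * (1 - \<alpha>)) = ennreal (v powr (1 - \<alpha>) * \<alpha> + v powr (1 - \<alpha>) * (1 - \<alpha>))"
    using v \<alpha> by (intro ennreal_plus[symmetric]) auto
  also have "\<dots> = ennreal (measure m V powr (1 / n))"
    by (rule arg_cong[where f = ennreal]) (simp add: \<alpha>_def v_def algebra_simps)
  finally show ?thesis .
qed

lemma ac_uniform:
  assumes E: "E \<in> sets borel" "0 < measure m E" and \<mu>: "\<mu> = density m (\<lambda>x. ennreal (indicator E x / measure m E))"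
  shows "ac \<mu>" "AE x in m. dens m \<mu> x = indicator E x / measure m E" "emeasure m E = ennreal (measure m E)"
proof -
  note [measurable] = E(1)
  \<comment> \<open>\<open>measure\<close> is 0 on sets of infinite measure, so positivity entails
    finiteness.\<close>
  show e: "emeasure m E = ennreal (measure m E)"
    using E(2) by (intro emeasure_eq_ennreal_measure) (auto simp: measure_def)
  have f: "(\<lambda>x. indicator E x / measure m E) \<in> borel_measurable borel" by measurable
  have "emeasure \<mu> UNIV = (\<integral>\<^sup>+x. ennreal (1 / measure m E) * indicator E x \<partial>m)"
    unfolding \<mu> by (subst emeasure_density) (auto intro!: nn_integral_cong simp: indicator_def)
  also have "\<dots> = ennreal (1 / measure m E) * emeasure m E"
    by (rule nn_integral_cmult_indicator) simp
  also have "\<dots> = 1" unfolding e using E(2) by (simp add: ennreal_mult[symmetric])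
  finally have "emeasure \<mu> UNIV = 1" .
  then show a: "ac \<mu>"
    unfolding ac_def using f
    by (intro conjI prob_spaceI) (auto simp: \<mu> absolutely_continuousI_density)
  show "AE x in m. dens m \<mu> x = indicator E x / measure m E"
    by (rule dens_unique[OF a f _ \<mu>]) simp
qed

lemma pow_int_uniform:
  assumes E: "E \<in> sets borel" "0 < measure m E" and \<mu>: "\<mu> = density m (\<lambda>x. ennreal (indicator E x / measure m E))"
    and n: "1 < n"
  shows "pow_int n \<mu> = ennreal (measure m E powr (1 / n))"
proof -
  define v where "v = measure m E"
  have v: "0 < v" using E by (simp add: v_def)
  have "pow_int n \<mu> = (\<integral>\<^sup>+x. ennreal ((1 / v) powr (1 - 1 / n)) * indicator E x \<partial>m)"
    unfolding pow_int_def
    by (rule nn_integral_cong_AE, rule eventually_mono[OF ac_uniform(2)[OF E \<mu>]])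
      (auto simp: v_def indicator_def)
  also have "\<dots> = ennreal ((1 / v) powr (1 - 1 / n)) * emeasure m E"
    using E(1) by (intro nn_integral_cmult_indicator) simp
  also have "\<dots> = ennreal ((1 / v) powr (1 - 1 / n) * v)"
    unfolding ac_uniform(3)[OF E \<mu>] v_def[symmetric] using v by (simp add: ennreal_mult)
  also have "(1 / v) powr (1 - 1 / n) * v = v powr (1 / n)"
  proof -
    have "(1 / v) powr (1 - 1 / n) = v powr (1 / n - 1)"
      using v by (simp add: powr_divide powr_minus_divide[symmetric])
    moreover have "v powr (1 / n - 1) * v = v powr (1 / n)"
      using powr_add[of v "1 / n - 1" 1] v by simp
    ultimately show ?thesis by simp
  qed
  finally show ?thesis by (simp add: v_def)
qed

text \<open>At almost every point one of the two densities vanishes, so the power of their half sum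
  splits although powers are not additive.\<close>

lemma pow_int_mixture:
  assumes a: "ac \<mu>1" "ac \<mu>2" "ac \<mu>" and B: "B \<in> sets borel" "emeasure \<mu>1 (UNIV - B) = 0" "emeasure \<mu>2 B = 0"
    and mix: "mixture \<mu> \<mu>1 \<mu>2" and n: "1 < n"
  shows "pow_int n \<mu> = ennreal ((1/2) powr (1 - 1 / n)) * (pow_int n \<mu>1 + pow_int n \<mu>2)"
proof -
  note [measurable] = dens_ac(1)[OF a(1)] dens_ac(1)[OF a(2)]
  have "pow_int n \<mu> = (\<integral>\<^sup>+x. ennreal ((1/2) powr (1 - 1 / n)) * (ennreal (dens m \<mu>1 x powr (1 - 1 / n)) + ennreal (dens m \<mu>2 x powr (1 - 1 / n))) \<partial>m)"
    unfolding pow_int_def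
  proof (rule nn_integral_cong_AE, rule eventually_mono[OF dens_mixture[OF a B mix]])
    fix x assume x: "dens m \<mu> x = (dens m \<mu>1 x + dens m \<mu>2 x) / 2 \<and> (dens m \<mu>1 x = 0 \<or> dens m \<mu>2 x = 0)"
    have half: "(y / 2) powr (1 - 1 / n) = (1/2) powr (1 - 1 / n) * y powr (1 - 1 / n)" if "0 \<le> y" for y
      using that powr_mult[of "1/2" y] by simp
    show "ennreal (dens m \<mu> x powr (1 - 1 / n)) =
        ennreal ((1/2) powr (1 - 1 / n)) * (ennreal (dens m \<mu>1 x powr (1 - 1 / n)) + ennreal (dens m \<mu>2 x powr (1 - 1 / n)))"
      using conjunct2[OF x] half[OF dens_ac(2)[OF a(1), of x]] half[OF dens_ac(2)[OF a(2), of x]]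
      unfolding conjunct1[OF x] by (elim disjE) (simp_all add: ennreal_mult[symmetric])
  qed
  also have "\<dots> = ennreal ((1/2) powr (1 - 1 / n)) * (\<integral>\<^sup>+x. ennreal (dens m \<mu>1 x powr (1 - 1 / n)) + ennreal (dens m \<mu>2 x powr (1 - 1 / n)) \<partial>m)"
    by (rule nn_integral_cmult) simp
  also have "(\<integral>\<^sup>+x. ennreal (dens m \<mu>1 x powr (1 - 1 / n)) + ennreal (dens m \<mu>2 x powr (1 - 1 / n)) \<partial>m) = pow_int n \<mu>1 + pow_int n \<mu>2"
    unfolding pow_int_def by (rule nn_integral_add) simp_all
  finally show ?thesis .
qed

definition pow_ent :: "real \<Rightarrow> 'a measure \<Rightarrow> real" where
  "pow_ent n \<mu> = - n * ln (enn2real (pow_int n \<mu>))"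

lemma pow_int_real:
  assumes "ac \<mu>" "1 < n" "V \<in> sets borel" "emeasure \<mu> (UNIV - V) = 0" "emeasure m V < \<infinity>"
  shows "pow_int n \<mu> = ennreal (enn2real (pow_int n \<mu>))" "0 < enn2real (pow_int n \<mu>)"
proof -
  have "pow_int n \<mu> < \<top>" using pow_int_le[OF assms] by (rule order.strict_trans1) simp
  then show "pow_int n \<mu> = ennreal (enn2real (pow_int n \<mu>))" "0 < enn2real (pow_int n \<mu>)"
    using pow_int_pos[OF assms(1), of n] by (auto simp: enn2real_positive_iff zero_less_iff_neq_zero)
qed

lemma pow_ent_lower:
  assumes "ac \<mu>" "1 < n" "V \<in> sets borel" "emeasure \<mu> (UNIV - V) = 0" "emeasure m V < \<infinity>"
  shows "- ln (measure m V) \<le> pow_ent n \<mu>"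
proof -
  have v: "0 < measure m V" by (rule ac_measure_pos[OF assms(1,3-5)])
  have "enn2real (pow_int n \<mu>) \<le> measure m V powr (1 / n)"
    using pow_int_le[OF assms] by (intro enn2real_leI) auto
  then have "ln (enn2real (pow_int n \<mu>)) \<le> ln (measure m V powr (1 / n))"
    using pow_int_real(2)[OF assms] v by (intro ln_mono) auto
  also have "\<dots> = ln (measure m V) / n" using v by (simp add: ln_powr)
  finally have "n * ln (enn2real (pow_int n \<mu>)) \<le> n * (ln (measure m V) / n)"
    using assms(2) by (intro mult_left_mono) auto
  then show ?thesis using assms(2) by (simp add: pow_ent_def)
qed

lemma pow_ent_uniform:
  assumes E: "E \<in> sets borel" "0 < measure m E" and \<mu>: "\<mu> = density m (\<lambda>x. ennreal (indicator E x / measure m E))"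
    and n: "1 < n"
  shows "pow_ent n \<mu> = - ln (measure m E)"
  using E(2) n by (simp add: pow_ent_def pow_int_uniform[OF assms] ln_powr)

text \<open>Since \<open>- n * (1 - 1 / n) * ln (1/2) = n * ln 2 - ln 2\<close>, the mixture has the
  value \<open>- n * ln ((u1 + u2) / 2) - ln 2\<close>; the inequality of arithmetic and geometric
  means then brings in the average of the two entropies.\<close>

lemma pow_ent_mixture:
  assumes a: "ac \<mu>1" "ac \<mu>2" "ac \<mu>" and B: "B \<in> sets borel" "emeasure \<mu>1 (UNIV - B) = 0" "emeasure \<mu>2 B = 0"
    and mix: "mixture \<mu> \<mu>1 \<mu>2" and n: "1 < n"
    and V: "V \<in> sets borel" "emeasure \<mu>1 (UNIV - V) = 0" "emeasure \<mu>2 (UNIV - V) = 0" "emeasure m V < \<infinity>"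
  shows "pow_ent n \<mu> \<le> (pow_ent n \<mu>1 + pow_ent n \<mu>2) / 2 - ln 2"
proof -
  define u1 where "u1 = enn2real (pow_int n \<mu>1)"
  define u2 where "u2 = enn2real (pow_int n \<mu>2)"
  note r1 = pow_int_real[OF a(1) n V(1,2,4), folded u1_def] and r2 = pow_int_real[OF a(2) n V(1,3,4), folded u2_def]
  have "pow_int n \<mu> = ennreal ((1/2) powr (1 - 1 / n)) * (ennreal u1 + ennreal u2)"
    unfolding pow_int_mixture[OF a B mix n] r1(1)[symmetric] r2(1)[symmetric] ..
  also have "ennreal u1 + ennreal u2 = ennreal (u1 + u2)" using r1 r2 by (intro ennreal_plus[symmetric]) auto
  also have "ennreal ((1/2) powr (1 - 1 / n)) * ennreal (u1 + u2) = ennreal ((1/2) powr (1 - 1 / n) * (u1 + u2))"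
    using r1 r2 by (intro ennreal_mult[symmetric]) auto
  finally have "enn2real (pow_int n \<mu>) = (1/2) powr (1 - 1 / n) * (u1 + u2)" using r1(2) r2(2) by simp
  then have "pow_ent n \<mu> = - n * ((1 - 1 / n) * ln (1/2) + ln (u1 + u2))"
    using r1(2) r2(2) by (simp add: pow_ent_def ln_mult ln_powr)
  also have "\<dots> = - n * (ln (u1 + u2) - ln 2) - ln 2"
    using n by (simp add: ln_div algebra_simps)
  also have "\<dots> \<le> - n * ((ln u1 + ln u2) / 2) - ln 2"
  proof -
    have "sqrt (u1 * u2) \<le> (u1 + u2) / 2" using r1(2) r2(2) by (intro arith_geo_mean_sqrt) auto
    then have "ln (sqrt (u1 * u2)) \<le> ln ((u1 + u2) / 2)" using r1(2) r2(2) by (intro ln_mono) auto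
    then have "(ln u1 + ln u2) / 2 \<le> ln (u1 + u2) - ln 2"
      using r1(2) r2(2) by (simp add: ln_sqrt ln_mult ln_div)
    then have "n * ((ln u1 + ln u2) / 2) \<le> n * (ln (u1 + u2) - ln 2)" using n by (intro mult_left_mono) auto
    then show ?thesis by simp
  qed
  also have "\<dots> = (pow_ent n \<mu>1 + pow_ent n \<mu>2) / 2 - ln 2"
    by (simp add: pow_ent_def u1_def u2_def algebra_simps)
  finally show ?thesis .
qed

section \<open>N infinite: the Boltzmann entropy\<close>

definition log_ent :: "'a measure \<Rightarrow> real" where
  "log_ent \<mu> = (\<integral>x. dens m \<mu> x * ln (dens m \<mu> x) \<partial>m)"

text \<open>\<open>log_ent\<close> is a Bochner integral and would be 0 without integrability, so
  its value carries information only together with this predicate.\<close>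

definition fin_ent :: "'a measure \<Rightarrow> bool" where
  "fin_ent \<mu> \<longleftrightarrow> ac \<mu> \<and> integrable m (\<lambda>x. dens m \<mu> x * ln (dens m \<mu> x))"

lemma log_ent_lower:
  assumes "fin_ent \<mu>" and V: "V \<in> sets borel" "emeasure \<mu> (UNIV - V) = 0" "emeasure m V < \<infinity>"
  shows "- ln (measure m V) \<le> log_ent \<mu>"
proof -
  have a: "ac \<mu>" and i: "integrable m (\<lambda>x. dens m \<mu> x * ln (dens m \<mu> x))"
    using assms(1) by (auto simp: fin_ent_def)
  define v where "v = measure m V"
  have v: "0 < v" unfolding v_def by (rule ac_measure_pos[OF a V])
  have iV: "integrable m (indicator V :: 'a \<Rightarrow> real)" using V by simp
  have "- ln v = (\<integral>x. dens m \<mu> x * (1 - ln v) - indicator V x * (1 / v) \<partial>m)"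
    using dens_integral_1[OF a] iV v V by (simp add: v_def)
  also have "\<dots> \<le> log_ent \<mu>"
    unfolding log_ent_def
  proof (rule integral_mono_AE)
    show "integrable m (\<lambda>x. dens m \<mu> x * (1 - ln v) - indicator V x * (1 / v))"
      using dens_integral_1[OF a] iV by (intro Bochner_Integration.integrable_diff integrable_mult_left) auto
    show "AE x in m. dens m \<mu> x * (1 - ln v) - indicator V x * (1 / v) \<le> dens m \<mu> x * ln (dens m \<mu> x)"
      using dens_supp[OF a V(1,2)]
    proof eventually_elim
      fix x assume "x \<notin> V \<longrightarrow> dens m \<mu> x = 0"
      then show "dens m \<mu> x * (1 - ln v) - indicator V x * (1 / v) \<le> dens m \<mu> x * ln (dens m \<mu> x)"
        using x_ln_x_ge[OF dens_ac(2)[OF a, of x] v] by (cases "x \<in> V") auto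
    qed
  qed (rule i)
  finally show ?thesis by (simp add: v_def)
qed

lemma log_ent_upper:
  assumes a: "ac \<mu>" and V: "V \<in> sets borel" "emeasure \<mu> (UNIV - V) = 0" "emeasure m V < \<infinity>"
    and c: "1 \<le> c" "AE x in m. dens m \<mu> x \<le> c"
  shows "fin_ent \<mu>" "log_ent \<mu> \<le> ln c"
proof -
  note [measurable] = dens_ac(1)[OF a] V(1)
  have iV: "integrable m (\<lambda>x. (1 + c * ln c) * indicator V x)" using V by simp
  have le: "y * ln y \<le> y * ln c" if "0 \<le> y" "y \<le> c" for y
    using that c by (cases "y = 0") (auto intro!: mult_left_mono ln_mono)
  have i: "integrable m (\<lambda>x. dens m \<mu> x * ln (dens m \<mu> x))"
  proof (rule Bochner_Integration.integrable_bound[OF iV])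
    show "AE x in m. norm (dens m \<mu> x * ln (dens m \<mu> x)) \<le> norm ((1 + c * ln c) * indicator V x)"
      using dens_supp[OF a V(1,2)] c(2)
    proof eventually_elim
      fix x assume x: "x \<notin> V \<longrightarrow> dens m \<mu> x = 0" "dens m \<mu> x \<le> c"
      note d = dens_ac(2)[OF a, of x]
      have lc: "0 \<le> c * ln c" using c by simp
      have "dens m \<mu> x * ln c \<le> c * ln c" using x c by (intro mult_right_mono) auto
      then have "dens m \<mu> x * ln (dens m \<mu> x) \<le> c * ln c" using le[OF d x(2)] by linarith
      moreover have "- 1 \<le> dens m \<mu> x * ln (dens m \<mu> x)"
        using x_ln_x_ge[OF d, of 1] d by simp
      ultimately have "\<bar>dens m \<mu> x * ln (dens m \<mu> x)\<bar> \<le> 1 + c * ln c" using lc by linarith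
      then show "norm (dens m \<mu> x * ln (dens m \<mu> x)) \<le> norm ((1 + c * ln c) * indicator V x)"
        using x lc by (cases "x \<in> V") auto
    qed
  qed simp
  then show "fin_ent \<mu>" using a by (simp add: fin_ent_def)
  have "log_ent \<mu> \<le> (\<integral>x. dens m \<mu> x * ln c \<partial>m)"
    unfolding log_ent_def
  proof (rule integral_mono_AE[OF i])
    show "integrable m (\<lambda>x. dens m \<mu> x * ln c)" using dens_integral_1[OF a] by simp
    show "AE x in m. dens m \<mu> x * ln (dens m \<mu> x) \<le> dens m \<mu> x * ln c"
      using c(2) by eventually_elim (rule le[OF dens_ac(2)[OF a]])
  qed
  also have "\<dots> = ln c" using dens_integral_1[OF a] by simp
  finally show "log_ent \<mu> \<le> ln c" .
qed

lemma log_ent_uniform: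
  assumes E: "E \<in> sets borel" "0 < measure m E" and \<mu>: "\<mu> = density m (\<lambda>x. ennreal (indicator E x / measure m E))"
  shows "log_ent \<mu> = - ln (measure m E)"
proof -
  note [measurable] = dens_ac(1)[OF ac_uniform(1)[OF assms]] E(1)
  have "log_ent \<mu> = (\<integral>x. indicator E x * (- ln (measure m E) / measure m E) \<partial>m)"
    unfolding log_ent_def
  proof (rule integral_cong_AE)
    show "AE x in m. dens m \<mu> x * ln (dens m \<mu> x) = indicator E x * (- ln (measure m E) / measure m E)"
      using ac_uniform(2)[OF assms]
    proof eventually_elim
      fix x assume x: "dens m \<mu> x = indicator E x / measure m E"
      show "dens m \<mu> x * ln (dens m \<mu> x) = indicator E x * (- ln (measure m E) / measure m E)"
        unfolding x using E(2) by (cases "x \<in> E") (auto simp: ln_div)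
    qed
  qed simp_all
  also have "\<dots> = - ln (measure m E)"
    using E ac_uniform(3)[OF assms] by simp
  finally show ?thesis .
qed

text \<open>Halving a density lowers the entropy by \<open>ln 2\<close> per unit of mass, and by
  disjointness no cross terms arise.\<close>

lemma log_ent_mixture:
  assumes f: "fin_ent \<mu>1" "fin_ent \<mu>2" and a: "ac \<mu>"
    and B: "B \<in> sets borel" "emeasure \<mu>1 (UNIV - B) = 0" "emeasure \<mu>2 B = 0"
    and mix: "mixture \<mu> \<mu>1 \<mu>2"
  shows "log_ent \<mu> = (log_ent \<mu>1 + log_ent \<mu>2) / 2 - ln 2"
proof -
  have a12: "ac \<mu>1" "ac \<mu>2" and i: "integrable m (\<lambda>x. dens m \<mu>1 x * ln (dens m \<mu>1 x))"
    "integrable m (\<lambda>x. dens m \<mu>2 x * ln (dens m \<mu>2 x))"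
    using f by (auto simp: fin_ent_def)
  note [measurable] = dens_ac(1)[OF a12(1)] dens_ac(1)[OF a12(2)] dens_ac(1)[OF a]
  note d = dens_integral_1[OF a12(1)] dens_integral_1[OF a12(2)]
  have "log_ent \<mu> = (\<integral>x. (dens m \<mu>1 x * ln (dens m \<mu>1 x) + dens m \<mu>2 x * ln (dens m \<mu>2 x)) * (1/2)
      - (dens m \<mu>1 x + dens m \<mu>2 x) * (ln 2 / 2) \<partial>m)"
    unfolding log_ent_def
  proof (rule integral_cong_AE)
    show "AE x in m. dens m \<mu> x * ln (dens m \<mu> x) = (dens m \<mu>1 x * ln (dens m \<mu>1 x) + dens m \<mu>2 x * ln (dens m \<mu>2 x)) * (1/2)
      - (dens m \<mu>1 x + dens m \<mu>2 x) * (ln 2 / 2)"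
      using dens_mixture[OF a12 a B mix]
    proof eventually_elim
      fix x assume x: "dens m \<mu> x = (dens m \<mu>1 x + dens m \<mu>2 x) / 2 \<and> (dens m \<mu>1 x = 0 \<or> dens m \<mu>2 x = 0)"
      have half: "(y / 2) * ln (y / 2) = y * ln y * (1/2) - y * (ln 2 / 2)" if "0 \<le> y" for y :: real
        using that by (cases "y = 0") (simp_all add: ln_div algebra_simps)
      show "dens m \<mu> x * ln (dens m \<mu> x) = (dens m \<mu>1 x * ln (dens m \<mu>1 x) + dens m \<mu>2 x * ln (dens m \<mu>2 x)) * (1/2)
      - (dens m \<mu>1 x + dens m \<mu>2 x) * (ln 2 / 2)"
        using conjunct2[OF x] half[OF dens_ac(2)[OF a12(1), of x]] half[OF dens_ac(2)[OF a12(2), of x]]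
        unfolding conjunct1[OF x] by (elim disjE) (simp_all only: add_0 add_0_right mult_zero_left)
    qed
  qed simp_all
  also have "\<dots> = (log_ent \<mu>1 + log_ent \<mu>2) / 2 - ln 2"
    using i d by (simp add: log_ent_def)
  finally show ?thesis .
qed

lemma Ent_inf_fin_ent: "fin_ent \<mu> \<Longrightarrow> Ent_inf m \<mu> = ereal (log_ent \<mu>)"
  by (simp add: Ent_inf_def fin_ent_def eint_integrable log_ent_def dens_ac(5))

text \<open>Because \<open>x * ln x \<ge> - 1\<close>, the negative part is integrable over a set of
  finite measure, so an upper bound on \<open>Ent_inf\<close> excludes an infinite positive
  part.\<close>

lemma Ent_inf_le_fin_ent:
  assumes a: "ac \<mu>" and V: "V \<in> sets borel" "emeasure \<mu> (UNIV - V) = 0" "emeasure m V < \<infinity>"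
    and le: "Ent_inf m \<mu> \<le> ereal c"
  shows "fin_ent \<mu>" "log_ent \<mu> \<le> c"
proof -
  note [measurable] = dens_ac(1)[OF a] V(1)
  let ?f = "\<lambda>x. dens m \<mu> x * ln (dens m \<mu> x)"
  have "(\<integral>\<^sup>+x. ennreal (- ?f x) \<partial>m) \<le> (\<integral>\<^sup>+x. indicator V x \<partial>m)"
  proof (rule nn_integral_mono_AE)
    show "AE x in m. ennreal (- ?f x) \<le> indicator V x"
      using dens_supp[OF a V(1,2)]
    proof eventually_elim
      fix x assume x: "x \<notin> V \<longrightarrow> dens m \<mu> x = 0"
      have "- 1 \<le> ?f x" using x_ln_x_ge[OF dens_ac(2)[OF a], of 1 x] dens_ac(2)[OF a, of x] by simp
      then have "- ?f x \<le> 1" by linarith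
      then show "ennreal (- ?f x) \<le> indicator V x"
        using x by (cases "x \<in> V") (simp_all add: ennreal_le_1)
    qed
  qed
  also have "\<dots> < \<infinity>" using V by simp
  finally have N: "(\<integral>\<^sup>+x. ennreal (- ?f x) \<partial>m) \<noteq> \<infinity>" by simp
  have "(\<integral>\<^sup>+x. ennreal (?f x) \<partial>m) \<noteq> \<infinity>"
  proof
    assume P: "(\<integral>\<^sup>+x. ennreal (?f x) \<partial>m) = \<infinity>"
    obtain q where "(\<integral>\<^sup>+x. ennreal (- ?f x) \<partial>m) = ennreal q" "0 \<le> q"
      using N by (cases "\<integral>\<^sup>+x. ennreal (- ?f x) \<partial>m" rule: ennreal_cases) auto
    then have "Ent_inf m \<mu> = \<infinity>"
      using P dens_ac(5)[OF a] by (simp add: Ent_inf_def eint_def enn2ereal_ennreal)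
    then show False using le by simp
  qed
  then show fe: "fin_ent \<mu>" using N a by (simp add: fin_ent_def real_integrable_def)
  show "log_ent \<mu> \<le> c" using le Ent_inf_fin_ent[OF fe] by simp
qed

lemma Ent_inf_singular:
  assumes p: "prob_space \<mu>" and s: "sets \<mu> = sets borel"
    and A: "A \<in> null_sets m" "emeasure \<mu> (UNIV - A) = 0"
  shows "Ent_inf m \<mu> = \<infinity>"
proof -
  note d = dens_singular[OF assms]
  have "(\<integral>\<^sup>+x. ennreal (dens m \<mu> x * ln (dens m \<mu> x)) \<partial>m) = (\<integral>\<^sup>+x. 0 \<partial>m)"
    "(\<integral>\<^sup>+x. ennreal (- (dens m \<mu> x * ln (dens m \<mu> x))) \<partial>m) = (\<integral>\<^sup>+x. 0 \<partial>m)"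
    by (rule nn_integral_cong_AE, rule eventually_mono[OF d(1)], simp)+
  then show ?thesis using d(2) by (simp add: Ent_inf_def eint_def)
qed

lemma pow_int_singular:
  assumes p: "prob_space \<mu>" and s: "sets \<mu> = sets borel"
    and A: "A \<in> null_sets m" "emeasure \<mu> (UNIV - A) = 0"
  shows "pow_int n \<mu> = 0"
proof -
  have "pow_int n \<mu> = (\<integral>\<^sup>+x. 0 \<partial>m)"
    unfolding pow_int_def
    by (rule nn_integral_cong_AE, rule eventually_mono[OF dens_singular(1)[OF assms]], simp)
  then show ?thesis by simp
qed

end

section \<open>Distortion coefficients and the curvature-dimension inequalities\<close>

text \<open>Concavity of the sine between 0 and \<open>x\<close>.\<close>

lemma sin_ratio_ge:
  fixes t x :: real
  assumes "0 \<le> t" "t \<le> 1" "0 < x" "x < pi"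
  shows "t \<le> sin (t * x) / sin x"
proof -
  have "concave_on {0..pi} sin"
    by (rule f''_le0_imp_concave[where f' = cos and f'' = "\<lambda>x. - sin x"])
      (auto intro!: derivative_eq_intros sin_ge_zero)
  from concave_onD[OF this assms(1,2), of 0 x] have "t * sin x \<le> sin (t * x)"
    using assms by simp
  moreover have "0 < sin x" using assms by (intro sin_gt_zero) auto
  ultimately show ?thesis by (simp add: pos_le_divide_eq)
qed

text \<open>Convexity of the exponential between 0 and \<open>- 2 * x\<close>, multiplied by
  \<open>exp (t * x) / 2\<close>.\<close>

lemma sinh_ratio_ge:
  fixes t x :: real
  assumes t: "0 \<le> t" "t \<le> 1" and x: "0 < x"
  shows "t * exp (- ((1 - t) * x)) \<le> sinh (t * x) / sinh x"
proof -
  have "convex_on UNIV (\<lambda>x::real. exp (1 * x))" by (rule convex_on_exp) simp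
  from convex_onD[OF this t, of 0 "- 2 * x"]
  have "exp (- 2 * (t * x)) \<le> (1 - t) + t * exp (- 2 * x)" by (simp add: mult_ac)
  then have "t * (1 - exp (- 2 * x)) \<le> 1 - exp (- 2 * (t * x))" by (simp add: algebra_simps)
  then have "exp (t * x) / 2 * (t * (1 - exp (- 2 * x))) \<le> exp (t * x) / 2 * (1 - exp (- 2 * (t * x)))"
    by (rule mult_left_mono) simp
  also have "exp (t * x) / 2 * (1 - exp (- 2 * (t * x))) = sinh (t * x)"
    by (simp add: sinh_def algebra_simps exp_add[symmetric])
  also have "exp (t * x) / 2 * (t * (1 - exp (- 2 * x))) = t * exp (- ((1 - t) * x)) * sinh x"
    by (simp add: sinh_def algebra_simps exp_add[symmetric])
  finally show ?thesis using x by (simp add: pos_le_divide_eq)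
qed

text \<open>One bound for every sign of \<open>K\<close>: the linear coefficient \<open>t\<close> up
  to a factor whose logarithm is of order \<open>1 - t\<close>, which makes the entropy increments
  linear in the time step. For \<open>K > 0\<close> the coefficient is at least \<open>t\<close>, or
  infinite.\<close>

lemma sigmaKN_ge:
  assumes n: "0 < n" and t: "0 \<le> t" "t \<le> 1" and \<theta>: "0 \<le> \<theta>" "\<theta> \<le> D"
  shows "ennreal (t * exp (- (D * sqrt (\<bar>K\<bar> / n) * (1 - t)))) \<le> sigmaKN K n t \<theta>"
proof -
  have D: "0 \<le> D" using \<theta> by simp
  define \<kappa> where "\<kappa> = D * sqrt (\<bar>K\<bar> / n)"
  have \<kappa>: "0 \<le> \<kappa>" using D n by (simp add: \<kappa>_def)
  have le_t: "t * exp (- (\<kappa> * (1 - t))) \<le> t"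
    using \<kappa> t by (intro mult_left_le) auto
  consider "K = 0 \<or> \<theta> = 0" | "K \<noteq> 0" "\<theta> \<noteq> 0" "K * \<theta>\<^sup>2 \<ge> n * pi\<^sup>2"
    | "K > 0" "\<theta> \<noteq> 0" "K * \<theta>\<^sup>2 < n * pi\<^sup>2" | "K < 0" "\<theta> \<noteq> 0" "K * \<theta>\<^sup>2 < n * pi\<^sup>2" by linarith
  then show ?thesis
  proof cases
    case 1
    then show ?thesis using le_t by (simp add: sigmaKN_def ennreal_leI \<kappa>_def)
  next
    case 2
    then show ?thesis by (simp add: sigmaKN_def)
  next
    case 3
    define x where "x = \<theta> * sqrt (K / n)"
    have x0: "0 < x" using 3 \<theta> n by (simp add: x_def)
    have "x\<^sup>2 = K * \<theta>\<^sup>2 / n" using 3 n by (simp add: x_def power_mult_distrib)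
    then have "x\<^sup>2 < pi\<^sup>2" using 3 n by (simp add: pos_divide_less_eq mult.commute)
    then have xpi: "x < pi" by (rule power_less_imp_less_base) simp
    have "t \<le> sin (t * x) / sin x" by (rule sin_ratio_ge[OF t x0 xpi])
    then have "t * exp (- (\<kappa> * (1 - t))) \<le> sin (t * x) / sin x" using le_t by linarith
    then show ?thesis using 3 by (simp add: sigmaKN_def x_def \<kappa>_def mult.assoc ennreal_leI)
  next
    case 4
    define x where "x = \<theta> * sqrt (- K / n)"
    have "0 < - K / n" using 4 n by (intro divide_pos_pos) auto
    then have x0: "0 < x" using 4 \<theta> by (simp add: x_def)
    have x\<kappa>: "x \<le> \<kappa>" unfolding x_def \<kappa>_def using 4 \<theta> n D by (intro mult_mono) (auto simp: divide_le_0_iff)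
    have "(1 - t) * x \<le> \<kappa> * (1 - t)" using x\<kappa> t by (simp add: mult.commute mult_right_mono)
    then have "t * exp (- (\<kappa> * (1 - t))) \<le> t * exp (- ((1 - t) * x))" using t by (intro mult_left_mono) auto
    also have "\<dots> \<le> sinh (t * x) / sinh x" by (rule sinh_ratio_ge[OF t x0])
    finally show ?thesis using 4 by (simp add: sigmaKN_def x_def \<kappa>_def mult.assoc ennreal_leI)
  qed
qed

text \<open>Inserting the bound \<open>t * w\<close> for the coefficient cancels the powers of
  \<open>t\<close> and leaves \<open>w powr ((n - 1) / n)\<close>, which is at least
  \<open>w\<close> as \<open>w \<le> 1\<close>.\<close>

lemma beta_root_ge:
  assumes n: "1 < n" and t: "0 < t" "t \<le> 1" and \<theta>: "0 \<le> \<theta>" "\<theta> \<le> D"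
  shows "ennreal (exp (- (D * sqrt (\<bar>K\<bar> / (n - 1)) * (1 - t)))) \<le> beta_root K n t \<theta>"
proof (cases "sigmaKN K (n - 1) t \<theta> = \<infinity>")
  case True
  then show ?thesis using t by (simp add: beta_root_def)
next
  case False
  define s where "s = enn2real (sigmaKN K (n - 1) t \<theta>)"
  define w where "w = exp (- (D * sqrt (\<bar>K\<bar> / (n - 1)) * (1 - t)))"
  have D: "0 \<le> D" using \<theta> by simp
  have w: "0 < w" "w \<le> 1" using D n t by (auto simp: w_def)
  have sig: "sigmaKN K (n - 1) t \<theta> = ennreal s" using False by (simp add: s_def ennreal_enn2real_if)
  have "ennreal (t * w) \<le> ennreal s"
    using sigmaKN_ge[of "n - 1" t \<theta> D K] n t \<theta> unfolding sig w_def by auto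
  then have ws: "t * w \<le> s" using t w by (simp add: ennreal_le_iff2) (smt (verit) mult_pos_pos)
  have tw: "0 < t * w" using t w by simp
  have "w = (w powr n) powr (1 / n)" using w n by (simp add: powr_powr)
  also have "\<dots> \<le> (w powr (n - 1)) powr (1 / n)"
    using w n by (intro powr_mono2 powr_mono') auto
  also have "w powr (n - 1) = t powr (1 - n) * (t * w) powr (n - 1)"
  proof -
    have "t powr (1 - n) * t powr (n - 1) = 1" using t by (simp add: powr_add[symmetric])
    then show ?thesis using t w by (simp add: powr_mult mult.assoc[symmetric])
  qed
  also have "(t powr (1 - n) * (t * w) powr (n - 1)) powr (1 / n) \<le> (t powr (1 - n) * s powr (n - 1)) powr (1 / n)"
    using n tw ws by (intro powr_mono2 mult_left_mono) auto
  finally show ?thesis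
    using False t unfolding beta_root_def s_def[symmetric] w_def[symmetric] by (simp add: ennreal_leI)
qed

text \<open>All terms are negated nonnegative quantities, so the passage from \<open>ereal\<close>
  to \<open>ennreal\<close> meets no difference of infinities.\<close>

lemma neg_ennreal_le:
  assumes "- enn2ereal u \<le> ereal a * (- enn2ereal x) + ereal b * (- enn2ereal y)" "0 \<le> a" "0 \<le> b"
  shows "ennreal a * x + ennreal b * y \<le> u"
proof -
  have m: "ereal c * (- enn2ereal z) = - enn2ereal (ennreal c * z)" if "0 \<le> c" for c z
    using that by (simp add: times_ennreal.rep_eq enn2ereal_ennreal)
  have p: "- enn2ereal z + - enn2ereal z' = - enn2ereal (z + z')" for z z'
    by (cases z rule: ennreal_cases; cases z' rule: ennreal_cases)
      (simp_all add: plus_ennreal.rep_eq enn2ereal_ennreal)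
  have "- enn2ereal u \<le> - enn2ereal (ennreal a * x + ennreal b * y)"
    using assms by (simp only: m p)
  then show ?thesis by (simp add: less_eq_ennreal.rep_eq)
qed

section \<open>Marginals and lengths of restricted and reversed plans\<close>

context geodesic_plan
begin

lemma restr_measurable_plan:
  "t1 \<in> {0..1} \<Longrightarrow> t2 \<in> {0..1} \<Longrightarrow> restr t1 t2 \<in> \<pi> \<rightarrow>\<^sub>M GeoM"
  using restr_measurable measurable_cong_sets[OF sets_plan refl] by blast

lemma marg_pi_tilde:
  assumes F: "F \<in> borel_measurable GeoM" and t: "t1 \<in> {0..1}" "t2 \<in> {0..1}" "t \<in> {0..1}"
  shows "marg (pi_tilde \<pi> F t1 t2) t = law \<pi> F (t * t2 + (1 - t) * t1)"
proof -
  have "marg (pi_tilde \<pi> F t1 t2) t = distr (density \<pi> (\<lambda>\<gamma>. ennreal (F \<gamma>))) borel ((\<lambda>\<gamma>. \<gamma> t) \<circ> restr t1 t2)"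
    unfolding marg_def pi_tilde_def
  proof (rule distr_distr)
    show "(\<lambda>\<gamma>. \<gamma> t) \<in> GeoM \<rightarrow>\<^sub>M borel" by (rule measurable_eval[OF t(3)])
    show "restr t1 t2 \<in> density \<pi> (\<lambda>\<gamma>. ennreal (F \<gamma>)) \<rightarrow>\<^sub>M GeoM" using restr_measurable_plan[OF t(1,2)] by simp
  qed
  also have "(\<lambda>\<gamma>. \<gamma> t) \<circ> restr t1 t2 = (\<lambda>\<gamma>. \<gamma> (t * t2 + (1 - t) * t1))"
    using t(3) by (auto simp: restr_def)
  finally show ?thesis by (simp add: law_def)
qed

lemma sets_pi_tilde: "sets (pi_tilde \<pi> F t1 t2) = sets GeoM"
  by (simp add: pi_tilde_def)

lemma prob_space_pi_tilde:
  assumes F: "adm \<Gamma> R F" and t: "t1 \<in> {0..1}" "t2 \<in> {0..1}"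
  shows "prob_space (pi_tilde \<pi> F t1 t2)"
  unfolding pi_tilde_def
proof (rule prob_space.prob_space_distr)
  have Fm: "(\<lambda>\<gamma>. ennreal (F \<gamma>)) \<in> borel_measurable \<pi>" using admD(1)[OF F] by simp
  show "prob_space (density \<pi> (\<lambda>\<gamma>. ennreal (F \<gamma>)))"
  proof (rule prob_spaceI)
    have "emeasure (density \<pi> (\<lambda>\<gamma>. ennreal (F \<gamma>))) (space \<pi>) = (\<integral>\<^sup>+\<gamma>. ennreal (F \<gamma>) * indicator (space \<pi>) \<gamma> \<partial>\<pi>)"
      by (rule emeasure_density[OF Fm sets.top])
    also have "\<dots> = 1" unfolding admD(5)[OF F, symmetric] by (intro nn_integral_cong) simp
    finally show "emeasure (density \<pi> (\<lambda>\<gamma>. ennreal (F \<gamma>))) (space (density \<pi> (\<lambda>\<gamma>. ennreal (F \<gamma>)))) = 1"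
      by (simp only: space_density)
  qed
  show "restr t1 t2 \<in> density \<pi> (\<lambda>\<gamma>. ennreal (F \<gamma>)) \<rightarrow>\<^sub>M GeoM" using restr_measurable_plan[OF t] by simp
qed

lemma length_measurable: "(\<lambda>\<gamma>. dist (\<gamma> 0) (\<gamma> 1)) \<in> borel_measurable (GeoM :: (real \<Rightarrow> 'a) measure)"
proof -
  have [measurable]: "(\<lambda>\<gamma>. \<gamma> 0) \<in> GeoM \<rightarrow>\<^sub>M (borel :: 'a measure)" "(\<lambda>\<gamma>. \<gamma> 1) \<in> GeoM \<rightarrow>\<^sub>M (borel :: 'a measure)"
    by (auto intro: measurable_eval)
  show ?thesis by measurable
qed

lemma AE_length_pi_tilde:
  assumes F: "adm \<Gamma> R F" and D: "\<And>\<gamma>. \<gamma> \<in> \<Gamma> \<Longrightarrow> dist (\<gamma> 0) (\<gamma> 1) \<le> D" and t: "t1 \<in> {0..1}" "t2 \<in> {0..1}"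
  shows "AE \<gamma> in pi_tilde \<pi> F t1 t2. dist (\<gamma> 0) (\<gamma> 1) \<le> D"
  unfolding pi_tilde_def
proof (subst AE_distr_iff)
  show "restr t1 t2 \<in> density \<pi> (\<lambda>\<gamma>. ennreal (F \<gamma>)) \<rightarrow>\<^sub>M GeoM" using restr_measurable_plan[OF t] by simp
  show "{\<gamma> \<in> space (GeoM :: (real \<Rightarrow> 'a) measure). dist (\<gamma> 0) (\<gamma> 1) \<le> D} \<in> sets GeoM"
  proof -
    note [measurable] = length_measurable
    show ?thesis by measurable
  qed
  show "AE \<gamma> in density \<pi> (\<lambda>\<gamma>. ennreal (F \<gamma>)). dist (restr t1 t2 \<gamma> 0) (restr t1 t2 \<gamma> 1) \<le> D"
  proof (subst AE_density)
    show "(\<lambda>\<gamma>. ennreal (F \<gamma>)) \<in> borel_measurable \<pi>" using admD(1)[OF F] by simp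
    show "AE \<gamma> in \<pi>. 0 < ennreal (F \<gamma>) \<longrightarrow> dist (restr t1 t2 \<gamma> 0) (restr t1 t2 \<gamma> 1) \<le> D"
    proof (rule AE_I2, rule impI)
      fix \<gamma> assume \<gamma>: "\<gamma> \<in> space \<pi>" and "0 < ennreal (F \<gamma>)"
      then have "\<gamma> \<in> \<Gamma>" using admD(4)[OF F, of \<gamma>] by force
      then show "dist (restr t1 t2 \<gamma> 0) (restr t1 t2 \<gamma> 1) \<le> D"
        using D[of \<gamma>] Geo_dist_le[of \<gamma> t1 t2] \<gamma> t by (simp add: restr_def)
    qed
  qed
qed

lemma marg_reverse:
  assumes "sets \<psi> = sets (GeoM :: (real \<Rightarrow> 'a) measure)"
  shows "marg (distr \<psi> GeoM reverse) 0 = marg \<psi> 1"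
proof -
  have "marg (distr \<psi> GeoM reverse) 0 = distr \<psi> borel ((\<lambda>\<gamma>. \<gamma> 0) \<circ> reverse)"
    unfolding marg_def
    by (rule distr_distr)
      (auto intro: measurable_eval reverse_measurable simp: measurable_cong_sets[OF assms refl])
  also have "(\<lambda>\<gamma>. \<gamma> 0) \<circ> reverse = (\<lambda>\<gamma>::real \<Rightarrow> 'a. \<gamma> 1)" by (auto simp: reverse_def)
  finally show ?thesis by (simp add: marg_def)
qed

lemma AE_length_reverse:
  assumes s: "sets \<psi> = sets (GeoM :: (real \<Rightarrow> 'a) measure)" and "AE \<gamma> in \<psi>. dist (\<gamma> 0) (\<gamma> 1) \<le> D"
  shows "AE \<gamma> in distr \<psi> GeoM reverse. dist (\<gamma> 0) (\<gamma> 1) \<le> D"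
proof (subst AE_distr_iff)
  show "reverse \<in> \<psi> \<rightarrow>\<^sub>M (GeoM :: (real \<Rightarrow> 'a) measure)"
    using reverse_measurable by (simp add: measurable_cong_sets[OF s refl])
  show "{\<gamma> \<in> space (GeoM :: (real \<Rightarrow> 'a) measure). dist (\<gamma> 0) (\<gamma> 1) \<le> D} \<in> sets GeoM"
  proof -
    note [measurable] = length_measurable
    show ?thesis by measurable
  qed
  show "AE \<gamma> in \<psi>. dist (reverse \<gamma> 0) (reverse \<gamma> 1) \<le> D"
    using assms(2) by (simp add: reverse_def dist_commute)
qed

end

text \<open>\<open>c1\<close> stands for a bound on the densities of both end laws over
  \<open>\<Gamma>\<close>. It is expressed through measures of sets, which does not depend on the
  version of a density.\<close>

locale plan_setup = geodesic_plan \<pi> + reference_measure m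
  for \<pi> :: "(real \<Rightarrow> 'a::polish_space) measure" and m :: "'a measure" +
  fixes \<Gamma> :: "(real \<Rightarrow> 'a) set" and W :: "'a set" and D c1 :: real
  assumes \<Gamma>_sets: "\<Gamma> \<in> sets GeoM" and W_sets: "W \<in> sets borel" and W_fin: "emeasure m W < \<infinity>"
    and \<Gamma>_W: "\<And>\<gamma> t. \<gamma> \<in> \<Gamma> \<Longrightarrow> t \<in> {0..1} \<Longrightarrow> \<gamma> t \<in> W"
    and \<Gamma>_D: "\<And>\<gamma>. \<gamma> \<in> \<Gamma> \<Longrightarrow> dist (\<gamma> 0) (\<gamma> 1) \<le> D" and D0: "0 \<le> D"
    and c1: "1 \<le> c1"
    and ends_bound: "\<And>R F e A. adm \<Gamma> R F \<Longrightarrow> e \<in> {0, 1} \<Longrightarrow> A \<in> sets borel \<Longrightarrow>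
      emeasure (law \<pi> F e) A \<le> ennreal (R * c1) * emeasure m A"
begin

lemma law_W:
  assumes "adm \<Gamma> R F" "t \<in> {0..1}"
  shows "emeasure (law \<pi> F t) (UNIV - W) = 0"
proof (rule law_null)
  have "F \<gamma> \<noteq> 0 \<longrightarrow> \<gamma> t \<notin> UNIV - W" for \<gamma>
    using admD(4)[OF assms(1), of \<gamma>] \<Gamma>_W[of \<gamma> t] assms(2) by auto
  then show "AE \<gamma> in \<pi>. F \<gamma> \<noteq> 0 \<longrightarrow> \<gamma> t \<notin> UNIV - W" by simp
qed (use assms admD(1)[OF assms(1)] W_sets in auto)

lemma ac_law:
  assumes "adm \<Gamma> R F" "t \<in> {0..1}"
  shows "ac (law \<pi> F t) \<longleftrightarrow> absolutely_continuous m (law \<pi> F t)"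
  using prob_space_law[OF assms] by (simp add: ac_def)

lemma ac_law_end:
  assumes "adm \<Gamma> R F" "e \<in> {0, 1}"
  shows "ac (law \<pi> F e)"
proof -
  have "emeasure (law \<pi> F e) A = 0" if "A \<in> null_sets m" for A
  proof -
    have "A \<in> sets borel" "emeasure m A = 0" using that by (auto simp: null_sets_def)
    then show ?thesis using ends_bound[OF assms, of A] by simp
  qed
  then have "absolutely_continuous m (law \<pi> F e)"
    unfolding absolutely_continuous_def by (auto simp: null_sets_def)
  then show ?thesis using assms by (subst ac_law) auto
qed

lemma mixture_law:
  assumes "adm \<Gamma> R F1" "adm \<Gamma> R F2" "t \<in> {0..1}"
  shows "mixture (law \<pi> (\<lambda>\<gamma>. (F1 \<gamma> + F2 \<gamma>) / 2) t) (law \<pi> F1 t) (law \<pi> F2 t)"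
  unfolding mixture_def
  by (intro ballI emeasure_law_mix assms admD(1)[OF assms(1)] admD(1)[OF assms(2)] admD(2)[OF assms(1)] admD(2)[OF assms(2)])

text \<open>Conditioning on the null set charged by the law gives a plan that is totally singular at
  time \<open>t\<close>, and for such laws both entropies are explicit. The density bound grows to
  \<open>R / q\<close>.\<close>

lemma not_ac_plan:
  assumes F: "adm \<Gamma> R F" and t: "t \<in> {0..1}" and n: "\<not> absolutely_continuous m (law \<pi> F t)"
  shows "\<exists>R' F' A. adm \<Gamma> R' F' \<and> A \<in> null_sets m \<and> emeasure (law \<pi> F' t) (UNIV - A) = 0"
proof -
  obtain A where A: "A \<in> null_sets m" "emeasure (law \<pi> F t) A \<noteq> 0"
    using n unfolding absolutely_continuous_def null_sets_def by auto
  have As: "A \<in> sets borel" using A(1) by auto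
  note [measurable] = measurable_eval[OF t] As admD(1)[OF F]
  define q where "q = measure (law \<pi> F t) A"
  have "finite_measure (law \<pi> F t)" using prob_space_law[OF F t] by (simp add: prob_space_def)
  then have eq: "emeasure (law \<pi> F t) A = ennreal q"
    unfolding q_def by (rule finite_measure.emeasure_eq_measure)
  then have q: "0 < q" using A(2) by (cases "q \<le> 0") (auto simp: ennreal_eq_0_iff)
  define F' where "F' \<gamma> = F \<gamma> * indicator A (\<gamma> t) / q" for \<gamma>
  have F'm: "F' \<in> borel_measurable GeoM" unfolding F'_def[abs_def] by measurable
  have "adm \<Gamma> (R / q) F'"
  proof (rule admI[OF F'm])
    show "0 \<le> F' \<gamma>" for \<gamma> using admD(2)[OF F] q by (simp add: F'_def)
    show "F' \<gamma> \<le> R / q" for \<gamma>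
      using admD(2,3)[OF F, of \<gamma>] q by (cases "\<gamma> t \<in> A") (auto simp: F'_def divide_right_mono)
    show "F' \<gamma> = 0" if "\<gamma> \<notin> \<Gamma>" for \<gamma> using admD(4)[OF F that] by (simp add: F'_def)
    have "(\<integral>\<^sup>+\<gamma>. ennreal (F' \<gamma>) \<partial>\<pi>) = (\<integral>\<^sup>+\<gamma>. ennreal (1/q) * (ennreal (F \<gamma>) * indicator A (\<gamma> t)) \<partial>\<pi>)"
      using admD(2)[OF F] q by (intro nn_integral_cong) (auto simp: F'_def indicator_def ennreal_mult[symmetric])
    also have "\<dots> = ennreal (1/q) * (\<integral>\<^sup>+\<gamma>. ennreal (F \<gamma>) * indicator A (\<gamma> t) \<partial>\<pi>)"
      using measurable_eval_plan[OF t] admD(1)[OF F] As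
      by (intro nn_integral_cmult) measurable
    also have "\<dots> = 1"
      using eq q unfolding emeasure_law[OF t admD(1)[OF F] As] by (simp add: ennreal_mult[symmetric])
    finally show "(\<integral>\<^sup>+\<gamma>. ennreal (F' \<gamma>) \<partial>\<pi>) = 1" .
  qed
  moreover have "emeasure (law \<pi> F' t) (UNIV - A) = 0"
    by (rule law_null[OF t F'm]) (use As in \<open>auto simp: F'_def indicator_def intro!: AE_I2\<close>)
  ultimately show ?thesis using A(1) by blast
qed

lemma weighted_pow_int:
  assumes s: "sets \<psi> = sets (GeoM :: (real \<Rightarrow> 'a) measure)" and D: "AE \<gamma> in \<psi>. dist (\<gamma> 0) (\<gamma> 1) \<le> D"
    and a: "ac (marg \<psi> e)" and e: "e \<in> {0..1}" and w: "\<And>\<theta>. 0 \<le> \<theta> \<Longrightarrow> \<theta> \<le> D \<Longrightarrow> w \<le> cf \<theta>"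
  shows "w * pow_int n (marg \<psi> e) \<le> (\<integral>\<^sup>+\<gamma>. cf (dist (\<gamma> 0) (\<gamma> 1)) * inv_root_dens m n (marg \<psi> e) (\<gamma> e) \<partial>\<psi>)"
proof -
  let ?i = "inv_root_dens m n (marg \<psi> e)"
  note im[measurable] = pow_int_inv_root(1)[OF a, of n]
  have ev[measurable]: "(\<lambda>\<gamma>. \<gamma> e) \<in> \<psi> \<rightarrow>\<^sub>M borel"
    using measurable_eval[OF e] measurable_cong_sets[OF s refl] by blast
  have "pow_int n (marg \<psi> e) = (\<integral>\<^sup>+x. ?i x \<partial>(distr \<psi> borel (\<lambda>\<gamma>. \<gamma> e)))"
    using pow_int_inv_root(2)[OF a, of n] by (simp add: marg_def)
  also have "\<dots> = (\<integral>\<^sup>+\<gamma>. ?i (\<gamma> e) \<partial>\<psi>)"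
    by (rule nn_integral_distr[OF ev]) (simp add: im)
  finally have "w * pow_int n (marg \<psi> e) = w * (\<integral>\<^sup>+\<gamma>. ?i (\<gamma> e) \<partial>\<psi>)" by simp
  also have "\<dots> = (\<integral>\<^sup>+\<gamma>. w * ?i (\<gamma> e) \<partial>\<psi>)"
    by (rule nn_integral_cmult[symmetric]) (rule measurable_compose[OF ev im])
  also have "\<dots> \<le> (\<integral>\<^sup>+\<gamma>. cf (dist (\<gamma> 0) (\<gamma> 1)) * ?i (\<gamma> e) \<partial>\<psi>)"
    using D by (intro nn_integral_mono_AE) (auto elim!: eventually_mono intro!: mult_right_mono w)
  finally show ?thesis .
qed

text \<open>A lower bound for the coefficient of the initial law at time \<open>t\<close>; the final
  law gets \<open>1 - t\<close>. Having \<open>n - 1\<close> under the root serves both conditions,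
  since \<open>\<bar>K\<bar> / n \<le> \<bar>K\<bar> / (n - 1)\<close>.\<close>

definition contr :: "real \<Rightarrow> real \<Rightarrow> real \<Rightarrow> real" where
  "contr K n t = (1 - t) * exp (- (D * sqrt (\<bar>K\<bar> / (n - 1)) * t))"

text \<open>The two terms on the right of the curvature condition have the same sign, so either may
  be dropped. Each estimate therefore asks for absolute continuity at one end only.\<close>

lemma pow_int_step:
  assumes plan: "CDstar_plan m K n \<pi> \<or> CD_plan m K (ereal n) \<pi>" and n: "1 < n"
    and F: "adm \<Gamma> R F" and t: "0 \<le> t1" "t1 < t2" "t2 \<le> 1" "0 \<le> t" "t \<le> 1"
  shows "ac (law \<pi> F t1) \<Longrightarrow> ennreal (contr K n t) * pow_int n (law \<pi> F t1) \<le> pow_int n (law \<pi> F (t * t2 + (1 - t) * t1))"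
    and "ac (law \<pi> F t2) \<Longrightarrow> ennreal (contr K n (1 - t)) * pow_int n (law \<pi> F t2) \<le> pow_int n (law \<pi> F (t * t2 + (1 - t) * t1))"
proof -
  define \<psi> where "\<psi> = pi_tilde \<pi> F t1 t2"
  define \<psi>r where "\<psi>r = distr \<psi> GeoM reverse"
  have t01: "t1 \<in> {0..1}" "t2 \<in> {0..1}" "t \<in> {0..1}" using t by auto
  have s: "sets \<psi> = sets GeoM" by (simp add: \<psi>_def sets_pi_tilde)
  have sr: "sets \<psi>r = sets GeoM" by (simp add: \<psi>r_def)
  have D\<psi>: "AE \<gamma> in \<psi>. dist (\<gamma> 0) (\<gamma> 1) \<le> D"
    unfolding \<psi>_def by (rule AE_length_pi_tilde[OF F \<Gamma>_D t01(1,2)])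
  have Dr: "AE \<gamma> in \<psi>r. dist (\<gamma> 0) (\<gamma> 1) \<le> D"
    unfolding \<psi>r_def by (rule AE_length_reverse[OF s D\<psi>])
  have m0: "marg \<psi> 0 = law \<pi> F t1" and m1: "marg \<psi> 1 = law \<pi> F t2" and mt: "marg \<psi> t = law \<pi> F (t * t2 + (1 - t) * t1)"
    unfolding \<psi>_def using marg_pi_tilde[OF admD(1)[OF F] t01(1,2), of 0] marg_pi_tilde[OF admD(1)[OF F] t01(1,2), of 1]
      marg_pi_tilde[OF admD(1)[OF F] t01(1,2), of t] t01 by simp_all
  have mr: "marg \<psi>r 0 = law \<pi> F t2" unfolding \<psi>r_def marg_reverse[OF s] m1 ..
  have Ent: "Ent_fin m n \<mu> = - enn2ereal (pow_int n \<mu>)" for \<mu> by (simp add: Ent_fin_def pow_int_def)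
  have cond: "admissible_density \<pi> F \<and> 0 \<le> t1 \<and> t1 < t2 \<and> t2 \<le> 1 \<and> 0 \<le> t \<and> t \<le> 1"
    using admD(6)[OF F] t by simp
  have "(ac (law \<pi> F t1) \<longrightarrow> ennreal (contr K n t) * pow_int n (law \<pi> F t1) \<le> pow_int n (marg \<psi> t)) \<and>
    (ac (law \<pi> F t2) \<longrightarrow> ennreal (contr K n (1 - t)) * pow_int n (law \<pi> F t2) \<le> pow_int n (marg \<psi> t))"
    using plan
  proof
    assume "CDstar_plan m K n \<pi>"
    then have le: "(\<integral>\<^sup>+\<gamma>. sigmaKN K n (1 - t) (dist (\<gamma> 0) (\<gamma> 1)) * inv_root_dens m n (marg \<psi> 0) (\<gamma> 0)
        + sigmaKN K n t (dist (\<gamma> 0) (\<gamma> 1)) * inv_root_dens m n (marg \<psi> 1) (\<gamma> 1) \<partial>\<psi>) \<le> pow_int n (marg \<psi> t)"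
      using cond unfolding CDstar_plan_def Let_def Ent by (simp add: \<psi>_def less_eq_ennreal.rep_eq)
    have sig: "ennreal (contr K n (1 - \<tau>)) \<le> sigmaKN K n \<tau> \<theta>" if "0 \<le> \<tau>" "\<tau> \<le> 1" "0 \<le> \<theta>" "\<theta> \<le> D" for \<tau> \<theta>
    proof -
      have "D * sqrt (\<bar>K\<bar> / n) * (1 - \<tau>) \<le> D * sqrt (\<bar>K\<bar> / (n - 1)) * (1 - \<tau>)"
        using D0 n that by (intro mult_right_mono mult_left_mono real_sqrt_le_mono divide_left_mono) auto
      then have "contr K n (1 - \<tau>) \<le> \<tau> * exp (- (D * sqrt (\<bar>K\<bar> / n) * (1 - \<tau>)))"
        using that by (simp add: contr_def mult_left_mono)
      then show ?thesis using sigmaKN_ge[of n \<tau> \<theta> D K] n that by (auto intro: order_trans ennreal_leI)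
    qed
    show ?thesis
    proof (intro conjI impI)
      assume a: "ac (law \<pi> F t1)"
      have "ennreal (contr K n t) * pow_int n (marg \<psi> 0) \<le>
          (\<integral>\<^sup>+\<gamma>. sigmaKN K n (1 - t) (dist (\<gamma> 0) (\<gamma> 1)) * inv_root_dens m n (marg \<psi> 0) (\<gamma> 0) \<partial>\<psi>)"
        using sig[of "1 - t"] t a by (intro weighted_pow_int[OF s D\<psi>]) (auto simp: m0)
      also have "\<dots> \<le> (\<integral>\<^sup>+\<gamma>. sigmaKN K n (1 - t) (dist (\<gamma> 0) (\<gamma> 1)) * inv_root_dens m n (marg \<psi> 0) (\<gamma> 0)
        + sigmaKN K n t (dist (\<gamma> 0) (\<gamma> 1)) * inv_root_dens m n (marg \<psi> 1) (\<gamma> 1) \<partial>\<psi>)"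
        by (intro nn_integral_mono) simp
      also note le
      finally show "ennreal (contr K n t) * pow_int n (law \<pi> F t1) \<le> pow_int n (marg \<psi> t)" by (simp add: m0)
    next
      assume a: "ac (law \<pi> F t2)"
      have "ennreal (contr K n (1 - t)) * pow_int n (marg \<psi> 1) \<le>
          (\<integral>\<^sup>+\<gamma>. sigmaKN K n t (dist (\<gamma> 0) (\<gamma> 1)) * inv_root_dens m n (marg \<psi> 1) (\<gamma> 1) \<partial>\<psi>)"
        using sig[of t] t a by (intro weighted_pow_int[OF s D\<psi>]) (auto simp: m1)
      also have "\<dots> \<le> (\<integral>\<^sup>+\<gamma>. sigmaKN K n (1 - t) (dist (\<gamma> 0) (\<gamma> 1)) * inv_root_dens m n (marg \<psi> 0) (\<gamma> 0)
        + sigmaKN K n t (dist (\<gamma> 0) (\<gamma> 1)) * inv_root_dens m n (marg \<psi> 1) (\<gamma> 1) \<partial>\<psi>)"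
        by (intro nn_integral_mono) simp
      also note le
      finally show "ennreal (contr K n (1 - t)) * pow_int n (law \<pi> F t2) \<le> pow_int n (marg \<psi> t)" by (simp add: m1)
    qed
  next
    assume "CD_plan m K (ereal n) \<pi>"
    then have "Ent_fin m n (marg \<psi> t) \<le> ereal (1 - t) * Ent_fin_pi m K n (1 - t) \<psi> (marg \<psi> 0) + ereal t * Ent_fin_pi m K n t \<psi>r (marg \<psi> 1)"
      using cond unfolding CD_plan_def Let_def by (simp add: \<psi>_def \<psi>r_def)
    then have le: "ennreal (1 - t) * (\<integral>\<^sup>+\<gamma>. beta_root K n (1 - t) (dist (\<gamma> 0) (\<gamma> 1)) * inv_root_dens m n (marg \<psi> 0) (\<gamma> 0) \<partial>\<psi>)
      + ennreal t * (\<integral>\<^sup>+\<gamma>. beta_root K n t (dist (\<gamma> 0) (\<gamma> 1)) * inv_root_dens m n (marg \<psi> 1) (\<gamma> 0) \<partial>\<psi>r) \<le> pow_int n (marg \<psi> t)"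
      unfolding Ent Ent_fin_pi_def using t by (intro neg_ennreal_le) auto
    \<comment> \<open>Stated for a general plan \<open>\<phi>\<close>, to be applied to
      \<open>\<psi>\<close> with \<open>1 - t\<close> and to the reversed plan
      \<open>\<psi>r\<close> with \<open>t\<close>; the initial law of \<open>\<psi>r\<close> is the
      final law of \<open>\<psi>\<close>.\<close>
    have step: "ennreal (contr K n (1 - \<tau>)) * pow_int n (marg \<phi> 0) \<le>
        ennreal \<tau> * (\<integral>\<^sup>+\<gamma>. beta_root K n \<tau> (dist (\<gamma> 0) (\<gamma> 1)) * inv_root_dens m n (marg \<phi> 0) (\<gamma> 0) \<partial>\<phi>)"
      if \<tau>: "0 \<le> \<tau>" "\<tau> \<le> 1" and \<phi>: "sets \<phi> = sets (GeoM :: (real \<Rightarrow> 'a) measure)" "AE \<gamma> in \<phi>. dist (\<gamma> 0) (\<gamma> 1) \<le> D" "ac (marg \<phi> 0)" for \<tau> \<phi>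
    proof (cases "\<tau> = 0")
      case False
      define w where "w = exp (- (D * sqrt (\<bar>K\<bar> / (n - 1)) * (1 - \<tau>)))"
      have "contr K n (1 - \<tau>) = \<tau> * w" by (simp add: contr_def w_def)
      then have "ennreal (contr K n (1 - \<tau>)) * pow_int n (marg \<phi> 0) = ennreal \<tau> * (ennreal w * pow_int n (marg \<phi> 0))"
        using \<tau> by (simp add: w_def ennreal_mult mult.assoc)
      also have "\<dots> \<le> ennreal \<tau> * (\<integral>\<^sup>+\<gamma>. beta_root K n \<tau> (dist (\<gamma> 0) (\<gamma> 1)) * inv_root_dens m n (marg \<phi> 0) (\<gamma> 0) \<partial>\<phi>)"
        unfolding w_def using False \<tau> n
        by (intro mult_left_mono weighted_pow_int[OF \<phi>] beta_root_ge) auto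
      finally show ?thesis .
    qed (simp add: contr_def)
    show ?thesis
    proof (intro conjI impI)
      assume "ac (law \<pi> F t1)"
      then have "ennreal (contr K n t) * pow_int n (marg \<psi> 0) \<le>
          ennreal (1 - t) * (\<integral>\<^sup>+\<gamma>. beta_root K n (1 - t) (dist (\<gamma> 0) (\<gamma> 1)) * inv_root_dens m n (marg \<psi> 0) (\<gamma> 0) \<partial>\<psi>)"
        using step[of "1 - t" \<psi>] t s D\<psi> by (simp add: m0)
      also have "\<dots> \<le> pow_int n (marg \<psi> t)" using le by (rule order_trans[rotated]) simp
      finally show "ennreal (contr K n t) * pow_int n (law \<pi> F t1) \<le> pow_int n (marg \<psi> t)" by (simp add: m0)
    next
      assume "ac (law \<pi> F t2)"
      then have "ennreal (contr K n (1 - t)) * pow_int n (marg \<psi>r 0) \<le>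
          ennreal t * (\<integral>\<^sup>+\<gamma>. beta_root K n t (dist (\<gamma> 0) (\<gamma> 1)) * inv_root_dens m n (marg \<psi>r 0) (\<gamma> 0) \<partial>\<psi>r)"
        using step[of t \<psi>r] t sr Dr by (simp add: mr)
      also have "marg \<psi>r 0 = marg \<psi> 1" by (simp add: mr m1)
      also have "ennreal t * (\<integral>\<^sup>+\<gamma>. beta_root K n t (dist (\<gamma> 0) (\<gamma> 1)) * inv_root_dens m n (marg \<psi> 1) (\<gamma> 0) \<partial>\<psi>r) \<le> pow_int n (marg \<psi> t)"
        using le by (rule order_trans[rotated]) simp
      finally show "ennreal (contr K n (1 - t)) * pow_int n (law \<pi> F t2) \<le> pow_int n (marg \<psi> t)" by (simp add: m1)
    qed
  qed
  then show "ac (law \<pi> F t1) \<Longrightarrow> ennreal (contr K n t) * pow_int n (law \<pi> F t1) \<le> pow_int n (law \<pi> F (t * t2 + (1 - t) * t1))"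
    and "ac (law \<pi> F t2) \<Longrightarrow> ennreal (contr K n (1 - t)) * pow_int n (law \<pi> F t2) \<le> pow_int n (law \<pi> F (t * t2 + (1 - t) * t1))"
    unfolding mt by blast+
qed

end

section \<open>The locale \<open>entropy_plan\<close> for finite N\<close>

context plan_setup
begin

text \<open>A singular law has power integral 0, whereas \<open>pow_int_step\<close> started at time
  0 keeps the integral positive as long as \<open>t < 1\<close>.\<close>

lemma ac_law_power:
  assumes plan: "CDstar_plan m K n \<pi> \<or> CD_plan m K (ereal n) \<pi>" and n: "1 < n"
    and F: "adm \<Gamma> R F" and t: "0 \<le> t" "t < 1"
  shows "ac (law \<pi> F t)"
proof (rule ccontr)
  assume "\<not> ac (law \<pi> F t)"
  then obtain R' F' A where F': "adm \<Gamma> R' F'" and A: "A \<in> null_sets m" "emeasure (law \<pi> F' t) (UNIV - A) = 0"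
    using not_ac_plan[OF F, of t] ac_law[OF F, of t] t by auto
  have "pow_int n (law \<pi> F' t) = 0"
    using t by (intro pow_int_singular[OF prob_space_law[OF F'] _ A]) auto
  moreover have a: "ac (law \<pi> F' 0)" by (rule ac_law_end[OF F']) simp
  ultimately have "ennreal (contr K n t) * pow_int n (law \<pi> F' 0) = 0"
    using pow_int_step(1)[OF plan n F', of 0 1 t] t by simp
  moreover have "0 < contr K n t" using t by (simp add: contr_def)
  ultimately show False using pow_int_pos[OF a, of n] by (simp add: ennreal_eq_0_iff)
qed

text \<open>With \<open>\<kappa>\<close> as below,
  \<open>- ln (contr K n t) \<le> (\<kappa> + 2) * t\<close> for \<open>t \<le> 1/2\<close>. This
  restriction is the origin of the condition \<open>b - a \<le> \<delta> / 2\<close> in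
  \<open>entropy_plan\<close>.\<close>

lemma pow_ent_le:
  assumes n: "1 < n" and a: "ac \<mu>" "ac \<nu>" and W: "emeasure \<mu> (UNIV - W) = 0" "emeasure \<nu> (UNIV - W) = 0"
    and t: "0 \<le> t" "t \<le> 1/2" and le: "ennreal (contr K n t) * pow_int n \<mu> \<le> pow_int n \<nu>"
  shows "pow_ent n \<nu> \<le> pow_ent n \<mu> + n * (D * sqrt (\<bar>K\<bar> / (n - 1)) + 2) * t"
proof -
  define \<kappa> where "\<kappa> = D * sqrt (\<bar>K\<bar> / (n - 1))"
  define u where "u = enn2real (pow_int n \<mu>)"
  define v where "v = enn2real (pow_int n \<nu>)"
  note u = pow_int_real[OF a(1) n W_sets W(1) W_fin, folded u_def]
  note v = pow_int_real[OF a(2) n W_sets W(2) W_fin, folded v_def]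
  have c: "0 < contr K n t" using t by (simp add: contr_def)
  have "ennreal (contr K n t * u) \<le> ennreal v"
    using le c u(2) unfolding u(1) v(1) by (simp add: ennreal_mult)
  then have "contr K n t * u \<le> v" using v(2) by (simp add: ennreal_le_iff)
  then have "ln (contr K n t * u) \<le> ln v" using c u by (intro ln_mono) auto
  then have 1: "ln (contr K n t) + ln u \<le> ln v" using c u by (simp add: ln_mult)
  have "ln (1 / (1 - t)) \<le> 1 / (1 - t) - 1" using t by (intro ln_le_minus_one) auto
  also have "\<dots> \<le> 2 * t" 
  proof -
    have "t / (1 - t) \<le> t / (1/2)" using t by (intro divide_left_mono) auto
    moreover have "1 / (1 - t) - 1 = t / (1 - t)" using t by (simp add: field_simps)
    ultimately show ?thesis by simp
  qed
  finally have "- ln (1 - t) \<le> 2 * t" using t by (simp add: ln_div)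
  moreover have "ln (contr K n t) = ln (1 - t) - \<kappa> * t"
    using t by (simp add: contr_def \<kappa>_def ln_mult)
  ultimately have "ln u - ln v \<le> (\<kappa> + 2) * t" using 1 by (simp add: algebra_simps)
  then have "n * (ln u - ln v) \<le> n * ((\<kappa> + 2) * t)" using n by (intro mult_left_mono) auto
  then show ?thesis by (simp add: pow_ent_def u_def[symmetric] v_def[symmetric] \<kappa>_def[symmetric] algebra_simps)
qed

text \<open>Forward steps interpolate on \<open>[a, 1]\<close>, backward steps on
  \<open>[0, b]\<close>; the margin \<open>\<delta>\<close> bounds the relative step by
  \<open>(b - a) / \<delta>\<close>.\<close>

lemma entropy_plan_power:
  assumes plan: "CDstar_plan m K n \<pi> \<or> CD_plan m K (ereal n) \<pi>" and n: "1 < n"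
  shows "entropy_plan \<pi> m \<Gamma> W D (n * (D * sqrt (\<bar>K\<bar> / (n - 1)) + 2)) (pow_ent n)"
proof -
  define C where "C = n * (D * sqrt (\<bar>K\<bar> / (n - 1)) + 2)"
  have C0: "0 \<le> C" using n D0 by (simp add: C_def)
  \<comment> \<open>For finite N the increments do not depend on \<open>R\<close>; the factor
    \<open>1 + ln R \<ge> 1\<close> is inserted to fit the common interface.\<close>
  have bound: "C * x \<le> C / \<delta> * y * (1 + ln R)" if "1 \<le> R" "0 < \<delta>" "x \<le> y / \<delta>" "0 \<le> y" for x y R \<delta>
  proof -
    have "C * x \<le> C * (y / \<delta>)" using that C0 by (intro mult_left_mono)
    also have "\<dots> = C * (y / \<delta>) * 1" by simp
    also have "\<dots> \<le> C * (y / \<delta>) * (1 + ln R)" using that C0 by (intro mult_left_mono) auto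
    finally show ?thesis by simp
  qed
  note ac = ac_law_power[OF plan n]
  show ?thesis unfolding C_def[symmetric]
  proof (intro entropy_plan.intro entropy_plan_axioms.intro)
    show "geodesic_plan \<pi>" by (rule geodesic_plan_axioms)
    show "sets m = sets borel" "\<Gamma> \<in> sets GeoM" "W \<in> sets borel" "emeasure m W < \<infinity>" "0 \<le> C" "sigma_finite_measure m"
      using \<Gamma>_sets W_sets W_fin C0 sigma_finite_measure_axioms by simp_all
    show "\<gamma> t \<in> W" if "\<gamma> \<in> \<Gamma>" "t \<in> {0..1}" for \<gamma> t by (rule \<Gamma>_W[OF that])
    show "dist (\<gamma> 0) (\<gamma> 1) \<le> D" if "\<gamma> \<in> \<Gamma>" for \<gamma> by (rule \<Gamma>_D[OF that])
    show "absolutely_continuous m (law \<pi> F 0)" if "adm \<Gamma> R F" for R F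
      using ac_law_end[OF that, of 0] by (simp add: ac_def)
    show "pow_ent n (law \<pi> F b) \<le> pow_ent n (law \<pi> F a) + C / \<delta> * (b - a) * (1 + ln R)"
      if F: "adm \<Gamma> R F" and R: "1 \<le> R" and \<delta>: "0 < \<delta>" and ab: "0 \<le> a" "a \<le> b" "b \<le> 1 - \<delta>" "b - a \<le> \<delta> / 2" for R F \<delta> a b
    proof -
      define t where "t = (b - a) / (1 - a)"
      have a1: "\<delta> \<le> 1 - a" using ab by linarith
      have tle: "t \<le> (b - a) / \<delta>" unfolding t_def using a1 \<delta> ab by (intro divide_left_mono) auto
      have t: "0 \<le> t" "t \<le> 1/2"
        using tle ab a1 \<delta> order_trans[OF tle, of "1/2"] by (auto simp: t_def divide_le_eq)
      have mid: "t * 1 + (1 - t) * a = b"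
      proof -
        have "t * (1 - a) = b - a" using a1 \<delta> by (simp add: t_def)
        then show ?thesis by (simp add: algebra_simps)
      qed
      have acs: "ac (law \<pi> F a)" "ac (law \<pi> F b)" using ab \<delta> by (auto intro!: ac[OF F])
      have "pow_ent n (law \<pi> F b) \<le> pow_ent n (law \<pi> F a) + C * t"
        unfolding C_def
      proof (rule pow_ent_le[OF n acs law_W[OF F] law_W[OF F] t])
        show "ennreal (contr K n t) * pow_int n (law \<pi> F a) \<le> pow_int n (law \<pi> F b)"
          using pow_int_step(1)[OF plan n F _ _ _ _ _ acs(1), of 1 t] ab a1 \<delta> t unfolding mid by simp
      qed (use ab \<delta> in auto)
      also have "C * t \<le> C / \<delta> * (b - a) * (1 + ln R)" using bound[OF R \<delta> tle] ab by simp
      finally show ?thesis by simp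
    qed
    show "pow_ent n (law \<pi> F a) \<le> pow_ent n (law \<pi> F b) + C / \<delta> * (b - a) * (1 + ln R)"
      if F: "adm \<Gamma> R F" and R: "1 \<le> R" and \<delta>: "0 < \<delta>" and ab: "\<delta> \<le> a" "a \<le> b" "b \<le> 1 - \<delta>" "b - a \<le> \<delta> / 2" for R F \<delta> a b
    proof -
      define t where "t = a / b"
      have b: "\<delta> \<le> b" using ab by linarith
      have t1: "1 - t = (b - a) / b" using b \<delta> by (simp add: t_def field_simps)
      have tle: "1 - t \<le> (b - a) / \<delta>" unfolding t1 using b \<delta> ab by (intro divide_left_mono) auto
      have t: "0 \<le> 1 - t" "1 - t \<le> 1/2"
        using tle ab b \<delta> order_trans[OF tle, of "1/2"] by (auto simp: t1 divide_le_eq)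
      have mid: "t * b + (1 - t) * 0 = a" using b \<delta> by (simp add: t_def)
      have acs: "ac (law \<pi> F a)" "ac (law \<pi> F b)" using ab \<delta> by (auto intro!: ac[OF F])
      have "pow_ent n (law \<pi> F a) \<le> pow_ent n (law \<pi> F b) + C * (1 - t)"
        unfolding C_def
      proof (rule pow_ent_le[OF n acs(2,1) law_W[OF F] law_W[OF F] t])
        have "0 \<le> t" using ab \<delta> b by (simp add: t_def)
        then show "ennreal (contr K n (1 - t)) * pow_int n (law \<pi> F b) \<le> pow_int n (law \<pi> F a)"
          using pow_int_step(2)[OF plan n F _ _ _ _ _ acs(2), of 0 t] ab b \<delta> t unfolding mid by simp
      qed (use ab \<delta> in auto)
      also have "C * (1 - t) \<le> C / \<delta> * (b - a) * (1 + ln R)" using bound[OF R \<delta> tle] ab by simp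
      finally show ?thesis by simp
    qed
    show "pow_ent n (law \<pi> (\<lambda>\<gamma>. (F1 \<gamma> + F2 \<gamma>) / 2) t) \<le> (pow_ent n (law \<pi> F1 t) + pow_ent n (law \<pi> F2 t)) / 2 - ln 2"
      if F: "adm \<Gamma> R F1" "adm \<Gamma> R F2" and t: "0 \<le> t" "t < 1" and B: "B \<in> sets borel"
        "emeasure (law \<pi> F1 t) (UNIV - B) = 0" "emeasure (law \<pi> F2 t) B = 0" for R F1 F2 t B
    proof (rule pow_ent_mixture[OF ac[OF F(1) t] ac[OF F(2) t] ac[OF adm_mix[OF F] t] B _ n W_sets _ _ W_fin])
      show "mixture (law \<pi> (\<lambda>\<gamma>. (F1 \<gamma> + F2 \<gamma>) / 2) t) (law \<pi> F1 t) (law \<pi> F2 t)"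
        using t by (intro mixture_law[OF F]) simp
      show "emeasure (law \<pi> F1 t) (UNIV - W) = 0" "emeasure (law \<pi> F2 t) (UNIV - W) = 0"
        using t law_W[OF F(1), of t] law_W[OF F(2), of t] by auto
    qed
    show "- ln (measure m V) \<le> pow_ent n (law \<pi> F t)"
      if F: "adm \<Gamma> R F" and t: "0 \<le> t" "t < 1" and V: "V \<in> sets borel" "V \<subseteq> W" "emeasure (law \<pi> F t) (UNIV - V) = 0" for R F t V
      using emeasure_mono[OF V(2), of m] W_sets W_fin
      by (intro pow_ent_lower[OF ac[OF F t] n V(1,3)]) auto
    show "pow_ent n (law \<pi> F 0) \<le> - ln (measure m E)"
      if "adm \<Gamma> R F" "E \<in> sets borel" "E \<subseteq> W" "0 < measure m E"
        "law \<pi> F 0 = density m (\<lambda>x. ennreal (indicator E x / measure m E))" for R F E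
      using pow_ent_uniform[OF that(2,4,5) n] by simp
  qed
qed

section \<open>The locale \<open>entropy_plan\<close> for infinite N\<close>

lemma Ent_inf_pi_le:
  assumes s: "sets \<psi> = sets (GeoM :: (real \<Rightarrow> 'a) measure)" and p: "prob_space \<psi>"
    and D: "AE \<gamma> in \<psi>. dist (\<gamma> 0) (\<gamma> 1) \<le> D" and f: "fin_ent (marg \<psi> 0)" and \<tau>: "0 \<le> \<tau>" "\<tau> \<le> 1"
  shows "Ent_inf_pi m K \<tau> \<psi> (marg \<psi> 0) \<le> ereal (log_ent (marg \<psi> 0) + \<bar>K\<bar> / 6 * D\<^sup>2 * (1 - \<tau>\<^sup>2))"
proof -
  interpret \<psi>: prob_space \<psi> by fact
  define \<mu> where "\<mu> = marg \<psi> 0"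
  define \<rho> where "\<rho> = dens m \<mu>"
  have a: "ac \<mu>" and i: "integrable m (\<lambda>x. \<rho> x * ln (\<rho> x))" using f by (auto simp: fin_ent_def \<mu>_def \<rho>_def)
  have rm[measurable]: "\<rho> \<in> borel_measurable borel" and r0: "\<And>x. 0 \<le> \<rho> x" and \<mu>d: "\<mu> = density m (\<lambda>x. ennreal (\<rho> x))"
    using dens_ac(1-3)[OF a] by (simp_all only: \<rho>_def)
  have ev[measurable]: "(\<lambda>\<gamma>. \<gamma> 0) \<in> \<psi> \<rightarrow>\<^sub>M borel" "(\<lambda>\<gamma>. \<gamma> 1) \<in> \<psi> \<rightarrow>\<^sub>M borel"
    using measurable_eval[of 0] measurable_eval[of 1] by (simp_all add: measurable_cong_sets[OF s refl])
  have \<mu>m: "\<mu> = distr \<psi> borel (\<lambda>\<gamma>. \<gamma> 0)" by (simp add: \<mu>_def marg_def)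
  \<comment> \<open>A density is positive almost everywhere for its own law, so the logarithm of the
    quotient by \<open>beta_inf\<close> splits.\<close>
  have "AE x in \<mu>. 0 < \<rho> x"
    unfolding \<mu>d by (subst AE_density) auto
  then have pos: "AE \<gamma> in \<psi>. 0 < \<rho> (\<gamma> 0)"
    unfolding \<mu>m by (subst (asm) AE_distr_iff) auto
  \<comment> \<open>The logarithm of the distortion coefficient, bounded through the length bound
    \<open>D\<close>.\<close>
  define k where "k \<gamma> = K / 6 * (1 - \<tau>\<^sup>2) * (dist (\<gamma> 0) (\<gamma> 1))\<^sup>2" for \<gamma> :: "real \<Rightarrow> 'a"
  have km[measurable]: "k \<in> borel_measurable \<psi>" unfolding k_def[abs_def] by measurable
  have \<tau>2: "0 \<le> 1 - \<tau>\<^sup>2" using \<tau> by (simp add: power_le_one)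
  have kb: "AE \<gamma> in \<psi>. \<bar>k \<gamma>\<bar> \<le> \<bar>K\<bar> / 6 * D\<^sup>2 * (1 - \<tau>\<^sup>2)"
    using D
  proof eventually_elim
    fix \<gamma> :: "real \<Rightarrow> 'a" assume "dist (\<gamma> 0) (\<gamma> 1) \<le> D"
    then have "(dist (\<gamma> 0) (\<gamma> 1))\<^sup>2 \<le> D\<^sup>2" by (intro power_mono) auto
    then have "\<bar>K\<bar> / 6 * (1 - \<tau>\<^sup>2) * (dist (\<gamma> 0) (\<gamma> 1))\<^sup>2 \<le> \<bar>K\<bar> / 6 * (1 - \<tau>\<^sup>2) * D\<^sup>2"
      using \<tau>2 by (intro mult_left_mono) auto
    then show "\<bar>k \<gamma>\<bar> \<le> \<bar>K\<bar> / 6 * D\<^sup>2 * (1 - \<tau>\<^sup>2)"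
      using \<tau>2 by (simp add: k_def abs_mult mult_ac)
  qed
  have ki: "integrable \<psi> k" using kb by (intro \<psi>.integrable_const_bound[where B = "\<bar>K\<bar> / 6 * D\<^sup>2 * (1 - \<tau>\<^sup>2)"]) auto
  have li: "integrable \<mu> (\<lambda>x. ln (\<rho> x))"
    unfolding \<mu>d using i r0 by (subst integrable_density) auto
  have lI: "(\<integral>x. ln (\<rho> x) \<partial>\<mu>) = log_ent \<mu>"
    unfolding log_ent_def \<rho>_def[symmetric] using r0 by (subst \<mu>d, subst integral_density) auto
  have li': "integrable \<psi> (\<lambda>\<gamma>. ln (\<rho> (\<gamma> 0)))"
    using li unfolding \<mu>m by (subst (asm) integrable_distr_eq) auto
  have lI': "(\<integral>\<gamma>. ln (\<rho> (\<gamma> 0)) \<partial>\<psi>) = log_ent \<mu>"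
    using lI unfolding \<mu>m by (subst (asm) integral_distr) auto
  have "eint \<psi> (\<lambda>\<gamma>. ln (\<rho> (\<gamma> 0) / beta_inf K \<tau> (dist (\<gamma> 0) (\<gamma> 1)))) = eint \<psi> (\<lambda>\<gamma>. ln (\<rho> (\<gamma> 0)) - k \<gamma>)"
    by (rule eint_cong_AE, rule eventually_mono[OF pos]) (simp add: beta_inf_def k_def ln_div)
  also have "\<dots> = ereal (\<integral>\<gamma>. ln (\<rho> (\<gamma> 0)) - k \<gamma> \<partial>\<psi>)"
    using li' ki by (intro eint_integrable) simp
  also have "(\<integral>\<gamma>. ln (\<rho> (\<gamma> 0)) - k \<gamma> \<partial>\<psi>) = log_ent \<mu> - (\<integral>\<gamma>. k \<gamma> \<partial>\<psi>)"
    using li' ki lI' by simp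
  also have "\<dots> \<le> log_ent \<mu> + \<bar>K\<bar> / 6 * D\<^sup>2 * (1 - \<tau>\<^sup>2)"
  proof -
    have "(\<integral>\<gamma>. - k \<gamma> \<partial>\<psi>) \<le> (\<integral>\<gamma>. \<bar>K\<bar> / 6 * D\<^sup>2 * (1 - \<tau>\<^sup>2) \<partial>\<psi>)"
      using kb ki by (intro integral_mono_AE) (auto elim!: eventually_mono)
    then show ?thesis using ki by (simp add: \<psi>.prob_space)
  qed
  finally show ?thesis
    using dens_ac(5)[OF a] by (simp add: Ent_inf_pi_def \<mu>_def \<rho>_def)
qed

text \<open>The distortion errors add up by
  \<open>(1 - t) * (1 - (1 - t)^2) + t * (1 - t^2) = 3 * t * (1 - t)\<close>, and the constant is
  rounded up to 4. Unlike the power integrals, logarithmic entropies have no fixed sign, so both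
  ends stay in the estimate.\<close>

lemma Ent_inf_step:
  assumes plan: "CD_plan m K \<infinity> \<pi>" and F: "adm \<Gamma> R F" and t: "0 \<le> t1" "t1 < t2" "t2 \<le> 1" "0 \<le> t" "t \<le> 1"
    and f: "fin_ent (law \<pi> F t1)" "fin_ent (law \<pi> F t2)"
  shows "Ent_inf m (law \<pi> F (t * t2 + (1 - t) * t1)) \<le>
    ereal ((1 - t) * log_ent (law \<pi> F t1) + t * log_ent (law \<pi> F t2) + 4 * (\<bar>K\<bar> / 6 * D\<^sup>2) * (t * (1 - t)))"
proof -
  define \<psi> where "\<psi> = pi_tilde \<pi> F t1 t2"
  define \<psi>r where "\<psi>r = distr \<psi> GeoM reverse"
  define k where "k = \<bar>K\<bar> / 6 * D\<^sup>2"
  have t01: "t1 \<in> {0..1}" "t2 \<in> {0..1}" "t \<in> {0..1}" using t by auto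
  have s: "sets \<psi> = sets GeoM" by (simp add: \<psi>_def sets_pi_tilde)
  have sr: "sets \<psi>r = sets GeoM" by (simp add: \<psi>r_def)
  have D\<psi>: "AE \<gamma> in \<psi>. dist (\<gamma> 0) (\<gamma> 1) \<le> D"
    unfolding \<psi>_def by (rule AE_length_pi_tilde[OF F \<Gamma>_D t01(1,2)])
  have Dr: "AE \<gamma> in \<psi>r. dist (\<gamma> 0) (\<gamma> 1) \<le> D"
    unfolding \<psi>r_def by (rule AE_length_reverse[OF s D\<psi>])
  have p: "prob_space \<psi>" unfolding \<psi>_def by (rule prob_space_pi_tilde[OF F t01(1,2)])
  have pr: "prob_space \<psi>r" unfolding \<psi>r_def
    by (rule prob_space.prob_space_distr[OF p]) (simp add: measurable_cong_sets[OF s refl] reverse_measurable)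
  have m0: "marg \<psi> 0 = law \<pi> F t1" and m1: "marg \<psi> 1 = law \<pi> F t2" and mt: "marg \<psi> t = law \<pi> F (t * t2 + (1 - t) * t1)"
    unfolding \<psi>_def using marg_pi_tilde[OF admD(1)[OF F] t01(1,2), of 0] marg_pi_tilde[OF admD(1)[OF F] t01(1,2), of 1]
      marg_pi_tilde[OF admD(1)[OF F] t01(1,2), of t] t01 by simp_all
  have mr: "marg \<psi>r 0 = law \<pi> F t2" unfolding \<psi>r_def marg_reverse[OF s] m1 ..
  have cond: "admissible_density \<pi> F \<and> 0 \<le> t1 \<and> t1 < t2 \<and> t2 \<le> 1 \<and> 0 \<le> t \<and> t \<le> 1"
    using admD(6)[OF F] t by simp
  have "Ent_inf m (marg \<psi> t) \<le> ereal (1 - t) * Ent_inf_pi m K (1 - t) \<psi> (marg \<psi> 0) + ereal t * Ent_inf_pi m K t \<psi>r (marg \<psi> 1)"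
    using plan cond unfolding CD_plan_def Let_def by (simp add: \<psi>_def \<psi>r_def)
  also have "\<dots> \<le> ereal (1 - t) * ereal (log_ent (law \<pi> F t1) + k * (1 - (1 - t)\<^sup>2)) + ereal t * ereal (log_ent (law \<pi> F t2) + k * (1 - t\<^sup>2))"
    using t f Ent_inf_pi_le[OF s p D\<psi>, of "1 - t" K] Ent_inf_pi_le[OF sr pr Dr, of t K]
    by (intro add_mono ereal_mult_left_mono) (auto simp: m0 m1 mr k_def)
  also have "\<dots> = ereal ((1 - t) * log_ent (law \<pi> F t1) + t * log_ent (law \<pi> F t2) + k * (3 * (t * (1 - t))))"
    by (simp add: algebra_simps power2_eq_square)
  also have "\<dots> \<le> ereal ((1 - t) * log_ent (law \<pi> F t1) + t * log_ent (law \<pi> F t2) + 4 * k * (t * (1 - t)))"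
    using t by (simp add: k_def mult_right_mono)
  finally show ?thesis by (simp add: mt k_def)
qed

lemma adm_mono: "adm \<Gamma> R F \<Longrightarrow> R \<le> R' \<Longrightarrow> adm \<Gamma> R' F"
  by (auto simp: adm_def intro: order_trans)

lemma log_ent_end:
  assumes F: "adm \<Gamma> R F" and R: "1 \<le> R" and e: "e \<in> {0, 1}"
  shows "fin_ent (law \<pi> F e)" "log_ent (law \<pi> F e) \<le> ln R + ln c1"
proof -
  have Rc: "1 \<le> R * c1" using R c1 mult_mono[of 1 R 1 c1] by simp
  have e01: "e \<in> {0..1}" using e by auto
  have le: "AE x in m. dens m (law \<pi> F e) x \<le> R * c1"
    using Rc by (intro dens_le[OF ac_law_end[OF F e]] ends_bound[OF F e]) auto
  note u = log_ent_upper[OF ac_law_end[OF F e] W_sets law_W[OF F e01] W_fin Rc le]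
  show "fin_ent (law \<pi> F e)" by (rule u(1))
  show "log_ent (law \<pi> F e) \<le> ln R + ln c1" using u(2) R c1 by (simp add: ln_mult)
qed

text \<open>Interpolation between times 0 and 1, where bounded densities give finite entropy, bounds
  \<open>Ent_inf\<close> at time \<open>t\<close> for every admissible plan. The conditioned plan of
  \<open>not_ac_plan\<close> would have an infinite value there, so the law is absolutely
  continuous.\<close>

lemma fin_ent_law:
  assumes plan: "CD_plan m K \<infinity> \<pi>" and F: "adm \<Gamma> R F" and t: "0 \<le> t" "t \<le> 1"
  shows "fin_ent (law \<pi> F t)"
proof -
  have t01: "t \<in> {0..1}" using t by simp
  have bnd: "\<exists>c. Ent_inf m (law \<pi> F' t) \<le> ereal c" if F': "adm \<Gamma> R' F'" for R' F'
  proof -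
    have F1: "adm \<Gamma> (max 1 R') F'" by (rule adm_mono[OF F']) simp
    show ?thesis
      using Ent_inf_step[OF plan F1, of 0 1 t] t log_ent_end(1)[OF F1, of 0] log_ent_end(1)[OF F1, of 1] by auto
  qed
  have "ac (law \<pi> F t)"
  proof (rule ccontr)
    assume "\<not> ac (law \<pi> F t)"
    then obtain R' F' A where F': "adm \<Gamma> R' F'" and A: "A \<in> null_sets m" "emeasure (law \<pi> F' t) (UNIV - A) = 0"
      using not_ac_plan[OF F t01] ac_law[OF F t01] by auto
    have "Ent_inf m (law \<pi> F' t) = \<infinity>"
      by (rule Ent_inf_singular[OF prob_space_law[OF F' t01] sets_law A])
    then show False using bnd[OF F'] by auto
  qed
  then show ?thesis
    using bnd[OF F] Ent_inf_le_fin_ent(1)[OF _ W_sets law_W[OF F t01] W_fin] by blast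
qed

lemma log_ent_step:
  assumes plan: "CD_plan m K \<infinity> \<pi>" and F: "adm \<Gamma> R F" and t: "0 \<le> t1" "t1 < t2" "t2 \<le> 1" "0 \<le> t" "t \<le> 1"
  shows "log_ent (law \<pi> F (t * t2 + (1 - t) * t1)) \<le>
    (1 - t) * log_ent (law \<pi> F t1) + t * log_ent (law \<pi> F t2) + 4 * (\<bar>K\<bar> / 6 * D\<^sup>2) * (t * (1 - t))"
proof -
  have "t * t2 + (1 - t) * t1 \<in> {0..1}" using t by (intro affine_time) auto
  then show ?thesis
    using Ent_inf_step[OF plan F t] fin_ent_law[OF plan F] t Ent_inf_fin_ent[OF fin_ent_law[OF plan F, of "t * t2 + (1 - t) * t1"]]
    by auto
qed

text \<open>Writing \<open>H x\<close> for the entropy at time \<open>x\<close>, convexity gives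
  \<open>H y - H x \<le> t * (H e - H x + k)\<close> for an end \<open>e\<close> of the plan. There
  the density is at most \<open>R * c1\<close>, which is where \<open>ln R\<close> enters, while
  \<open>H x\<close> is at least \<open>- ln (measure m W)\<close>; the constant collects these
  bounds.\<close>

lemma entropy_plan_log:
  assumes plan: "CD_plan m K \<infinity> \<pi>"
  shows "entropy_plan \<pi> m \<Gamma> W D (1 + ln c1 + \<bar>ln (measure m W)\<bar> + 4 * (\<bar>K\<bar> / 6 * D\<^sup>2)) log_ent"
proof -
  define k where "k = 4 * (\<bar>K\<bar> / 6 * D\<^sup>2)"
  define X where "X = ln c1 + \<bar>ln (measure m W)\<bar> + k"
  have k0: "0 \<le> k" by (simp add: k_def)
  have X0: "0 \<le> X" using c1 k0 by (simp add: X_def)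
  \<comment> \<open>The summand 1 takes care of the coefficient of \<open>ln R\<close>:
    \<open>ln R + X \<le> (1 + X) * (1 + ln R)\<close>.\<close>
  define C where "C = 1 + X"
  have CX: "1 + ln c1 + \<bar>ln (measure m W)\<bar> + 4 * (\<bar>K\<bar> / 6 * D\<^sup>2) = C"
    by (simp add: C_def X_def k_def)
  have C0: "0 \<le> C" using X0 by (simp add: C_def)
  note fin = fin_ent_law[OF plan]
  have ac: "ac (law \<pi> F t)" if "adm \<Gamma> R F" "0 \<le> t" "t \<le> 1" for R F t
    using fin[OF that] by (simp add: fin_ent_def)
  have lower: "- ln (measure m V) \<le> log_ent (law \<pi> F t)"
    if F: "adm \<Gamma> R F" and t: "0 \<le> t" "t \<le> 1" and V: "V \<in> sets borel" "V \<subseteq> W" "emeasure (law \<pi> F t) (UNIV - V) = 0" for R F t V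
    using emeasure_mono[OF V(2), of m] W_sets W_fin
    by (intro log_ent_lower[OF fin[OF F t] V(1,3)]) auto
  have key: "log_ent (law \<pi> F y) \<le> log_ent (law \<pi> F x) + C / \<delta> * h * (1 + ln R)"
    if F: "adm \<Gamma> R F" and R: "1 \<le> R" and \<delta>: "0 < \<delta>" and x: "0 \<le> x" "x \<le> 1" and e: "e \<in> {0, 1}"
      and le: "log_ent (law \<pi> F y) \<le> (1 - t) * log_ent (law \<pi> F x) + t * log_ent (law \<pi> F e) + k * (t * (1 - t))"
      and t: "0 \<le> t" "t \<le> 1" "t \<le> h / \<delta>" for R F \<delta> x y e t h
  proof -
    have lnR: "0 \<le> ln R" using R by simp
    have xx: "x \<in> {0..1}" using x by simp
    have "- \<bar>ln (measure m W)\<bar> \<le> log_ent (law \<pi> F x)"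
      using lower[OF F x W_sets order_refl law_W[OF F xx]] by linarith
    moreover have "log_ent (law \<pi> F e) \<le> ln R + ln c1" by (rule log_ent_end(2)[OF F R e])
    ultimately have "log_ent (law \<pi> F e) - log_ent (law \<pi> F x) + k \<le> ln R + X" by (simp add: X_def)
    also have "\<dots> \<le> C * (1 + ln R)"
      using X0 lnR mult_nonneg_nonneg[OF X0 lnR] by (simp add: C_def algebra_simps)
    finally have 1: "t * (log_ent (law \<pi> F e) - log_ent (law \<pi> F x) + k) \<le> t * (C * (1 + ln R))"
      using t by (intro mult_left_mono) auto
    have "t * (C * (1 + ln R)) \<le> h / \<delta> * (C * (1 + ln R))"
      using t C0 lnR by (intro mult_right_mono) auto
    moreover have "k * (t * (1 - t)) \<le> k * t"
      using k0 t by (intro mult_left_mono) (auto simp: mult_left_le)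
    ultimately have "log_ent (law \<pi> F y) \<le> log_ent (law \<pi> F x) + h / \<delta> * (C * (1 + ln R))"
      using le 1 by (simp add: algebra_simps)
    then show ?thesis by (simp add: mult_ac)
  qed
  have e0: "(0::real) \<in> {0, 1}" and e1: "(1::real) \<in> {0, 1}" by simp_all
  show ?thesis unfolding CX
  proof (intro entropy_plan.intro entropy_plan_axioms.intro)
    show "geodesic_plan \<pi>" by (rule geodesic_plan_axioms)
    show "sets m = sets borel" "\<Gamma> \<in> sets GeoM" "W \<in> sets borel" "emeasure m W < \<infinity>" "0 \<le> C" "sigma_finite_measure m"
      using \<Gamma>_sets W_sets W_fin C0 sigma_finite_measure_axioms by simp_all
    show "\<gamma> t \<in> W" if "\<gamma> \<in> \<Gamma>" "t \<in> {0..1}" for \<gamma> t by (rule \<Gamma>_W[OF that])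
    show "dist (\<gamma> 0) (\<gamma> 1) \<le> D" if "\<gamma> \<in> \<Gamma>" for \<gamma> by (rule \<Gamma>_D[OF that])
    show "absolutely_continuous m (law \<pi> F 0)" if "adm \<Gamma> R F" for R F
      using ac_law_end[OF that, of 0] by (simp add: ac_def)
    show "log_ent (law \<pi> F b) \<le> log_ent (law \<pi> F a) + C / \<delta> * (b - a) * (1 + ln R)"
      if F: "adm \<Gamma> R F" and R: "1 \<le> R" and \<delta>: "0 < \<delta>" and ab: "0 \<le> a" "a \<le> b" "b \<le> 1 - \<delta>" "b - a \<le> \<delta> / 2" for R F \<delta> a b
    proof -
      define t where "t = (b - a) / (1 - a)"
      have a1: "\<delta> \<le> 1 - a" using ab by linarith
      have tle: "t \<le> (b - a) / \<delta>" unfolding t_def using a1 \<delta> ab by (intro divide_left_mono) auto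
      have t: "0 \<le> t" "t \<le> 1" using ab a1 \<delta> by (auto simp: t_def divide_le_eq)
      have mid: "t * 1 + (1 - t) * a = b"
      proof -
        have "t * (1 - a) = b - a" using a1 \<delta> by (simp add: t_def)
        then show ?thesis by (simp add: algebra_simps)
      qed
      show ?thesis
        using log_ent_step[OF plan F, of a 1 t] ab a1 \<delta> t unfolding mid k_def[symmetric]
        by (intro key[OF F R \<delta> _ _ e1 _ t tle]) auto
    qed
    show "log_ent (law \<pi> F a) \<le> log_ent (law \<pi> F b) + C / \<delta> * (b - a) * (1 + ln R)"
      if F: "adm \<Gamma> R F" and R: "1 \<le> R" and \<delta>: "0 < \<delta>" and ab: "\<delta> \<le> a" "a \<le> b" "b \<le> 1 - \<delta>" "b - a \<le> \<delta> / 2" for R F \<delta> a b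
    proof -
      \<comment> \<open>Here \<open>t\<close> is the weight of the end at time 0; the interpolation
        parameter on \<open>[0, b]\<close> is \<open>1 - t\<close>.\<close>
      define t where "t = (b - a) / b"
      have b: "\<delta> \<le> b" using ab by linarith
      have tle: "t \<le> (b - a) / \<delta>" unfolding t_def using b \<delta> ab by (intro divide_left_mono) auto
      have t: "0 \<le> t" "t \<le> 1" using ab b \<delta> by (auto simp: t_def divide_le_eq)
      have mid: "(1 - t) * b + (1 - (1 - t)) * 0 = a" using b \<delta> by (simp add: t_def field_simps)
      show ?thesis
        using log_ent_step[OF plan F, of 0 b "1 - t"] ab b \<delta> t unfolding mid k_def[symmetric]
        by (intro key[OF F R \<delta> _ _ e0 _ t tle]) (auto simp: mult_ac add_ac)
    qed
    show "log_ent (law \<pi> (\<lambda>\<gamma>. (F1 \<gamma> + F2 \<gamma>) / 2) t) \<le> (log_ent (law \<pi> F1 t) + log_ent (law \<pi> F2 t)) / 2 - ln 2"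
      if F: "adm \<Gamma> R F1" "adm \<Gamma> R F2" and t: "0 \<le> t" "t < 1" and B: "B \<in> sets borel"
        "emeasure (law \<pi> F1 t) (UNIV - B) = 0" "emeasure (law \<pi> F2 t) B = 0" for R F1 F2 t B
    proof -
      have t1: "t \<le> 1" and t01: "t \<in> {0..1}" using t by auto
      show ?thesis
        using log_ent_mixture[OF fin[OF F(1) t(1) t1] fin[OF F(2) t(1) t1] ac[OF adm_mix[OF F] t(1) t1] B mixture_law[OF F t01]]
        by simp
    qed
    show "- ln (measure m V) \<le> log_ent (law \<pi> F t)"
      if F: "adm \<Gamma> R F" and t: "0 \<le> t" "t < 1" and V: "V \<in> sets borel" "V \<subseteq> W" "emeasure (law \<pi> F t) (UNIV - V) = 0" for R F t V
      using t by (intro lower[OF F t(1) _ V]) simp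
    show "log_ent (law \<pi> F 0) \<le> - ln (measure m E)"
      if "adm \<Gamma> R F" "E \<in> sets borel" "E \<subseteq> W" "0 < measure m E"
        "law \<pi> F 0 = density m (\<lambda>x. ennreal (indicator E x / measure m E))" for R F E
      using log_ent_uniform[OF that(2,4,5)] by simp
  qed
qed

end

section \<open>Exhaustion and conclusion\<close>

text \<open>Local finiteness and the Lindelof property; finite unions make the sequence increasing.
  Openness is kept so that \<open>geo_open_within\<close> applies to each member.\<close>

lemma finite_exhaustion:
  fixes m :: "'a::polish_space measure"
  assumes "mm_space m"
  shows "\<exists>W :: nat \<Rightarrow> 'a set. (\<forall>k. open (W k)) \<and> incseq W \<and> (\<Union>k. W k) = UNIV \<and> (\<forall>k. emeasure m (W k) < \<infinity>)"
proof -
  have sm: "sets m = sets borel" using assms by (simp add: mm_space_def)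
  define \<U> where "\<U> = {U. open U \<and> emeasure m U < \<infinity>}"
  have "\<Union>\<U> = UNIV" using assms by (fastforce simp: \<U>_def mm_space_def)
  moreover obtain \<V> where V: "\<V> \<subseteq> \<U>" "countable \<V>" "\<Union>\<V> = \<Union>\<U>"
    using Lindelof[of \<U>] by (auto simp: \<U>_def)
  ultimately have VU: "\<Union>\<V> = UNIV" by simp
  then have ne: "\<V> \<noteq> {}" by auto
  define U where "U = from_nat_into \<V>"
  have U: "U k \<in> \<U>" for k using from_nat_into[OF ne] V(1) by (auto simp: U_def)
  define W where "W k = (\<Union>i<k. U i)" for k
  have "open (W k)" for k using U by (auto simp: W_def \<U>_def)
  moreover have "incseq W" by (auto simp: incseq_def W_def intro: less_le_trans)
  moreover have "(\<Union>k. W k) = UNIV"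
  proof -
    have "x \<in> (\<Union>k. W k)" for x
    proof -
      obtain V where "V \<in> \<V>" "x \<in> V" using VU by blast
      then obtain i where "U i = V" using from_nat_into_surj[OF V(2)] by (auto simp: U_def)
      then have "x \<in> W (Suc i)" using \<open>x \<in> V\<close> by (auto simp: W_def)
      then show ?thesis by blast
    qed
    then show ?thesis by blast
  qed
  moreover have "emeasure m (W k) < \<infinity>" for k
  proof -
    have "emeasure m (W k) \<le> (\<Sum>i<k. emeasure m (U i))"
      unfolding W_def using U by (intro emeasure_subadditive_finite) (auto simp: \<U>_def sm)
    also have "\<dots> < \<infinity>" using U by (auto simp: \<U>_def)
    finally show ?thesis .
  qed
  ultimately show ?thesis by blast
qed

lemma reference_measure_mm:
  fixes m :: "'a::polish_space measure"
  assumes "mm_space m"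
  shows "reference_measure m"
proof -
  have sm: "sets m = sets borel" using assms by (simp add: mm_space_def)
  then have sp: "space m = UNIV" using sets_eq_imp_space_eq[OF sm] by simp
  obtain W :: "nat \<Rightarrow> 'a set" where W: "\<And>k. open (W k)" "(\<Union>k. W k) = UNIV" "\<And>k. emeasure m (W k) < \<infinity>"
    using finite_exhaustion[OF assms] by blast
  have "sigma_finite_measure m"
  proof
    show "\<exists>A. countable A \<and> A \<subseteq> sets m \<and> \<Union>A = space m \<and> (\<forall>a\<in>A. emeasure m a \<noteq> \<infinity>)"
      using W by (intro exI[of _ "range W"]) (auto simp: sm sp less_top)
  qed
  then show ?thesis using sm by (intro reference_measure.intro reference_measure_axioms.intro)
qed

lemma compact_image_Geo:
  assumes "\<gamma> \<in> Geo"
  shows "compact (\<gamma> ` {0..1})"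
proof (rule compact_continuous_image)
  have "(dist (\<gamma> 0) (\<gamma> 1))-lipschitz_on {0..1} \<gamma>"
  proof (rule lipschitz_onI)
    fix s t :: real assume "s \<in> {0..1}" "t \<in> {0..1}"
    then show "dist (\<gamma> s) (\<gamma> t) \<le> dist (\<gamma> 0) (\<gamma> 1) * dist s t"
      using Geo_dist[OF assms, of s t] by (simp add: dist_real_def mult.commute)
  qed simp
  then show "continuous_on {0..1} \<gamma>" by (rule lipschitz_on_continuous_on)
qed simp

text \<open>The trace of a geodesic is compact, so a uniform neighbourhood of it stays in
  \<open>W\<close>. This makes confinement of the whole path to \<open>W\<close> a measurable
  condition.\<close>

lemma geo_open_within:
  assumes "open W"
  shows "geo_open {\<gamma> \<in> Geo. \<gamma> ` {0..1} \<subseteq> W}"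
  unfolding geo_open_def
proof safe
  fix \<gamma> :: "real \<Rightarrow> 'a" assume \<gamma>: "\<gamma> \<in> Geo" "\<gamma> ` {0..1} \<subseteq> W"
  obtain e where e: "e > 0" "(\<Union>x\<in>\<gamma> ` {0..1}. ball x e) \<subseteq> W"
    using compact_subset_open_imp_ball_epsilon_subset[OF compact_image_Geo[OF \<gamma>(1)] assms \<gamma>(2)] by blast
  show "\<exists>e>0. \<forall>\<eta>\<in>Geo. supdist \<gamma> \<eta> < e \<longrightarrow> \<eta> \<in> {\<gamma> \<in> Geo. \<gamma> ` {0..1} \<subseteq> W}"
  proof (intro exI[of _ e] conjI ballI impI e(1))
    fix \<eta> :: "real \<Rightarrow> 'a" assume \<eta>: "\<eta> \<in> Geo" "supdist \<gamma> \<eta> < e"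
    have "\<eta> t \<in> W" if "t \<in> {0..1}" for t
    proof -
      have "\<eta> t \<in> ball (\<gamma> t) e" using dist_le_supdist[OF \<gamma>(1) \<eta>(1) that] \<eta>(2) by simp
      then show ?thesis using e(2) that by blast
    qed
    then show "\<eta> \<in> {\<gamma> \<in> Geo. \<gamma> ` {0..1} \<subseteq> W}" using \<eta>(1) by blast
  qed
qed

lemma Geo_in_exhaustion:
  fixes W :: "nat \<Rightarrow> 'a::metric_space set"
  assumes "\<gamma> \<in> Geo" and W: "\<And>k. open (W k)" "incseq W" "(\<Union>k. W k) = UNIV"
  shows "\<exists>k. \<gamma> ` {0..1} \<subseteq> W k"
proof -
  obtain I where I: "finite I" "\<gamma> ` {0..1} \<subseteq> (\<Union>i\<in>I. W i)"
    using compactE_image[OF compact_image_Geo[OF assms(1)], of UNIV W] W by auto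
  have "W i \<subseteq> W (Max (insert 0 I))" if "i \<in> I" for i
    using I(1) that by (intro incseqD[OF W(2)]) auto
  then show ?thesis using I(2) by blast
qed

context geodesic_plan
begin

text \<open>The predictors for different \<open>k\<close> need not be compatible and are not glued.
  The one for \<open>\<Gamma> k\<close> has error at most the mass outside \<open>\<Gamma> k\<close>
  under \<open>\<pi>\<close>, which tends to 0, and \<open>predictable_limit\<close>
  applies.\<close>

lemma determined_of_exhaustion:
  assumes \<Gamma>: "\<And>k. \<Gamma> k \<in> sets GeoM" "incseq \<Gamma>" "AE \<gamma> in \<pi>. \<exists>k. \<gamma> \<in> \<Gamma> k"
    and pr: "\<And>k. predictable (density \<pi> (indicator (\<Gamma> k))) (\<lambda>\<gamma>. \<gamma> 0) borel (thru s B) 0"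
    and s: "s \<in> {0..1}" and B: "B \<in> sets borel"
  shows "\<exists>A\<in>sets borel. AE \<gamma> in \<pi>. \<gamma> 0 \<in> A \<longleftrightarrow> \<gamma> s \<in> B"
proof -
  have zero: "(0::real) \<in> {0..1}" by simp
  have em: "{\<gamma> \<in> Geo. (\<gamma> 0 \<in> A) \<noteq> (\<gamma> s \<in> B)} \<in> sets \<pi>" if "A \<in> sets borel" for A
  proof -
    note [measurable] = measurable_eval[OF zero] measurable_eval[OF s] B that
    have "{\<gamma> \<in> space GeoM. (\<gamma> 0 \<in> A) \<noteq> (\<gamma> s \<in> B)} \<in> sets GeoM" by measurable
    then show ?thesis by simp
  qed
  have ev: "{\<gamma> \<in> space \<pi>. (\<gamma> 0 \<in> A) \<noteq> (\<gamma> \<in> thru s B)} = {\<gamma> \<in> Geo. (\<gamma> 0 \<in> A) \<noteq> (\<gamma> s \<in> B)}" for A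
    by (auto simp: thru_def)
  have "predictable \<pi> (\<lambda>\<gamma>. \<gamma> 0) borel (thru s B) 0"
  proof (rule predictable_limit)
    show "finite_measure \<pi>" by unfold_locales
    show "(\<lambda>\<gamma>. \<gamma> 0) \<in> \<pi> \<rightarrow>\<^sub>M borel" by (rule measurable_eval_plan[OF zero])
    show "thru s B \<in> sets \<pi>" using thru_sets[OF s B] by simp
    fix \<epsilon> :: real assume \<epsilon>: "\<epsilon> > 0"
    have "(\<lambda>k. measure \<pi> (Geo - \<Gamma> k)) \<longlonglongrightarrow> measure \<pi> (\<Inter>k. Geo - \<Gamma> k)"
    proof (rule finite_Lim_measure_decseq)
      show "range (\<lambda>k. Geo - \<Gamma> k) \<subseteq> sets \<pi>"
        using \<Gamma>(1) sets.compl_sets[of _ "GeoM :: (real \<Rightarrow> 'a) measure"] by auto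
      show "decseq (\<lambda>k. Geo - \<Gamma> k)" using \<Gamma>(2) by (auto simp: decseq_def incseq_def)
    qed
    moreover have "measure \<pi> (\<Inter>k. Geo - \<Gamma> k) = 0"
    proof -
      have "{\<gamma> \<in> space \<pi>. \<not> (\<exists>k. \<gamma> \<in> \<Gamma> k)} = (\<Inter>k. Geo - \<Gamma> k)" by auto
      moreover have "(\<Inter>k. Geo - \<Gamma> k) \<in> sets \<pi>"
        using \<Gamma>(1) sets.compl_sets[of _ "GeoM :: (real \<Rightarrow> 'a) measure"] by (intro sets.countable_INT) auto
      ultimately have "emeasure \<pi> (\<Inter>k. Geo - \<Gamma> k) = 0"
        using AE_iff_measurable[of "\<Inter>k. Geo - \<Gamma> k" \<pi> "\<lambda>\<gamma>. \<exists>k. \<gamma> \<in> \<Gamma> k"] \<Gamma>(3) by auto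
      then show ?thesis by (simp add: measure_def)
    qed
    ultimately have "(\<lambda>k. measure \<pi> (Geo - \<Gamma> k)) \<longlonglongrightarrow> 0" by simp
    then have "eventually (\<lambda>k. measure \<pi> (Geo - \<Gamma> k) < \<epsilon>) sequentially"
      using \<epsilon> by (intro order_tendstoD)
    then obtain k where k: "measure \<pi> (Geo - \<Gamma> k) < \<epsilon>" by (auto simp: eventually_sequentially)
    obtain A where A: "A \<in> sets borel" "emeasure (density \<pi> (indicator (\<Gamma> k))) {\<gamma> \<in> Geo. (\<gamma> 0 \<in> A) \<noteq> (\<gamma> s \<in> B)} \<le> 0"
      using pr[of k] unfolding predictable_def space_density ev by blast
    let ?E = "{\<gamma> \<in> Geo. (\<gamma> 0 \<in> A) \<noteq> (\<gamma> s \<in> B)}"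
    have E: "?E \<in> sets \<pi>" by (rule em[OF A(1)])
    have \<Gamma>k: "\<Gamma> k \<in> sets \<pi>" "Geo - \<Gamma> k \<in> sets \<pi>"
      using \<Gamma>(1) sets.compl_sets[of "\<Gamma> k" "GeoM :: (real \<Rightarrow> 'a) measure"] by auto
    have "emeasure (density \<pi> (indicator (\<Gamma> k))) ?E = (\<integral>\<^sup>+\<gamma>. indicator (\<Gamma> k) \<gamma> * indicator ?E \<gamma> \<partial>\<pi>)"
      using \<Gamma>k by (intro emeasure_density[OF _ E]) simp
    also have "\<dots> = (\<integral>\<^sup>+\<gamma>. indicator (\<Gamma> k \<inter> ?E) \<gamma> \<partial>\<pi>)"
      by (intro nn_integral_cong) (auto simp: indicator_def)
    also have "\<dots> = emeasure \<pi> (\<Gamma> k \<inter> ?E)"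
      using \<Gamma>k E by (intro nn_integral_indicator) auto
    finally have "emeasure \<pi> (\<Gamma> k \<inter> ?E) = 0" using A(2) by simp
    then have "emeasure \<pi> ((\<Gamma> k \<inter> ?E) \<union> (Geo - \<Gamma> k)) \<le> 0 + emeasure \<pi> (Geo - \<Gamma> k)"
      using emeasure_subadditive[of "\<Gamma> k \<inter> ?E" \<pi> "Geo - \<Gamma> k"] \<Gamma>k E by auto
    moreover have "emeasure \<pi> ?E \<le> emeasure \<pi> ((\<Gamma> k \<inter> ?E) \<union> (Geo - \<Gamma> k))"
      using \<Gamma>k E by (intro emeasure_mono) auto
    ultimately have "emeasure \<pi> ?E \<le> 0 + emeasure \<pi> (Geo - \<Gamma> k)" by order
    then have "emeasure \<pi> ?E \<le> emeasure \<pi> (Geo - \<Gamma> k)" by simp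
    also have "\<dots> \<le> ennreal \<epsilon>" using k by (simp add: emeasure_eq_measure ennreal_leI)
    finally show "predictable \<pi> (\<lambda>\<gamma>. \<gamma> 0) borel (thru s B) (ennreal \<epsilon>)"
      unfolding predictable_def ev using A(1) by blast
  qed
  then obtain A where A: "A \<in> sets borel" "emeasure \<pi> {\<gamma> \<in> Geo. (\<gamma> 0 \<in> A) \<noteq> (\<gamma> s \<in> B)} = 0"
    unfolding predictable_def ev by auto
  have "AE \<gamma> in \<pi>. \<gamma> 0 \<in> A \<longleftrightarrow> \<gamma> s \<in> B"
    by (rule AE_I[OF _ A(2) em[OF A(1)]]) auto
  then show ?thesis using A(1) by blast
qed

text \<open>Where \<open>F\<close> is nonzero the geodesic lies in \<open>\<Gamma>\<close>, so its
  point at time \<open>e\<close> lies where the density is at most \<open>k\<close>; transporting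
  the bound \<open>F \<le> R\<close> to \<open>m\<close> yields the product of both
  constants.\<close>

lemma emeasure_law_le:
  assumes F: "adm \<Gamma> R F" and e: "e \<in> {0..1}" and A: "A \<in> sets borel"
    and \<rho>: "\<rho> \<in> borel_measurable borel" and \<mu>: "distr \<pi> borel (\<lambda>\<gamma>. \<gamma> e) = density m (\<lambda>x. ennreal (\<rho> x))"
    and m: "sets m = sets borel" and k: "\<And>\<gamma>. \<gamma> \<in> \<Gamma> \<Longrightarrow> \<rho> (\<gamma> e) \<le> k" and k0: "0 \<le> k"
  shows "emeasure (law \<pi> F e) A \<le> ennreal (R * k) * emeasure m A"
proof -
  have R: "0 \<le> R" using admD(2,3)[OF F] order_trans by blast
  define Q where "Q = {x \<in> A. \<rho> x \<le> k}"
  have Q: "Q \<in> sets borel"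
  proof -
    note [measurable] = \<rho> A
    have eq: "Q = A \<inter> {x \<in> space borel. \<rho> x \<le> k}" by (auto simp: Q_def)
    show ?thesis unfolding eq by measurable
  qed
  have "emeasure (law \<pi> F e) A = (\<integral>\<^sup>+\<gamma>. ennreal (F \<gamma>) * indicator A (\<gamma> e) \<partial>\<pi>)"
    by (rule emeasure_law[OF e admD(1)[OF F] A])
  also have "\<dots> \<le> (\<integral>\<^sup>+\<gamma>. ennreal R * indicator Q (\<gamma> e) \<partial>\<pi>)"
  proof (rule nn_integral_mono)
    fix \<gamma>
    show "ennreal (F \<gamma>) * indicator A (\<gamma> e) \<le> ennreal R * indicator Q (\<gamma> e)"
      using admD(3)[OF F, of \<gamma>] admD(4)[OF F, of \<gamma>] k[of \<gamma>]
      by (cases "\<gamma> \<in> \<Gamma>") (auto simp: Q_def indicator_def ennreal_leI)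
  qed
  also have "\<dots> = (\<integral>\<^sup>+x. ennreal R * indicator Q x \<partial>(distr \<pi> borel (\<lambda>\<gamma>. \<gamma> e)))"
    using Q by (intro nn_integral_distr[symmetric] measurable_eval_plan[OF e]) simp
  also have "\<dots> = (\<integral>\<^sup>+x. ennreal (\<rho> x) * (ennreal R * indicator Q x) \<partial>m)"
    unfolding \<mu> using \<rho> Q
    by (intro nn_integral_density) (simp_all add: measurable_cong_sets[OF m refl])
  also have "\<dots> \<le> (\<integral>\<^sup>+x. ennreal (R * k) * indicator A x \<partial>m)"
  proof (rule nn_integral_mono)
    fix x
    show "ennreal (\<rho> x) * (ennreal R * indicator Q x) \<le> ennreal (R * k) * indicator A x"
    proof (cases "x \<in> Q")
      case True
      then have "ennreal (\<rho> x) * ennreal R \<le> ennreal k * ennreal R"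
        by (intro mult_right_mono ennreal_leI) (auto simp: Q_def)
      then show ?thesis using True R k0 by (simp add: Q_def ennreal_mult mult.commute)
    qed simp
  qed
  also have "\<dots> = ennreal (R * k) * emeasure m A"
    using A m by (intro nn_integral_cmult_indicator) simp
  finally show ?thesis .
qed

end

theorem theorem3p1:
  fixes m :: "'a::polish_space measure" and K :: real and N :: ereal
    and \<mu>0 \<mu>1 :: "'a measure" and \<pi> :: "(real \<Rightarrow> 'a) measure"
  assumes "mm_space m"
    and "(1 < N \<and> N < \<infinity> \<and> very_strict_CDstar m K (real_of_ereal N)
            \<and> CDstar_plan m K (real_of_ereal N) \<pi>)
         \<or> (1 < N \<and> very_strict_CD m K N \<and> CD_plan m K N \<pi>)"
    and "P2ac m \<mu>0" and "P2ac m \<mu>1"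
    and "bounded_support \<mu>0" and "bounded_support \<mu>1"
    and "OptGeo \<mu>0 \<mu>1 \<pi>"
  shows "\<exists>T. T \<in> borel \<rightarrow>\<^sub>M GeoM \<and> (\<forall>x. T x \<in> Geo \<and> T x 0 = x) \<and> \<pi> = distr \<mu>0 GeoM T"
proof -
  interpret geodesic_plan \<pi>
    using assms(7) by (auto simp: OptGeo_def geodesic_plan_def geodesic_plan_axioms_def)
  interpret reference_measure m by (rule reference_measure_mm[OF assms(1)])
  have zero: "(0::real) \<in> {0..1}" and one: "(1::real) \<in> {0..1}" by simp_all
  note e0 = measurable_eval_plan[OF zero] and e1 = measurable_eval_plan[OF one]
  have pair: "(\<lambda>\<gamma>. (\<gamma> 0, \<gamma> 1)) \<in> \<pi> \<rightarrow>\<^sub>M borel"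
    using measurable_Pair[OF e0 e1] by (simp add: borel_prod)
  have marg0: "distr \<pi> borel (\<lambda>\<gamma>. \<gamma> 0) = \<mu>0"
  proof -
    have "distr (distr \<pi> borel (\<lambda>\<gamma>. (\<gamma> 0, \<gamma> 1))) borel fst = \<mu>0"
      using assms(7) by (simp add: OptGeo_def optimal_coupling_def coupling_def)
    then show ?thesis by (subst (asm) distr_distr[OF _ pair]) (simp_all add: comp_def borel_prod[symmetric])
  qed
  have marg1: "distr \<pi> borel (\<lambda>\<gamma>. \<gamma> 1) = \<mu>1"
  proof -
    have "distr (distr \<pi> borel (\<lambda>\<gamma>. (\<gamma> 0, \<gamma> 1))) borel snd = \<mu>1"
      using assms(7) by (simp add: OptGeo_def optimal_coupling_def coupling_def)
    then show ?thesis by (subst (asm) distr_distr[OF _ pair]) (simp_all add: comp_def borel_prod[symmetric])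
  qed
  have dens: "\<exists>\<rho>\<in>borel_measurable borel. \<mu> = density m (\<lambda>x. ennreal (\<rho> x))" if "P2ac m \<mu>" for \<mu>
    using real_valued_density[OF sigma_finite_measure_axioms, of \<mu>] that
    by (auto simp: P2ac_def P2_def prob_space_def)
  obtain \<rho>0 where \<rho>0[measurable]: "\<rho>0 \<in> borel_measurable borel" and \<mu>0: "\<mu>0 = density m (\<lambda>x. ennreal (\<rho>0 x))"
    using dens[OF assms(3)] by blast
  obtain \<rho>1 where \<rho>1[measurable]: "\<rho>1 \<in> borel_measurable borel" and \<mu>1: "\<mu>1 = density m (\<lambda>x. ennreal (\<rho>1 x))"
    using dens[OF assms(4)] by blast
  obtain B0 where B0: "bounded B0" "B0 \<in> sets borel" "emeasure \<mu>0 (UNIV - B0) = 0"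
    using assms(5) by (auto simp: bounded_support_def)
  obtain B1 where B1: "bounded B1" "B1 \<in> sets borel" "emeasure \<mu>1 (UNIV - B1) = 0"
    using assms(6) by (auto simp: bounded_support_def)
  have AEB: "AE \<gamma> in \<pi>. \<gamma> e \<in> B"
    if e: "e \<in> {0..1}" and \<mu>: "distr \<pi> borel (\<lambda>\<gamma>. \<gamma> e) = \<mu>" and B: "B \<in> sets borel" "emeasure \<mu> (UNIV - B) = 0" for e \<mu> B
  proof -
    have "emeasure \<pi> ((\<lambda>\<gamma>. \<gamma> e) -` (UNIV - B) \<inter> space \<pi>) = 0"
      using B unfolding \<mu>[symmetric] by (subst (asm) emeasure_distr[OF measurable_eval_plan[OF e]]) auto
    moreover have "(\<lambda>\<gamma>. \<gamma> e) -` (UNIV - B) \<inter> space \<pi> \<in> sets \<pi>"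
      using B by (intro measurable_sets[OF measurable_eval_plan[OF e]]) auto
    ultimately show ?thesis by (intro AE_I) auto
  qed
  obtain D0 where D0: "\<And>x y. x \<in> B0 \<union> B1 \<Longrightarrow> y \<in> B0 \<union> B1 \<Longrightarrow> dist x y \<le> D0"
    using B0(1) B1(1) bounded_two_points[of "B0 \<union> B1"] by auto
  define D where "D = max 0 D0"
  obtain W :: "nat \<Rightarrow> 'a set" where W: "\<And>k. open (W k)" "incseq W" "(\<Union>k. W k) = UNIV" "\<And>k. emeasure m (W k) < \<infinity>"
    using finite_exhaustion[OF assms(1)] by blast
  \<comment> \<open>The first set confines the whole trace to a set of finite measure. The
    conditions at the ends bound both densities and, through the bounded sets \<open>B0\<close> and
    \<open>B1\<close>, the length.\<close>
  define \<Gamma> where "\<Gamma> k = {\<gamma> \<in> Geo. \<gamma> ` {0..1} \<subseteq> W k} \<inter>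
    {\<gamma> \<in> space GeoM. \<gamma> 0 \<in> B0 \<and> \<gamma> 1 \<in> B1 \<and> \<rho>0 (\<gamma> 0) \<le> real k \<and> \<rho>1 (\<gamma> 1) \<le> real k}" for k
  have \<Gamma>s: "\<Gamma> k \<in> sets GeoM" for k
  proof -
    note [measurable] = measurable_eval[OF zero] measurable_eval[OF one] B0(2) B1(2)
    have "{\<gamma> \<in> space GeoM. \<gamma> 0 \<in> B0 \<and> \<gamma> 1 \<in> B1 \<and> \<rho>0 (\<gamma> 0) \<le> real k \<and> \<rho>1 (\<gamma> 1) \<le> real k} \<in> sets GeoM"
      by measurable
    then show ?thesis unfolding \<Gamma>_def using geo_open_sets[OF geo_open_within[OF W(1)]] by blast
  qed
  have \<Gamma>inc: "incseq \<Gamma>"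
  proof (rule incseq_SucI)
    fix k
    have "W k \<subseteq> W (Suc k)" using W(2) by (simp add: incseq_Suc_iff)
    then show "\<Gamma> k \<subseteq> \<Gamma> (Suc k)" by (auto simp: \<Gamma>_def)
  qed
  have \<Gamma>ae: "AE \<gamma> in \<pi>. \<exists>k. \<gamma> \<in> \<Gamma> k"
  proof -
    have "AE \<gamma> in \<pi>. \<gamma> \<in> Geo" by (rule AE_I2) simp
    moreover have "AE \<gamma> in \<pi>. \<gamma> 0 \<in> B0" by (rule AEB[OF zero marg0 B0(2,3)])
    moreover have "AE \<gamma> in \<pi>. \<gamma> 1 \<in> B1" by (rule AEB[OF one marg1 B1(2,3)])
    ultimately show ?thesis
    proof eventually_elim
      fix \<gamma> assume \<gamma>: "\<gamma> \<in> Geo" "\<gamma> 0 \<in> B0" "\<gamma> 1 \<in> B1"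
      obtain k1 where k1: "\<gamma> ` {0..1} \<subseteq> W k1" using Geo_in_exhaustion[OF \<gamma>(1) W(1-3)] by blast
      obtain k2 where k2: "max (\<rho>0 (\<gamma> 0)) (\<rho>1 (\<gamma> 1)) \<le> real k2" using real_arch_simple by blast
      have "W k1 \<subseteq> W (max k1 k2)" by (rule incseqD[OF W(2)]) simp
      then have "\<gamma> \<in> \<Gamma> (max k1 k2)" using \<gamma> k1 k2 by (auto simp: \<Gamma>_def)
      then show "\<exists>k. \<gamma> \<in> \<Gamma> k" ..
    qed
  qed
  have ps: "plan_setup \<pi> m (\<Gamma> k) (W k) D (max 1 (real k))" for k
  proof (intro plan_setup.intro plan_setup_axioms.intro)
    show "geodesic_plan \<pi>" "reference_measure m" by unfold_locales
    show "\<Gamma> k \<in> sets GeoM" by (rule \<Gamma>s)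
    show "W k \<in> sets borel" "emeasure m (W k) < \<infinity>" using W(1,4) by auto
    show "\<gamma> t \<in> W k" if "\<gamma> \<in> \<Gamma> k" "t \<in> {0..1}" for \<gamma> t using that by (auto simp: \<Gamma>_def)
    show "dist (\<gamma> 0) (\<gamma> 1) \<le> D" if "\<gamma> \<in> \<Gamma> k" for \<gamma>
      using that D0[of "\<gamma> 0" "\<gamma> 1"] by (auto simp: \<Gamma>_def D_def)
    show "0 \<le> D" "1 \<le> max 1 (real k)" by (simp_all add: D_def)
    show "emeasure (law \<pi> F e) A \<le> ennreal (R * max 1 (real k)) * emeasure m A"
      if F: "adm (\<Gamma> k) R F" and e: "e \<in> {0, 1}" and A: "A \<in> sets borel" for R F e A
    proof (cases "e = 0")
      case True
      then show ?thesis
        using F A \<rho>0 by (intro emeasure_law_le[OF F _ A \<rho>0]) (auto simp: marg0 \<mu>0[symmetric] \<Gamma>_def le_max_iff_disj)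
    next
      case False
      then have "e = 1" using e by simp
      then show ?thesis
        using F A \<rho>1 by (intro emeasure_law_le[OF F _ A \<rho>1]) (auto simp: marg1 \<mu>1[symmetric] \<Gamma>_def le_max_iff_disj)
    qed
  qed
  \<comment> \<open>The constant may vary with \<open>k\<close>: the prediction obtained from it has
    error 0 and no longer mentions it.\<close>
  have "\<exists>C H. entropy_plan \<pi> m (\<Gamma> k) (W k) D C H" for k
  proof (cases "N = \<infinity>")
    case True
    then have "CD_plan m K \<infinity> \<pi>" using assms(2) by auto
    then show ?thesis using plan_setup.entropy_plan_log[OF ps[of k]] by blast
  next
    case False
    define n where "n = real_of_ereal N"
    have N: "N = ereal n" using False assms(2) by (cases N) (auto simp: n_def)
    have n: "1 < n" using assms(2) unfolding N by auto
    have "CDstar_plan m K n \<pi> \<or> CD_plan m K (ereal n) \<pi>" using assms(2) unfolding N by auto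
    then show ?thesis using plan_setup.entropy_plan_power[OF ps[of k] _ n] by blast
  qed
  then have pr: "predictable (density \<pi> (indicator (\<Gamma> k))) (\<lambda>\<gamma>. \<gamma> 0) borel (thru s B) 0"
    if "0 < s" "s < 1" "B \<in> sets borel" for k s B
    using entropy_plan.initial_predictable[of \<pi> m "\<Gamma> k" "W k" D, OF _ that] by blast
  have "\<exists>A\<in>sets borel. AE \<gamma> in \<pi>. \<gamma> 0 \<in> A \<longleftrightarrow> \<gamma> s \<in> B" if s: "s \<in> {0..<1}" and B: "B \<in> sets borel" for s B
  proof (cases "s = 0")
    case True
    then show ?thesis using B by (intro bexI[of _ B]) auto
  next
    case False
    then show ?thesis
      using s B by (intro determined_of_exhaustion[OF \<Gamma>s \<Gamma>inc \<Gamma>ae] pr) auto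
  qed
  from induced_by_map[OF this] show ?thesis unfolding marg0 .
qed

end
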